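(* Let $n\ge1$ and $\mathbf{e}_n=\sum_{\alpha\models n}(-1)^{n-\ell(\alpha)}\mathbf{h}_\alpha$. The quantity $\langle\chi(\nabla(\mathbf{e}_n)),h_{1^n}\rangle$ is a $q,t$-analog of the number of preferential arrangements, i.e. it is a polynomial in $q,t$ whose value at $q=t=1$ is the number of maps $f:\{1,\dots,n\}\to\{1,\dots,k\}$, $1\le k\le n$, which are onto for some $k$ (that is, $\sum_{k=1}^n\#\{\text{surjections }\{1,\dots,n\}\to\{1,\dots,k\}\}$). Moreover, $$\langle\chi(\nabla(\mathbf{e}_n)),e_n\rangle=\prod_{i=1}^{n-1}(q^{n-i}+t^i),$$ which is a $q,t$-analog of $2^{n-1}$ (its value at $q=t=1$ is $2^{n-1}$).
   Context: A composition $\alpha$ of a positive integer $n$ ($\alpha\models n$) is a sequence $(\alpha_1,\dots,\alpha_\ell)$ of positive integers with sum $n$; $|\alpha|=n$, $\ell(\alpha)=\ell$. The descent set is $D(\alpha)=\{\alpha_1,\alpha_1+\alpha_2,\dots,\alpha_1+\cdots+\alpha_{\ell-1}\}\subseteq\{1,\dots,n-1\}$; $\alpha\mapsto D(\alpha)$ is a bijection onto subsets of $\{1,\dots,n-1\}$. For compositions of the same $n$, $\alpha\le\beta$ (equivalently $\beta\ge\alpha$) means $D(\beta)\subseteq D(\alpha)$. Involutions: $\overleftarrow{\alpha}=(\alpha_\ell,\dots,\alpha_1)$; $\alpha^c$ is the composition of $n$ with $D(\alpha^c)=\{1,\dots,n-1\}\setminus D(\alpha)$; $\alpha'=\overleftarrow{\alpha^c}$.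 Statistics: $n(\alpha)=\sum_{i\in D(\alpha)}i$, and for $\alpha,\beta\models n$, $c(\alpha,\beta)=\sum_{i\in D(\alpha)\cap D(\beta)} i$. $NC\Lambda$ is the free associative algebra on $\mathbf{h}_1,\mathbf{h}_2,\dots$ over $\mathbb{Q}$, with coefficients extended to $\mathbb{Q}(q,t)$. Put $\mathbf{h}_\alpha=\mathbf{h}_{\alpha_1}\cdots\mathbf{h}_{\alpha_\ell}$. The ribbon Schur functions are $\mathbf{s}_\alpha=\sum_{\beta\ge\alpha}(-1)^{\ell(\alpha)-\ell(\beta)}\mathbf{h}_\beta$. Define $\widetilde{\mathbf{H}}_\alpha^{qt}=\sum_{\beta\models|\alpha|}t^{c(\alpha,\beta)}q^{c(\alpha',\overleftarrow{\beta})}\,\mathbf{s}_\beta$; for $\alpha\models n$ these form a basis of the degree $n$ part of $NC\Lambda$ over $\mathbb{Q}(q,t)$. $\nabla$ is the linear operator on $NC\Lambda$ defined by $\nabla(\widetilde{\mathbf{H}}_\alpha^{qt})=t^{n(\alpha)}q^{n(\alpha')}\widetilde{\mathbf{H}}_\alpha^{qt}$ for all compositions $\alpha$. $\Lambda$ is the ring of (commutative) symmetric functions with complete homogeneous functions $h_k$, elementary functions $e_k$, $h_{1^n}=h_1^n$; $\chi:NC\Lambda\to\Lambda$ is the algebra homomorphism with $\chi(\mathbf{h}_k)=h_k$, extended linearly to coefficients in $\mathbb{Q}(q,t)$. In this statement $\langle\ ,\ \rangle$ is the usual Hall scalar product on $\Lambda$ (Schur functions orthonormal), extended bilinearly to coefficients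 in $\mathbb{Q}(q,t)$. *)

theory Defs
  imports
    "HOL-Computational_Algebra.Fraction_Field"
    "HOL-Computational_Algebra.Polynomial"
    "HOL-Library.Poly_Mapping"
    "HOL-Library.FuncSet"
begin

section \<open>The coefficient field\<close>

text \<open>The field of rational functions in \<open>q\<close>, \<open>t\<close> as the fraction field of
  \<open>\<rat>[q][t]\<close>: the outer polynomial variable is \<open>t\<close>, the inner one is \<open>q\<close>.\<close>

type_synonym qt_poly = "rat poly poly"
type_synonym qt_field = "qt_poly fract"

definition of_qt_poly :: "qt_poly \<Rightarrow> qt_field" where
  "of_qt_poly P = Fraction_Field.Fract P 1"

definition q :: qt_field where "q = of_qt_poly [:[:0, 1:]:]"
definition t :: qt_field where "t = of_qt_poly [:0, 1:]"

definition eval_qt :: "qt_poly \<Rightarrow> rat \<Rightarrow> rat \<Rightarrow> rat" where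
  "eval_qt P a b = poly (poly P [:b:]) a"

text \<open>\<open>x\<close> is a polynomial in \<open>q\<close>, \<open>t\<close> whose value at \<open>q = t = 1\<close> is \<open>N\<close>.\<close>

definition qt_analog :: "qt_field \<Rightarrow> nat \<Rightarrow> bool" where
  "qt_analog x N \<longleftrightarrow> (\<exists>P. x = of_qt_poly P \<and> eval_qt P 1 1 = of_nat N)"


section \<open>Compositions\<close>

text \<open>The empty composition (of \<open>0\<close>) is included; concatenation is written additively, so that
  compositions form the free monoid on the positive integers.\<close>

typedef composition = "{xs :: nat list. 0 \<notin> set xs}"
  morphisms parts Abs_composition
  by (rule exI[of _ "[]"]) simp

setup_lifting type_definition_composition

instantiation composition :: monoid_add
begin

lift_definition zero_composition :: composition is "[]" by simp

lift_definition plus_composition :: "composition \<Rightarrow> composition \<Rightarrow> composition" is "(@)" by simp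

instance by standard (transfer; simp)+

end

instantiation composition :: size
begin

definition size_composition :: "composition \<Rightarrow> nat" where
  "size \<alpha> = sum_list (parts \<alpha>)"

instance ..

end

definition len :: "composition \<Rightarrow> nat" where
  "len \<alpha> = length (parts \<alpha>)"

definition compositions :: "nat \<Rightarrow> composition set" where
  "compositions n = {\<alpha>. size \<alpha> = n}"

definition descents :: "composition \<Rightarrow> nat set" where
  "descents \<alpha> = {sum_list (take i (parts \<alpha>)) | i. 1 \<le> i \<and> i < len \<alpha>}"

text \<open>\<open>refines \<alpha> \<beta>\<close> is the relation \<open>\<alpha> \<le> \<beta>\<close>: the coarser composition is the larger one.\<close>

definition refines :: "composition \<Rightarrow> composition \<Rightarrow> bool" where
  "refines \<alpha> \<beta> \<longleftrightarrow> size \<alpha> = size \<beta> \<and> descents \<beta> \<subseteq> descents \<alpha>"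

lift_definition reverse :: "composition \<Rightarrow> composition" is rev by simp

definition complement :: "composition \<Rightarrow> composition" where
  "complement \<alpha> = (THE \<gamma>. size \<gamma> = size \<alpha> \<and> descents \<gamma> = {1..<size \<alpha>} - descents \<alpha>)"

definition conjugate :: "composition \<Rightarrow> composition" where
  "conjugate \<alpha> = reverse (complement \<alpha>)"

definition n_stat :: "composition \<Rightarrow> nat" where
  "n_stat \<alpha> = \<Sum>(descents \<alpha>)"

definition c_stat :: "composition \<Rightarrow> composition \<Rightarrow> nat" where
  "c_stat \<alpha> \<beta> = \<Sum>(descents \<alpha> \<inter> descents \<beta>)"

lemma finite_compositions: "finite (compositions n)"
proof -
  have len_le: "length xs \<le> sum_list xs" if "0 \<notin> set xs" for xs :: "nat list"
    using that by (induction xs) auto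
  have "parts ` compositions n \<subseteq> {xs. set xs \<subseteq> {..n} \<and> length xs \<le> n}"
    using parts len_le
    by (fastforce simp: compositions_def size_composition_def dest: member_le_sum_list)
  then have "finite (parts ` compositions n)"
    by (rule finite_subset) (simp add: finite_lists_length_le)
  then show ?thesis
    by (rule finite_imageD) (simp add: inj_on_def parts_inject)
qed


section \<open>Noncommutative symmetric functions\<close>

text \<open>The free associative algebra, as the monoid algebra of the free monoid.\<close>

type_synonym ncsym = "composition \<Rightarrow>\<^sub>0 qt_field"

definition nc_scale :: "qt_field \<Rightarrow> ncsym \<Rightarrow> ncsym" where
  "nc_scale c = Poly_Mapping.map ((*) c)"

lift_definition one_part :: "nat \<Rightarrow> composition" is "\<lambda>k. if k = 0 then [] else [k]" by auto

definition nc_h :: "nat \<Rightarrow> ncsym" where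
  "nc_h k = Poly_Mapping.single (one_part k) 1"

definition nc_h_comp :: "composition \<Rightarrow> ncsym" where
  "nc_h_comp \<alpha> = prod_list (map nc_h (parts \<alpha>))"

definition nc_ribbon :: "composition \<Rightarrow> ncsym" where
  "nc_ribbon \<alpha> = (\<Sum>\<beta> | refines \<alpha> \<beta>. nc_scale ((- 1) ^ (len \<alpha> - len \<beta>)) (nc_h_comp \<beta>))"

definition nc_e :: "nat \<Rightarrow> ncsym" where
  "nc_e n = (\<Sum>\<alpha>\<in>compositions n. nc_scale ((- 1) ^ (n - len \<alpha>)) (nc_h_comp \<alpha>))"

definition nc_Hqt :: "composition \<Rightarrow> ncsym" where
  "nc_Hqt \<alpha> = (\<Sum>\<beta>\<in>compositions (size \<alpha>).
     nc_scale (t ^ c_stat \<alpha> \<beta> * q ^ c_stat (conjugate \<alpha>) (reverse \<beta>)) (nc_ribbon \<beta>))"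

definition nabla :: "ncsym \<Rightarrow> ncsym" where
  "nabla = (THE F. Vector_Spaces.linear nc_scale nc_scale F \<and>
     (\<forall>\<alpha>. F (nc_Hqt \<alpha>) = nc_scale (t ^ n_stat \<alpha> * q ^ n_stat (conjugate \<alpha>)) (nc_Hqt \<alpha>)))"

lemma lookup_nc_scale [simp]:
  "Poly_Mapping.lookup (nc_scale c F) \<alpha> = c * Poly_Mapping.lookup F \<alpha>"
  unfolding nc_scale_def by transfer (simp add: when_def)

lemma vector_space_nc_scale: "vector_space nc_scale"
  by standard (auto intro!: poly_mapping_eqI simp: lookup_add algebra_simps)

lemma nc_h_comp_eq_single: "nc_h_comp \<alpha> = Poly_Mapping.single \<alpha> 1"
proof -
  have "prod_list (map nc_h xs) = Poly_Mapping.single (Abs_composition xs) 1"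
    if "0 \<notin> set xs" for xs
    using that
  proof (induction xs)
    case Nil
    then show ?case by (simp flip: zero_composition_def)
  next
    case (Cons x xs)
    then have "one_part x + Abs_composition xs = Abs_composition (x # xs)"
      by (auto simp: one_part_def plus_composition_def Abs_composition_inverse)
    with Cons show ?case by (auto simp: nc_h_def Poly_Mapping.mult_single)
  qed
  from this[of "parts \<alpha>"] show ?thesis
    using parts[of \<alpha>] by (simp add: nc_h_comp_def parts_inverse)
qed


section \<open>Formal power series in the variables \<open>x\<^sub>0, x\<^sub>1, x\<^sub>2, \<dots>\<close>\<close>

text \<open>A monomial is its finitely supported exponent vector.\<close>

type_synonym monomial = "nat \<Rightarrow>\<^sub>0 nat"

lemma finite_antidiagonal: "finite {(a, b). a + b = (m :: monomial)}"
proof -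
  let ?F = "{f. \<forall>i. (i \<in> Poly_Mapping.keys m \<longrightarrow> f i \<in> {..Max (range (Poly_Mapping.lookup m))})
    \<and> (i \<notin> Poly_Mapping.keys m \<longrightarrow> f i = 0)}"
  let ?A = "{a. \<exists>b. a + b = m}"
  have fin: "finite (range (Poly_Mapping.lookup m))"
  proof (rule finite_subset)
    show "range (Poly_Mapping.lookup m)
      \<subseteq> insert 0 (Poly_Mapping.lookup m ` Poly_Mapping.keys m)"
      by (auto simp: in_keys_iff)
  qed simp
  have "finite ?F"
    by (rule finite_set_of_finite_funs) auto
  moreover have "Poly_Mapping.lookup ` ?A \<subseteq> ?F"
  proof (clarsimp, intro conjI impI)
    fix a b :: monomial and i
    have "Poly_Mapping.lookup a i \<le> Poly_Mapping.lookup (a + b) i"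
      by (simp add: lookup_add)
    then show "i \<in> Poly_Mapping.keys (a + b) \<Longrightarrow> m = a + b \<Longrightarrow>
        Poly_Mapping.lookup a i \<le> Max (range (Poly_Mapping.lookup (a + b)))"
      using fin by (auto intro: order_trans)
    show "i \<notin> Poly_Mapping.keys (a + b) \<Longrightarrow> Poly_Mapping.lookup a i = 0"
      by (simp add: in_keys_iff lookup_add)
  qed
  ultimately have "finite (Poly_Mapping.lookup ` ?A)"
    by (rule rev_finite_subset)
  then have "finite ?A"
    by (rule finite_imageD) (simp add: inj_on_def)
  moreover have "{(a, b). a + b = m} \<subseteq> (\<lambda>a. (a, m - a)) ` ?A"
    by auto
  ultimately show ?thesis
    using finite_subset by blast
qed

typedef 'a powser = "UNIV :: (monomial \<Rightarrow> 'a) set"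
  morphisms pcoeff Powser ..

setup_lifting type_definition_powser

instantiation powser :: (comm_ring_1) comm_ring_1
begin

lift_definition zero_powser :: "'a powser" is "\<lambda>_. 0" .
lift_definition one_powser :: "'a powser" is "\<lambda>m. if m = 0 then 1 else 0" .
lift_definition plus_powser :: "'a powser \<Rightarrow> 'a powser \<Rightarrow> 'a powser" is "\<lambda>f g m. f m + g m" .
lift_definition minus_powser :: "'a powser \<Rightarrow> 'a powser \<Rightarrow> 'a powser" is "\<lambda>f g m. f m - g m" .
lift_definition uminus_powser :: "'a powser \<Rightarrow> 'a powser" is "\<lambda>f m. - f m" .
lift_definition times_powser :: "'a powser \<Rightarrow> 'a powser \<Rightarrow> 'a powser" is
  "\<lambda>f g m. \<Sum>(a, b) | a + b = m. f a * g b" .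

instance
proof
  fix f g h :: "'a powser"
  show "f * g * h = f * (g * h)"
  proof (transfer, rule ext)
    fix f g h :: "monomial \<Rightarrow> 'a" and m
    have "(\<Sum>(a, b) | a + b = m. (\<Sum>(c, d) | c + d = a. f c * g d) * h b) =
        (\<Sum>x\<in>{(a, b). a + b = m}. \<Sum>y\<in>{(c, d). c + d = fst x}. f (fst y) * g (snd y) * h (snd x))"
      by (simp add: case_prod_unfold sum_distrib_right)
    also have "\<dots> = (\<Sum>(x, y)\<in>(SIGMA x:{(a, b). a + b = m}. {(c, d). c + d = fst x}).
        f (fst y) * g (snd y) * h (snd x))"
      by (rule sum.Sigma) (use finite_antidiagonal in auto)
    also have "\<dots> = (\<Sum>(x, y)\<in>(SIGMA x:{(c, e). c + e = m}. {(d, b). d + b = snd x}).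
        f (fst x) * (g (fst y) * h (snd y)))"
      by (rule sum.reindex_bij_witness
          [of _ "\<lambda>((c, e), (d, b)). ((c + d, b), (c, d))" "\<lambda>((a, b), (c, d)). ((c, d + b), (d, b))"])
        (auto simp: algebra_simps)
    also have "\<dots> = (\<Sum>x\<in>{(c, e). c + e = m}. \<Sum>y\<in>{(d, b). d + b = snd x}.
        f (fst x) * (g (fst y) * h (snd y)))"
      by (rule sum.Sigma[symmetric]) (use finite_antidiagonal in auto)
    also have "\<dots> = (\<Sum>(c, e) | c + e = m. f c * (\<Sum>(d, b) | d + b = e. g d * h b))"
      by (simp add: case_prod_unfold sum_distrib_left)
    finally show "(\<Sum>(a, b) | a + b = m. (\<Sum>(c, d) | c + d = a. f c * g d) * h b) =
        (\<Sum>(c, e) | c + e = m. f c * (\<Sum>(d, b) | d + b = e. g d * h b))" .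
  qed
  show "f * g = g * f"
  proof (transfer, rule ext)
    fix f g :: "monomial \<Rightarrow> 'a" and m
    show "(\<Sum>(a, b) | a + b = m. f a * g b) = (\<Sum>(a, b) | a + b = m. g a * f b)"
      by (rule sum.reindex_bij_witness[of _ prod.swap prod.swap]) (auto simp: algebra_simps)
  qed
  show "1 * f = f"
  proof (transfer, rule ext)
    fix f :: "monomial \<Rightarrow> 'a" and m
    have "(\<Sum>(a, b) | a + b = m. (if a = 0 then 1 else 0) * f b) =
        (\<Sum>(a, b)\<in>{(0 :: monomial, m)}. (if a = 0 then 1 else 0) * f b)"
      using finite_antidiagonal[of m] by (intro sum.mono_neutral_right) (auto split: if_splits)
    then show "(\<Sum>(a, b) | a + b = m. (if a = 0 then 1 else 0) * f b) = f m"
      by simp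
  qed
  show "(f + g) * h = f * h + g * h"
    by transfer (simp add: fun_eq_iff case_prod_unfold algebra_simps sum.distrib)
qed (transfer; simp add: fun_eq_iff algebra_simps)+

end

lift_definition pscale :: "'a :: comm_ring_1 \<Rightarrow> 'a powser \<Rightarrow> 'a powser" is "\<lambda>c f m. c * f m" .

lemma vector_space_pscale: "vector_space (pscale :: 'a :: field \<Rightarrow> _)"
  by standard (transfer; simp add: fun_eq_iff algebra_simps)+


section \<open>Symmetric functions\<close>

definition mono_degree :: "monomial \<Rightarrow> nat" where
  "mono_degree m = (\<Sum>i\<in>Poly_Mapping.keys m. Poly_Mapping.lookup m i)"

definition symmetric_functions :: "'a :: comm_ring_1 powser set" where
  "symmetric_functions = {f.
     (\<forall>\<pi> m. bij \<pi> \<longrightarrow> pcoeff f (Poly_Mapping.map_key \<pi> m) = pcoeff f m) \<and>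
     (\<exists>d. \<forall>m. pcoeff f m \<noteq> 0 \<longrightarrow> mono_degree m \<le> d)}"

definition sym_h :: "nat \<Rightarrow> 'a :: comm_ring_1 powser" where
  "sym_h k = Powser (\<lambda>m. if mono_degree m = k then 1 else 0)"

definition sym_e :: "nat \<Rightarrow> 'a :: comm_ring_1 powser" where
  "sym_e k = Powser (\<lambda>m. if mono_degree m = k \<and> (\<forall>i. Poly_Mapping.lookup m i \<le> 1) then 1 else 0)"

lemma mono_degree_map_key:
  assumes "bij \<pi>"
  shows "mono_degree (Poly_Mapping.map_key \<pi> m) = mono_degree m"
proof -
  have "inj \<pi>" and "surj \<pi>"
    using assms by (auto simp: bij_def)
  then have "bij_betw \<pi> (\<pi> -` Poly_Mapping.keys m) (Poly_Mapping.keys m)"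
    by (auto simp: bij_betw_def inj_on_def surj_image_vimage_eq)
  then show ?thesis
    using \<open>inj \<pi>\<close>
    by (simp add: mono_degree_def keys_map_key map_key.rep_eq)
      (rule sum.reindex_bij_betw[of \<pi> _ _ "Poly_Mapping.lookup m"])
qed

lemma mono_degree_add: "mono_degree (a + b) = mono_degree a + mono_degree b"
proof -
  have deg: "mono_degree m = (\<Sum>i\<in>A. Poly_Mapping.lookup m i)"
    if "finite A" "Poly_Mapping.keys m \<subseteq> A" for m A
    unfolding mono_degree_def using that
    by (intro sum.mono_neutral_left) (auto simp: in_keys_iff)
  let ?A = "Poly_Mapping.keys a \<union> Poly_Mapping.keys b"
  have "Poly_Mapping.keys (a + b) \<subseteq> ?A"
    by (rule Poly_Mapping.keys_add)
  then show ?thesis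
    by (simp add: deg[of ?A] lookup_add sum.distrib)
qed

lemma symmetric_functions_zero: "0 \<in> symmetric_functions"
  by (auto simp: symmetric_functions_def zero_powser.rep_eq)

lemma symmetric_functions_one: "1 \<in> symmetric_functions"
proof -
  have "Poly_Mapping.map_key \<pi> m = 0 \<longleftrightarrow> m = 0" if "bij \<pi>" for \<pi> and m :: monomial
  proof -
    have "inj \<pi>" and "surj \<pi>"
      using that by (auto simp: bij_def)
    then show ?thesis
      by (auto simp: poly_mapping_eq_iff fun_eq_iff map_key.rep_eq) (metis surj_def)
  qed
  then show ?thesis
    by (auto simp: symmetric_functions_def one_powser.rep_eq)
qed

lemma symmetric_functions_add:
  assumes "f \<in> symmetric_functions" "g \<in> symmetric_functions"
  shows "f + g \<in> symmetric_functions"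
proof -
  obtain d e where de: "\<And>m. pcoeff f m \<noteq> 0 \<Longrightarrow> mono_degree m \<le> d"
    "\<And>m. pcoeff g m \<noteq> 0 \<Longrightarrow> mono_degree m \<le> e"
    using assms by (auto simp: symmetric_functions_def)
  have "mono_degree m \<le> max d e" if "pcoeff f m + pcoeff g m \<noteq> 0" for m
    using that de[of m] by (cases "pcoeff f m = 0") (auto simp: max_def)
  then show ?thesis
    using assms by (auto simp: symmetric_functions_def plus_powser.rep_eq)
qed

lemma symmetric_functions_scale:
  assumes "f \<in> symmetric_functions"
  shows "pscale c f \<in> symmetric_functions"
proof -
  obtain d where d: "\<And>m. pcoeff f m \<noteq> 0 \<Longrightarrow> mono_degree m \<le> d"
    using assms by (auto simp: symmetric_functions_def)
  have "mono_degree m \<le> d" if "c * pcoeff f m \<noteq> 0" for m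
    using that d[of m] by (cases "pcoeff f m = 0") auto
  then show ?thesis
    using assms by (auto simp: symmetric_functions_def pscale.rep_eq)
qed

lemma symmetric_functions_mult:
  assumes f: "f \<in> symmetric_functions" and g: "g \<in> symmetric_functions"
  shows "f * g \<in> symmetric_functions"
proof -
  have "pcoeff (f * g) (Poly_Mapping.map_key \<pi> m) = pcoeff (f * g) m" if \<pi>: "bij \<pi>" for \<pi> m
  proof -
    let ?\<rho> = "inv \<pi>"
    have inj: "inj \<pi>" "inj ?\<rho>" and inv: "\<pi> \<circ> ?\<rho> = (\<lambda>x. x)" "?\<rho> \<circ> \<pi> = (\<lambda>x. x)"
      using \<pi> by (auto simp: bij_def fun_eq_iff surj_f_inv_f surj_imp_inj_inv)
    have key: "Poly_Mapping.map_key \<pi> (Poly_Mapping.map_key ?\<rho> a) = a"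
      "Poly_Mapping.map_key ?\<rho> (Poly_Mapping.map_key \<pi> a) = a" for a :: monomial
      using inj inv by (simp_all only: map_key_compose map_key_id)
    have "(\<Sum>(a, b) | a + b = Poly_Mapping.map_key \<pi> m. pcoeff f a * pcoeff g b) =
        (\<Sum>(a, b) | a + b = m. pcoeff f a * pcoeff g b)"
    proof (rule sum.reindex_bij_witness[of _
          "\<lambda>(a, b). (Poly_Mapping.map_key \<pi> a, Poly_Mapping.map_key \<pi> b)"
          "\<lambda>(a, b). (Poly_Mapping.map_key ?\<rho> a, Poly_Mapping.map_key ?\<rho> b)"], goal_cases)
      case (2 x)
      then show ?case
        by (auto simp: key map_key_plus[OF inj(2), symmetric])
    next
      case (5 x)
      have "bij ?\<rho>" using \<pi> by (rule bij_imp_bij_inv)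
      then show ?case
        using f g by (auto simp: symmetric_functions_def split: prod.splits)
    qed (auto simp: key map_key_plus[OF inj(1)])
    then show ?thesis
      by (simp add: times_powser.rep_eq)
  qed
  moreover obtain d e where de: "\<And>m. pcoeff f m \<noteq> 0 \<Longrightarrow> mono_degree m \<le> d"
    "\<And>m. pcoeff g m \<noteq> 0 \<Longrightarrow> mono_degree m \<le> e"
    using f g by (auto simp: symmetric_functions_def)
  have "mono_degree m \<le> d + e" if "pcoeff (f * g) m \<noteq> 0" for m
  proof -
    obtain a b where ab: "a + b = m" "pcoeff f a * pcoeff g b \<noteq> 0"
      using \<open>pcoeff (f * g) m \<noteq> 0\<close>
      by (auto simp: times_powser.rep_eq elim!: sum.not_neutral_contains_not_neutral)
    then have "pcoeff f a \<noteq> 0" "pcoeff g b \<noteq> 0"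
      by auto
    then show ?thesis
      using de(1)[of a] de(2)[of b] ab(1) by (auto simp: mono_degree_add)
  qed
  ultimately show ?thesis
    by (auto simp: symmetric_functions_def)
qed

lemma symmetric_functions_h: "sym_h k \<in> symmetric_functions"
  by (auto simp: symmetric_functions_def sym_h_def Powser_inverse mono_degree_map_key)

definition is_partition :: "nat list \<Rightarrow> bool" where
  "is_partition \<mu> \<longleftrightarrow> sorted_wrt (\<ge>) \<mu> \<and> 0 \<notin> set \<mu>"

definition diagram :: "nat list \<Rightarrow> (nat \<times> nat) set" where
  "diagram \<mu> = {(i, j). i < length \<mu> \<and> j < \<mu> ! i}"

text \<open>Semistandard tableaux of shape \<open>\<mu>\<close> in which the entry \<open>k\<close> occurs as often as
  the variable \<open>x\<^sub>k\<close> in \<open>m\<close>; entries start at \<open>0\<close>.\<close>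

definition ssyt :: "nat list \<Rightarrow> monomial \<Rightarrow> (nat \<times> nat \<Rightarrow> nat) set" where
  "ssyt \<mu> m = {T \<in> extensional (diagram \<mu>).
     (\<forall>i j. (i, Suc j) \<in> diagram \<mu> \<longrightarrow> T (i, j) \<le> T (i, Suc j)) \<and>
     (\<forall>i j. (Suc i, j) \<in> diagram \<mu> \<longrightarrow> T (i, j) < T (Suc i, j)) \<and>
     (\<forall>k. card {c \<in> diagram \<mu>. T c = k} = Poly_Mapping.lookup m k)}"

definition schur :: "nat list \<Rightarrow> 'a :: comm_ring_1 powser" where
  "schur \<mu> = Powser (\<lambda>m. of_nat (card (ssyt \<mu> m)))"

definition schur_coord :: "'a :: field powser \<Rightarrow> 'a powser \<Rightarrow> 'a" where
  "schur_coord = module.representation pscale (schur ` Collect is_partition)"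

text \<open>The bilinear form on the span of the Schur functions for which they are orthonormal.\<close>

definition hall :: "'a :: field powser \<Rightarrow> 'a powser \<Rightarrow> 'a" where
  "hall f g = (\<Sum>s | schur_coord f s \<noteq> 0. schur_coord f s * schur_coord g s)"

lemma finite_ssyt: "finite (ssyt \<mu> m)"
proof -
  have fin: "finite (diagram \<mu>)"
    by (rule finite_subset[of _ "Sigma {..<length \<mu>} (\<lambda>i. {..<\<mu> ! i})"])
      (auto simp: diagram_def)
  have "ssyt \<mu> m \<subseteq> diagram \<mu> \<rightarrow>\<^sub>E Poly_Mapping.keys m"
  proof (intro subsetI PiE_I)
    fix T c assume T: "T \<in> ssyt \<mu> m" and c: "c \<in> diagram \<mu>"
    then have "card {c' \<in> diagram \<mu>. T c' = T c} \<noteq> 0"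
      using fin by (simp add: card_eq_0_iff) (metis surj_pair)
    with T show "T c \<in> Poly_Mapping.keys m"
      by (simp add: ssyt_def in_keys_iff)
  qed (auto simp: ssyt_def extensional_def)
  then show ?thesis
    by (rule finite_subset) (simp add: fin finite_PiE)
qed


section \<open>The commutative image\<close>

definition chi :: "ncsym \<Rightarrow> qt_field powser" where
  "chi F = (\<Sum>\<alpha>\<in>Poly_Mapping.keys F.
     pscale (Poly_Mapping.lookup F \<alpha>) (prod_list (map sym_h (parts \<alpha>))))"

lemma chi_superset:
  assumes "finite A" "Poly_Mapping.keys F \<subseteq> A"
  shows "chi F = (\<Sum>\<alpha>\<in>A. pscale (Poly_Mapping.lookup F \<alpha>) (prod_list (map sym_h (parts \<alpha>))))"
proof -
  interpret vector_space "pscale :: qt_field \<Rightarrow> _" by (rule vector_space_pscale)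
  show ?thesis
    unfolding chi_def using assms by (intro sum.mono_neutral_left) (auto simp: in_keys_iff)
qed

lemma chi_add: "chi (F + G) = chi F + chi G"
proof -
  interpret vector_space "pscale :: qt_field \<Rightarrow> _" by (rule vector_space_pscale)
  let ?A = "Poly_Mapping.keys F \<union> Poly_Mapping.keys G"
  have "Poly_Mapping.keys (F + G) \<subseteq> ?A"
    by (rule Poly_Mapping.keys_add)
  then show ?thesis
    by (simp add: chi_superset[of ?A] lookup_add scale_left_distrib sum.distrib)
qed

lemma chi_scale: "chi (nc_scale c F) = pscale c (chi F)"
proof -
  interpret vector_space "pscale :: qt_field \<Rightarrow> _" by (rule vector_space_pscale)
  have "Poly_Mapping.keys (nc_scale c F) \<subseteq> Poly_Mapping.keys F"
    by (auto simp: in_keys_iff)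
  then show ?thesis
    by (simp add: chi_superset[of "Poly_Mapping.keys F"] scale_sum_right)
qed

lemma chi_single:
  "chi (Poly_Mapping.single \<alpha> c) = pscale c (prod_list (map sym_h (parts \<alpha>)))"
  by (subst chi_superset[of "{\<alpha>}"]) auto

lemma pscale_one: "pscale 1 f = f"
  by transfer simp

lemma chi_nc_h: "k > 0 \<Longrightarrow> chi (nc_h k) = sym_h k"
  unfolding nc_h_def chi_single by (simp add: one_part.rep_eq pscale_one)

lemma chi_one: "chi 1 = 1"
  unfolding single_one[symmetric] chi_single by (simp add: zero_composition.rep_eq pscale_one)

lemma pscale_mult: "pscale c f * pscale d g = pscale (c * d) (f * g)"
  by transfer (auto simp: fun_eq_iff sum_distrib_left algebra_simps intro!: sum.cong)

lemma ncsym_induct [case_names single add]: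
  assumes "\<And>\<alpha> c. P (Poly_Mapping.single \<alpha> c)"
    and "\<And>F G. P F \<Longrightarrow> P G \<Longrightarrow> P (F + G)"
  shows "P (F :: ncsym)"
proof (induction F rule: update_induct)
  case const
  show ?case using assms(1)[of 0 0] by simp
next
  case (update F \<alpha> c)
  have "Poly_Mapping.update \<alpha> c F = F + Poly_Mapping.single \<alpha> c"
    using update(1)
    by (intro poly_mapping_eqI) (auto simp: lookup_update lookup_add lookup_single in_keys_iff)
  with update assms show ?case by simp
qed

lemma chi_mult: "chi (F * G) = chi F * chi G"
proof (induction F rule: ncsym_induct)
  case (single \<alpha> c)
  show ?case
  proof (induction G rule: ncsym_induct)
    case (single \<beta> d)
    show ?case
      by (simp add: Poly_Mapping.mult_single chi_single pscale_mult plus_composition.rep_eq)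
  next
    case (add G G')
    then show ?case by (simp add: chi_add distrib_left)
  qed
next
  case (add F F')
  then show ?case by (simp add: chi_add distrib_right)
qed

lemma chi_symmetric: "chi F \<in> symmetric_functions"
proof -
  have sum: "(\<Sum>x\<in>A. f x) \<in> symmetric_functions" if "\<And>x. f x \<in> symmetric_functions"
    for A :: "composition set" and f :: "composition \<Rightarrow> qt_field powser"
    by (induction A rule: infinite_finite_induct)
      (auto intro: that symmetric_functions_zero symmetric_functions_add)
  have "prod_list (map sym_h ks) \<in> symmetric_functions" for ks
    by (induction ks)
      (auto intro: symmetric_functions_one symmetric_functions_mult symmetric_functions_h)
  then show ?thesis
    unfolding chi_def by (intro sum symmetric_functions_scale)
qed

end

theory Submission
  imports Defs "HOL-Computational_Algebra.Formal_Power_Series"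
begin

text \<open>Identify a composition of \<open>n\<close> with its descent set. The coefficient of \<open>s\<^sub>\<beta>\<close> in
  \<open>H\<^sub>\<alpha>\<close> is the product over \<open>i \<in> D(\<beta>)\<close> of \<open>t\<^sup>i\<close> if \<open>i \<in> D(\<alpha>)\<close> and of \<open>q\<^sup>n\<^sup>-\<^sup>i\<close>
  otherwise, and the eigenvalue of \<open>\<nabla>\<close> is the same product over all \<open>i\<close>. So \<open>\<nabla>\<close> is a tensor
  product of operators on 2-dimensional spaces, and with \<open>W\<^sub>i = t\<^sup>i + q\<^sup>n\<^sup>-\<^sup>i\<close> the coefficient of
  \<open>h\<^sub>\<gamma>\<close> in \<open>\<nabla> e\<^sub>n\<close> is the product of the \<open>W\<^sub>i\<close> for \<open>i \<in> D(\<gamma>)\<close> and of the \<open>1 - W\<^sub>i\<close> for the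
  other \<open>i\<close>. The Pieri rule expands \<open>h\<^sub>\<gamma>\<close> in Schur functions with Kostka numbers, which gives
  \<open>\<langle>h\<^sub>\<gamma>, g\<rangle>\<close> as the coefficient of the monomial \<open>x\<^sup>\<gamma>\<close> in \<open>g\<close>: it is a multinomial coefficient for
  \<open>g = h\<^sub>1\<^sup>n\<close>, and for \<open>g = e\<^sub>n\<close> only \<open>\<gamma> = 1\<^sup>n\<close> contributes. At \<open>q = t = 1\<close> all \<open>W\<^sub>i\<close> are 2, and the
  signed sum of multinomial coefficients is evaluated by exponential generating functions.\<close>

text \<open>At a position i put x = t^i and y = q^(n-i), and let T and F be the local basis vectors
  of the complete functions for a descent and a non-descent at i. The local rows of the modified
  Macdonald-type basis are x T + (1 - x) F and y T + (1 - y) F, with eigenvalues x and y. Their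
  difference is (x - y) (T - F), and T - F is the local factor of e_n, so \<open>nabla\<close> sends
  this factor to the divided difference (x + y) T + (1 - x - y) F. The denominators x - y cancel,
  which is why polynomials result; they are nonzero because t^i and q^(n-i) are different rational
  functions, and this also gives meaning to the definite description of \<open>nabla\<close>. The
  Hall product is defined through coordinates in the set of Schur functions. Before any pairing can
  be computed, these functions must be known to be independent, which follows from the triangularity
  of the Kostka numbers in the dominance order, and the Pieri rule must supply the
  coordinates.\<close>

section \<open>Partitions as row-length functions and their tableaux\<close>

text \<open>A partition is encoded by its row lengths \<open>f 0 \<ge> f 1 \<ge> \<dots>\<close>, continued by zeros;
  \<open>strip f g\<close> says that \<open>f / g\<close> is a horizontal strip.\<close>

definition shape :: "(nat \<Rightarrow> nat) \<Rightarrow> bool" where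
  "shape f \<longleftrightarrow> antimono f \<and> (\<exists>N. f N = 0)"

definition cells :: "(nat \<Rightarrow> nat) \<Rightarrow> (nat \<times> nat) set" where
  "cells f = {(i, j). j < f i}"

definition weight :: "(nat \<Rightarrow> nat) \<Rightarrow> nat" where
  "weight f = card (cells f)"

definition strip :: "(nat \<Rightarrow> nat) \<Rightarrow> (nat \<Rightarrow> nat) \<Rightarrow> bool" where
  "strip f g \<longleftrightarrow> (\<forall>i. g i \<le> f i \<and> f (Suc i) \<le> g i)"

text \<open>The content is a plain function instead of a monomial, so that the update
  \<open>c(k := 0)\<close> can delete the largest entry.\<close>

definition tableaux :: "(nat \<Rightarrow> nat) \<Rightarrow> (nat \<Rightarrow> nat) \<Rightarrow> (nat \<times> nat \<Rightarrow> nat) set" where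
  "tableaux f c = {T \<in> extensional (cells f).
     (\<forall>i j. (i, Suc j) \<in> cells f \<longrightarrow> T (i, j) \<le> T (i, Suc j)) \<and>
     (\<forall>i j. (Suc i, j) \<in> cells f \<longrightarrow> T (i, j) < T (Suc i, j)) \<and>
     (\<forall>k. card {x \<in> cells f. T x = k} = c k)}"

lemma cells_inject: "cells f = cells g \<longleftrightarrow> f = g"
proof
  assume eq: "cells f = cells g"
  have row: "{..<h i} = {j. (i, j) \<in> cells h}" for h :: "nat \<Rightarrow> nat" and i
    by (auto simp: cells_def)
  have "{..<f i} = {..<g i}" for i
    unfolding row eq ..
  then show "f = g"
    by (intro ext) (simp only: lessThan_eq_iff)
qed simp

lemma shape_eventually_zero:
  assumes "shape f"
  obtains N where "\<And>i. i \<ge> N \<Longrightarrow> f i = 0"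
proof -
  obtain N where N: "f N = 0" and "antimono f"
    using assms by (auto simp: shape_def)
  then have "\<And>i. i \<ge> N \<Longrightarrow> f i = 0"
    using antimonoD[of f N] by simp
  then show thesis
    using that by blast
qed

lemma shape_antimono: "shape f \<Longrightarrow> i \<le> j \<Longrightarrow> f j \<le> f i"
  unfolding shape_def by (auto dest: antimonoD)

lemma cells_eq_Sigma:
  assumes "\<And>i. i \<ge> N \<Longrightarrow> f i = 0"
  shows "cells f = Sigma {..<N} (\<lambda>i. {..<f i})"
proof -
  have "i < N" if "j < f i" for i j
    using assms[of i] that by (cases "i < N") auto
  then show ?thesis by (auto simp: cells_def)
qed

lemma weight_eq_sum:
  assumes "\<And>i. i \<ge> N \<Longrightarrow> f i = 0"
  shows "weight f = sum f {..<N}"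
proof -
  have "cells f = Sigma {..<N} (\<lambda>i. {..<f i})"
    using assms by (rule cells_eq_Sigma)
  then show ?thesis
    by (simp add: weight_def)
qed

lemma finite_cells:
  assumes "shape f" shows "finite (cells f)"
proof (rule shape_eventually_zero[OF assms])
  fix N assume "\<And>i. i \<ge> N \<Longrightarrow> f i = 0"
  then have "cells f = Sigma {..<N} (\<lambda>i. {..<f i})"
    by (rule cells_eq_Sigma)
  then show ?thesis
    by simp
qed

text \<open>Interlacing gives \<open>g (Suc i) \<le> f (Suc i) \<le> g i\<close>. The upper shape is
  treated in the same way, with \<open>f (Suc i) \<le> g i \<le> f i\<close>.\<close>

lemma strip_shape_lower:
  assumes "strip f g" "shape f"
  shows "shape g"
proof -
  have "antimono g"
    unfolding antimono_iff_le_Suc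
  proof
    fix i show "g (Suc i) \<le> g i"
      using assms(1) order_trans unfolding strip_def by blast
  qed
  moreover obtain N where "f N = 0"
    using assms(2) by (auto simp: shape_def)
  then have "g N = 0"
    using assms(1) by (metis le_zero_eq strip_def)
  ultimately show ?thesis
    by (auto simp: shape_def)
qed

lemma strip_shape_upper:
  assumes "strip f g" "shape g"
  shows "shape f"
proof -
  have "antimono f"
    unfolding antimono_iff_le_Suc
  proof
    fix i show "f (Suc i) \<le> f i"
      using assms(1) order_trans unfolding strip_def by blast
  qed
  moreover obtain N where "g N = 0"
    using assms(2) by (auto simp: shape_def)
  then have "f (Suc N) = 0"
    using assms(1) by (metis le_zero_eq strip_def)
  ultimately show ?thesis
    by (auto simp: shape_def)
qed

lemma cells_mono:
  assumes "\<And>i. g i \<le> f i"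
  shows "cells g \<subseteq> cells f"
proof -
  have "j < f i" if "j < g i" for i j
    using that assms[of i] by simp
  then show ?thesis
    by (auto simp: cells_def)
qed

lemma finite_bounded_functions:
  fixes b :: "nat \<Rightarrow> nat"
  assumes "\<And>i. i \<ge> N \<Longrightarrow> b i = 0"
  shows "finite {g. \<forall>i. g i \<le> b i}"
proof (rule finite_subset)
  show "{g. \<forall>i. g i \<le> b i} \<subseteq>
    {g. \<forall>i. (i \<in> {..<N} \<longrightarrow> g i \<in> {..Max (b ` {..<N})}) \<and> (i \<notin> {..<N} \<longrightarrow> g i = 0)}"
  proof (clarsimp, intro conjI impI)
    fix g i assume g: "\<forall>i. g i \<le> b i"
    show "g i \<le> Max (b ` {..<N})" if "i < N"
      using that g by (intro order_trans[OF _ Max_ge[of _ "b i"]]) auto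
    show "g i = 0" if "\<not> i < N"
      using that g assms[of i] by (metis le_zero_eq not_less)
  qed
  show "finite {g. \<forall>i. (i \<in> {..<N} \<longrightarrow> g i \<in> {..Max (b ` {..<N})}) \<and> (i \<notin> {..<N} \<longrightarrow> g i = 0)}"
    by (rule finite_set_of_finite_funs) auto
qed

lemma finite_strips_lower:
  assumes "shape f"
  shows "finite {g. strip f g}"
proof (rule shape_eventually_zero[OF assms])
  fix N assume "\<And>i. i \<ge> N \<Longrightarrow> f i = 0"
  then have "finite {g. \<forall>i. g i \<le> f i}"
    by (rule finite_bounded_functions)
  then show ?thesis
    by (rule rev_finite_subset) (auto simp: strip_def)
qed

lemma weight_strip: "strip f g \<Longrightarrow> shape f \<Longrightarrow> weight g \<le> weight f"
  unfolding weight_def by (intro card_mono finite_cells cells_mono) (auto simp: strip_def)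

text \<open>Rows of a tableau increase weakly, so the columns of a row with entries below a bound
  form such a set; its cardinality then serves as the length of a shorter row.\<close>

lemma down_closed_eq_lessThan:
  assumes "finite D" "\<And>j. Suc j \<in> D \<Longrightarrow> j \<in> D"
  shows "D = {..<card D}"
proof -
  have down: "i \<in> D" if "j \<in> D" "i \<le> j" for i j
    using that(2)
  proof (induction rule: inc_induct)
    case base
    show ?case by (rule that(1))
  next
    case (step l)
    show ?case by (rule assms(2)[OF step.IH])
  qed
  have "\<exists>n. D = {..<n}"
  proof (cases "D = {}")
    case False
    have "D = {..Max D}"
    proof
      show "D \<subseteq> {..Max D}"
        using assms(1) by auto
      show "{..Max D} \<subseteq> D"
        using down[OF Max_in[OF assms(1) False]] by auto
    qed
    then show ?thesis
      unfolding lessThan_Suc_atMost[symmetric] by (rule exI)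
  qed (auto intro: exI[of _ 0])
  then show ?thesis
    by (metis card_lessThan)
qed

lemma tableauxI:
  assumes "T \<in> extensional (cells f)"
    and "\<And>i j. (i, Suc j) \<in> cells f \<Longrightarrow> T (i, j) \<le> T (i, Suc j)"
    and "\<And>i j. (Suc i, j) \<in> cells f \<Longrightarrow> T (i, j) < T (Suc i, j)"
    and "\<And>k. card {x \<in> cells f. T x = k} = c k"
  shows "T \<in> tableaux f c"
  using assms by (simp add: tableaux_def)

lemma tableauxD:
  assumes "T \<in> tableaux f c"
  shows "T \<in> extensional (cells f)"
    and "(i, Suc j) \<in> cells f \<Longrightarrow> T (i, j) \<le> T (i, Suc j)"
    and "(Suc i, j) \<in> cells f \<Longrightarrow> T (i, j) < T (Suc i, j)"
    and "card {x \<in> cells f. T x = k} = c k"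
  using assms by (simp_all add: tableaux_def)

text \<open>The cell \<open>x\<close> itself is among those counted by \<open>c (T x)\<close>. In
  this way the support of the content bounds the entries.\<close>

lemma tableaux_entry_content:
  assumes "shape f" "T \<in> tableaux f c" "x \<in> cells f"
  shows "c (T x) \<noteq> 0"
proof -
  have "x \<in> {y \<in> cells f. T y = T x}"
    using assms(3) by simp
  moreover have "finite {y \<in> cells f. T y = T x}"
    using finite_cells[OF assms(1)] by simp
  ultimately have "card {y \<in> cells f. T y = T x} \<noteq> 0"
    using card_0_eq by blast
  then show ?thesis
    by (simp only: tableauxD(4)[OF assms(2)] not_False_eq_True)
qed

lemma finite_tableaux:
  assumes "shape f" "\<And>j. j > k \<Longrightarrow> c j = 0"
  shows "finite (tableaux f c)"
proof (rule finite_subset)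
  show "tableaux f c \<subseteq> cells f \<rightarrow>\<^sub>E {..k}"
  proof (intro subsetI PiE_I)
    fix T x assume T: "T \<in> tableaux f c" and x: "x \<in> cells f"
    then have "c (T x) \<noteq> 0"
      by (rule tableaux_entry_content[OF assms(1)])
    with assms(2)[of "T x"] show "T x \<in> {..k}"
      by (cases "T x > k") auto
  qed (auto simp: tableaux_def extensional_def)
  show "finite (cells f \<rightarrow>\<^sub>E {..k})"
    by (rule finite_PiE[OF finite_cells[OF assms(1)]]) simp
qed

text \<open>The cells containing the largest entry \<open>k\<close> form a horizontal strip; removing them
  leaves a tableau in smaller entries.\<close>

lemma card_tableaux_rec:
  assumes f: "shape f" and c: "\<And>j. j > k \<Longrightarrow> c j = 0"
  shows "card (tableaux f c) =
    (\<Sum>g | strip f g \<and> weight f = weight g + c k. card (tableaux g (c(k := 0))))"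
proof -
  define G where "G = {g. strip f g \<and> weight f = weight g + c k}"
  \<comment> \<open>The tableaux are sorted by the region that the entries below \<open>k\<close>
    occupy.\<close>
  define S where "S g = {T \<in> tableaux f c. {x \<in> cells f. T x < k} = cells g}" for g
  have fin: "finite (cells f)" by (rule finite_cells[OF f])
  have finG: "finite G"
    unfolding G_def by (rule finite_subset[OF _ finite_strips_lower[OF f]]) auto
  have le_k: "T x \<le> k" if "T \<in> tableaux f c" "x \<in> cells f" for T x
    using tableaux_entry_content[OF f that] c[of "T x"] by (cases "T x > k") auto
  have "\<exists>g\<in>G. T \<in> S g" if T: "T \<in> tableaux f c" for T
  proof -
    define D where "D i = {j. j < f i \<and> T (i, j) < k}" for i
    define g where "g i = card (D i)" for i
    have "finite (D i)" for i
      by (rule finite_subset[of _ "{..<f i}"]) (auto simp: D_def)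
    moreover have "j \<in> D i" if "Suc j \<in> D i" for i j
    proof -
      have "T (i, j) \<le> T (i, Suc j)"
        using T that by (auto simp: tableaux_def D_def cells_def)
      with that show ?thesis by (auto simp: D_def)
    qed
    ultimately have D: "D i = {..<g i}" for i
      unfolding g_def by (rule down_closed_eq_lessThan)
    have cg: "{x \<in> cells f. T x < k} = cells g"
      using D by (auto simp: cells_def D_def set_eq_iff)
    have "strip f g"
      unfolding strip_def
    proof (intro allI conjI)
      fix i
      have "{..<g i} \<subseteq> {..<f i}" by (subst D[symmetric]) (auto simp: D_def)
      then show "g i \<le> f i" by simp
      \<comment> \<open>Columns increase strictly, so a cell directly above another cell carries an
        entry below \<open>k\<close>.\<close>
      have "{..<f (Suc i)} \<subseteq> {..<g i}"
      proof (subst D[symmetric], rule subsetI)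
        fix j assume "j \<in> {..<f (Suc i)}"
        then have "(Suc i, j) \<in> cells f" by (auto simp: cells_def)
        then have "T (i, j) < T (Suc i, j)" "T (Suc i, j) \<le> k" "j < f i"
          using T le_k[OF T] shape_antimono[OF f, of i "Suc i"]
          by (auto simp: tableaux_def cells_def)
        then show "j \<in> D i" by (auto simp: D_def)
      qed
      then show "f (Suc i) \<le> g i" by simp
    qed
    moreover have "weight f = weight g + c k"
    proof -
      have "cells f = cells g \<union> {x \<in> cells f. T x = k}"
        unfolding cg[symmetric] using le_k[OF T] by (auto simp: le_less)
      then have "card (cells f) = card (cells g) + card {x \<in> cells f. T x = k}"
        using fin cg by (subst card_Un_disjoint[symmetric]) (auto intro: finite_subset)
      then show ?thesis using T by (simp add: weight_def tableaux_def)
    qed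
    ultimately show ?thesis using T cg by (auto simp: G_def S_def)
  qed
  then have "tableaux f c = (\<Union>g\<in>G. S g)"
    by (auto simp: S_def)
  also have "card \<dots> = (\<Sum>g\<in>G. card (S g))"
  proof (rule card_UN_disjoint)
    show "\<forall>g\<in>G. finite (S g)"
      using finite_tableaux[of f k c] f c by (auto simp: S_def)
    show "\<forall>g\<in>G. \<forall>h\<in>G. g \<noteq> h \<longrightarrow> S g \<inter> S h = {}"
      by (auto simp: S_def cells_inject)
  qed (rule finG)
  also have "\<dots> = (\<Sum>g\<in>G. card (tableaux g (c(k := 0))))"
  proof (rule sum.cong[OF refl])
    fix g assume "g \<in> G"
    then have g: "strip f g" and wt: "weight f = weight g + c k" by (auto simp: G_def)
    then have shg: "shape g" using f by (auto intro: strip_shape_lower)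
    have sub: "cells g \<subseteq> cells f" using g by (intro cells_mono) (auto simp: strip_def)
    have fing: "finite (cells g)" using sub fin by (rule finite_subset)
    \<comment> \<open>A horizontal strip has no two cells in one column: whatever lies above a cell
      of \<open>f\<close> is in \<open>g\<close>. Hence filling the strip with \<open>k\<close>
      keeps columns strict.\<close>
    have up: "(i, j) \<in> cells g" if "(Suc i, j) \<in> cells f" for i j
      using that g unfolding cells_def strip_def by (auto dest!: spec[of _ i])
    have left: "(i, j) \<in> cells g" if "(i, Suc j) \<in> cells g" for i j
      using that by (auto simp: cells_def)
    \<comment> \<open>The inverse of restriction to \<open>g\<close>: the strip is filled with
      \<open>k\<close>.\<close>
    define E where "E T = (\<lambda>x\<in>cells f. if x \<in> cells g then T x else k)" for T :: "nat \<times> nat \<Rightarrow> nat"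
    have "bij_betw (\<lambda>T. restrict T (cells g)) (S g) (tableaux g (c(k := 0)))"
    proof (rule bij_betw_byWitness[where f' = E])
      show "\<forall>T\<in>S g. E (restrict T (cells g)) = T"
      proof
        fix T assume T: "T \<in> S g"
        then have "T x = k" if "x \<in> cells f" "x \<notin> cells g" for x
          using le_k[of T x] that by (auto simp: S_def le_less)
        moreover have "T \<in> extensional (cells f)"
          using T by (auto simp: S_def dest: tableauxD(1))
        ultimately show "E (restrict T (cells g)) = T"
          by (intro extensionalityI[of _ "cells f"]) (auto simp: E_def)
      qed
      show "\<forall>T\<in>tableaux g (c(k := 0)). restrict (E T) (cells g) = T"
        using sub
        by (intro ballI extensionalityI[of _ "cells g"]) (auto simp: E_def dest: tableauxD(1))
      show "(\<lambda>T. restrict T (cells g)) ` S g \<subseteq> tableaux g (c(k := 0))"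
      proof (rule image_subsetI)
        fix T assume TS: "T \<in> S g"
        then have T: "T \<in> tableaux f c" and cg: "{x \<in> cells f. T x < k} = cells g"
          by (auto simp: S_def)
        have lt: "T x < k" if "x \<in> cells g" for x using cg that by auto
        have "card {x \<in> cells g. T x = l} = (c(k := 0)) l" for l
        proof (cases "l < k")
          case True
          then have "{x \<in> cells g. T x = l} = {x \<in> cells f. T x = l}"
            unfolding cg[symmetric] by auto
          with True T show ?thesis by (auto simp: tableaux_def)
        next
          case False
          then have "{x \<in> cells g. T x = l} = {}" using lt by auto
          moreover have "(c(k := 0)) l = 0" using False c[of l] by auto
          ultimately show ?thesis by (simp only: card.empty)
        qed
        moreover have "{x \<in> cells g. restrict T (cells g) x = l} = {x \<in> cells g. T x = l}" for l
          by auto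
        moreover have "restrict T (cells g) (i, j) \<le> restrict T (cells g) (i, Suc j)"
          if "(i, Suc j) \<in> cells g" for i j
          using that left[OF that] subsetD[OF sub that] tableauxD(2)[OF T, of i j] by simp
        moreover have "restrict T (cells g) (i, j) < restrict T (cells g) (Suc i, j)"
          if "(Suc i, j) \<in> cells g" for i j
          using that subsetD[OF sub that] up[of i j] tableauxD(3)[OF T, of i j] by simp
        ultimately show "restrict T (cells g) \<in> tableaux g (c(k := 0))"
          by (intro tableauxI) auto
      qed
      show "E ` tableaux g (c(k := 0)) \<subseteq> S g"
      proof (rule image_subsetI)
        fix T assume T: "T \<in> tableaux g (c(k := 0))"
        have lt: "T x < k" if "x \<in> cells g" for x
          using tableaux_entry_content[OF shg T that] c[of "T x"]
          by (cases "T x" k rule: linorder_cases) auto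
        have "card {x \<in> cells f. E T x = l} = c l" for l
        proof (cases "l = k")
          case True
          then have "{x \<in> cells f. E T x = l} = cells f - cells g"
            using lt sub by (auto simp: E_def)
          then show ?thesis
            using True wt sub fing by (simp add: card_Diff_subset weight_def)
        next
          case False
          then have "{x \<in> cells f. E T x = l} = {x \<in> cells g. T x = l}"
            using sub by (auto simp: E_def)
          then show ?thesis using False T by (auto simp: tableaux_def)
        qed
        moreover have "E T (i, j) \<le> E T (i, Suc j)" if "(i, Suc j) \<in> cells f" for i j
        proof -
          have "(i, j) \<in> cells f" using that by (auto simp: cells_def)
          then show ?thesis
            using that tableauxD(2)[OF T, of i j] left[of i j] lt[of "(i, j)"]
            by (auto simp: E_def)
        qed
        moreover have "E T (i, j) < E T (Suc i, j)" if "(Suc i, j) \<in> cells f" for i j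
          using that tableauxD(3)[OF T, of i j] up[OF that] subsetD[OF sub up[OF that]] lt[of "(i, j)"]
          by (simp add: E_def)
        moreover have "{x \<in> cells f. E T x < k} = cells g"
          using lt sub by (auto simp: E_def)
        moreover have "E T \<in> extensional (cells f)"
          by (simp add: E_def)
        ultimately show "E T \<in> S g"
          unfolding S_def by (auto intro: tableauxI)
      qed
    qed
    then show "card (S g) = card (tableaux g (c(k := 0)))"
      by (rule bij_betw_same_card)
  qed
  finally show ?thesis by (simp add: G_def)
qed

section \<open>The Pieri rule\<close>

text \<open>Summing the row relations and using that min plus max is the plain sum balances
  everything except the top row: \<open>max (\<mu> 0) (\<nu> 0)\<close> and \<open>\<rho> 0\<close>
  occur in no relation. Their difference is the part of the weight that the reflection cannot
  see.\<close>

lemma strip_toggle_weight: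
  assumes \<mu>: "shape \<mu>" and \<nu>: "shape \<nu>"
    and eq: "\<And>i. \<rho> (Suc i) + \<kappa> i = min (\<mu> i) (\<nu> i) + max (\<mu> (Suc i)) (\<nu> (Suc i))"
  shows "weight \<kappa> + weight \<rho> + max (\<mu> 0) (\<nu> 0) = weight \<mu> + weight \<nu> + \<rho> 0"
proof -
  obtain M where M: "\<And>i. i \<ge> M \<Longrightarrow> \<mu> i = 0" using shape_eventually_zero[OF \<mu>] by blast
  obtain M' where M': "\<And>i. i \<ge> M' \<Longrightarrow> \<nu> i = 0" using shape_eventually_zero[OF \<nu>] by blast
  define N where "N = max M M'"
  have zero: "\<mu> i = 0" "\<nu> i = 0" "\<kappa> i = 0" "\<rho> (Suc i) = 0" if "i \<ge> N" for i
    using that M[of i] M'[of i] M[of "Suc i"] M'[of "Suc i"] eq[of i] by (auto simp: N_def)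
  \<comment> \<open>The relations control \<open>\<rho> (Suc i)\<close>, so \<open>\<rho>\<close>
    may have one row more than the other shapes.\<close>
  have w\<rho>: "weight \<rho> = sum \<rho> {..<Suc N}"
  proof (rule weight_eq_sum)
    fix i assume "Suc N \<le> i" then show "\<rho> i = 0" using zero(4)[of "i - 1"] by simp
  qed
  have wts: "weight \<mu> = sum \<mu> {..<N}" "weight \<nu> = sum \<nu> {..<N}" "weight \<kappa> = sum \<kappa> {..<N}"
    using zero by (auto intro!: weight_eq_sum)
  have "(\<Sum>i<N. \<rho> (Suc i) + \<kappa> i) + max (\<mu> 0) (\<nu> 0) =
      (\<Sum>i<N. min (\<mu> i) (\<nu> i)) + (max (\<mu> 0) (\<nu> 0) + (\<Sum>i<N. max (\<mu> (Suc i)) (\<nu> (Suc i))))"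
    by (simp add: eq sum.distrib)
  also have "max (\<mu> 0) (\<nu> 0) + (\<Sum>i<N. max (\<mu> (Suc i)) (\<nu> (Suc i)))
      = (\<Sum>i<Suc N. max (\<mu> i) (\<nu> i))"
    by (rule sum.lessThan_Suc_shift[symmetric])
  also have "\<dots> = (\<Sum>i<N. max (\<mu> i) (\<nu> i))"
    using zero[of N] by simp
  also have "(\<Sum>i<N. min (\<mu> i) (\<nu> i)) + (\<Sum>i<N. max (\<mu> i) (\<nu> i)) = (\<Sum>i<N. \<mu> i + \<nu> i)"
    by (auto simp: sum.distrib[symmetric] intro!: sum.cong)
  finally show ?thesis
    unfolding wts w\<rho> sum.lessThan_Suc_shift by (simp add: sum.distrib)
qed

definition kostka :: "(nat \<Rightarrow> nat) \<Rightarrow> monomial \<Rightarrow> nat" where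
  "kostka f m = card (tableaux f (Poly_Mapping.lookup m))"

lemma kostka_add_single:
  assumes "shape f" "Poly_Mapping.keys m \<subseteq> {..<k}"
  shows "kostka f (m + Poly_Mapping.single k b) =
    (\<Sum>g | strip f g \<and> weight f = weight g + b. kostka g m)"
proof -
  let ?c = "Poly_Mapping.lookup (m + Poly_Mapping.single k b)"
  have 0: "Poly_Mapping.lookup m j = 0" if "j \<ge> k" for j
    using assms(2) that by (auto simp: in_keys_iff)
  have "?c(k := 0) = Poly_Mapping.lookup m"
    using 0 by (auto simp: lookup_add lookup_single fun_eq_iff)
  moreover have "?c k = b"
    using 0 by (simp add: lookup_add)
  moreover have "?c j = 0" if "j > k" for j
    using 0 that by (simp add: lookup_add lookup_single)
  ultimately show ?thesis
    using card_tableaux_rec[OF assms(1), of k ?c] by (simp add: kostka_def)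
qed

lemma weight_zero [simp]: "weight (\<lambda>_. 0) = 0"
  by (simp add: weight_def cells_def)

lemma shape_zero [simp]: "shape (\<lambda>_. 0)"
  by (auto simp: shape_def antimono_def)

lemma kostka_zero:
  assumes "shape f"
  shows "kostka f 0 = (if f = (\<lambda>_. 0) then 1 else 0)"
proof (cases "f = (\<lambda>_. 0)")
  case True
  then have "tableaux f (Poly_Mapping.lookup 0) = {\<lambda>_. undefined}"
    by (auto simp: tableaux_def cells_def)
  with True show ?thesis by (simp add: kostka_def)
next
  case False
  have "tableaux f (Poly_Mapping.lookup 0) = {}"
  proof (rule ccontr)
    assume "tableaux f (Poly_Mapping.lookup 0) \<noteq> {}"
    then obtain T where T: "T \<in> tableaux f (Poly_Mapping.lookup 0)" by blast
    obtain i where "f i \<noteq> 0" using False by auto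
    then have "(i, 0) \<in> cells f" by (simp add: cells_def)
    from tableaux_entry_content[OF assms T this] show False by simp
  qed
  with False show ?thesis by (simp add: kostka_def)
qed

text \<open>As the variable \<open>k\<close> does not divide \<open>m\<close>, a factorization of
  the enlarged monomial is a factorization of \<open>m\<close> together with the share
  \<open>j\<close> of the exponent \<open>b\<close> that goes to the first factor.\<close>

lemma sum_antidiagonal_add_single:
  fixes F :: "monomial \<Rightarrow> monomial \<Rightarrow> 'a :: comm_monoid_add"
  assumes "Poly_Mapping.lookup m k = 0"
  shows "(\<Sum>(d, e) | d + e = m + Poly_Mapping.single k b. F d e) =
    (\<Sum>j\<le>b. \<Sum>(d, e) | d + e = m.
       F (d + Poly_Mapping.single k j) (e + Poly_Mapping.single k (b - j)))"
proof -
  let ?s = "Poly_Mapping.single k :: nat \<Rightarrow> monomial"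
  have lk: "Poly_Mapping.lookup d k = 0 \<and> Poly_Mapping.lookup e k = 0" if "d + e = m" for d e
    using assms by (simp add: that[symmetric] lookup_add)
  have split: "x - ?s (Poly_Mapping.lookup x k) + ?s (Poly_Mapping.lookup x k) = x" for x
    by (intro poly_mapping_eqI) (auto simp: lookup_add lookup_minus lookup_single when_def)
  have "(\<Sum>j\<le>b. \<Sum>(d, e) | d + e = m. F (d + ?s j) (e + ?s (b - j))) =
    (\<Sum>(j, d, e)\<in>{..b} \<times> {(d, e). d + e = m}. F (d + ?s j) (e + ?s (b - j)))"
    by (simp add: sum.cartesian_product case_prod_unfold)
  also have "\<dots> = (\<Sum>(d, e) | d + e = m + ?s b. F d e)"
  proof (rule sum.reindex_bij_witness[of _
        "\<lambda>(x, y). (Poly_Mapping.lookup x k, x - ?s (Poly_Mapping.lookup x k), y - ?s (Poly_Mapping.lookup y k))"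
        "\<lambda>(j, d, e). (d + ?s j, e + ?s (b - j))"], goal_cases)
    case (1 a)
    then show ?case using lk by (auto simp: lookup_add)
  next
    case (2 a)
    then obtain j d e where a: "a = (j, d, e)" "j \<le> b" "d + e = m" by auto
    have "d + ?s j + (e + ?s (b - j)) = (d + e) + (?s j + ?s (b - j))"
      by (simp add: algebra_simps)
    also have "?s j + ?s (b - j) = ?s b"
      using a by (simp add: single_add[symmetric])
    finally show ?case using a by simp
  next
    case (3 a)
    then obtain x y where a: "a = (x, y)" "x + y = m + ?s b" by auto
    have "Poly_Mapping.lookup x k + Poly_Mapping.lookup y k = b"
      using arg_cong[OF a(2), of "\<lambda>z. Poly_Mapping.lookup z k"] assms by (simp add: lookup_add)
    then show ?case using a split by auto
  next
    case (4 a)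
    then obtain x y where a: "a = (x, y)" "x + y = m + ?s b" by auto
    have "Poly_Mapping.lookup x k + Poly_Mapping.lookup y k = b"
      using arg_cong[OF a(2), of "\<lambda>z. Poly_Mapping.lookup z k"] assms by (simp add: lookup_add)
    moreover have "(x - ?s (Poly_Mapping.lookup x k)) + (y - ?s (Poly_Mapping.lookup y k)) = m"
    proof (rule poly_mapping_eqI)
      fix i
      show "Poly_Mapping.lookup (x - ?s (Poly_Mapping.lookup x k) + (y - ?s (Poly_Mapping.lookup y k))) i
        = Poly_Mapping.lookup m i"
        using arg_cong[OF a(2), of "\<lambda>z. Poly_Mapping.lookup z i"] assms
        by (cases "i = k") (auto simp: lookup_add lookup_minus lookup_single when_def)
    qed
    ultimately show ?case using a by auto
  next
    case (5 a)
    then show ?case by auto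
  qed
  finally show ?thesis by simp
qed

text \<open>This drives the inductions on the number of variables, in which the last variable is the
  largest possible entry.\<close>

lemma keys_lessThan_Suc_split:
  assumes "Poly_Mapping.keys m \<subseteq> {..<Suc k}"
  obtains m' b where "m = m' + Poly_Mapping.single k (b :: nat)" "Poly_Mapping.keys m' \<subseteq> {..<k}"
proof (rule that)
  let ?b = "Poly_Mapping.lookup m k"
  show "m = (m - Poly_Mapping.single k ?b) + Poly_Mapping.single k ?b"
    by (intro poly_mapping_eqI) (auto simp: lookup_add lookup_minus lookup_single when_def)
  show "Poly_Mapping.keys (m - Poly_Mapping.single k ?b) \<subseteq> {..<k}"
  proof
    fix i assume "i \<in> Poly_Mapping.keys (m - Poly_Mapping.single k ?b)"
    then have "Poly_Mapping.lookup m i - (if k = i then ?b else 0) \<noteq> 0"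
      by (simp add: in_keys_iff lookup_minus lookup_single when_def)
    then have "i \<noteq> k" "i \<in> Poly_Mapping.keys m"
      by (auto simp: in_keys_iff split: if_splits)
    then show "i \<in> {..<k}" using assms by auto
  qed
qed

lemma finite_strips_upper:
  assumes "shape \<mu>"
  shows "finite {\<rho>. strip \<rho> \<mu> \<and> weight \<rho> = weight \<mu> + a}"
proof -
  obtain N where N: "\<And>i. i \<ge> N \<Longrightarrow> \<mu> i = 0" using shape_eventually_zero[OF assms] by blast
  \<comment> \<open>Interlacing bounds row \<open>Suc j\<close> of an upper neighbour by
    \<open>\<mu> j\<close>; only row 0 is free, and it is at most the total weight.\<close>
  define b where "b i = (case i of 0 \<Rightarrow> weight \<mu> + a | Suc j \<Rightarrow> \<mu> j)" for i
  have "b i = 0" if "i \<ge> Suc N" for i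
    using that N[of "i - 1"] by (cases i) (simp_all add: b_def)
  then have "finite {g. \<forall>i. g i \<le> b i}"
    by (rule finite_bounded_functions)
  moreover have "{\<rho>. strip \<rho> \<mu> \<and> weight \<rho> = weight \<mu> + a} \<subseteq> {g. \<forall>i. g i \<le> b i}"
  proof clarify
    fix \<rho> i assume st: "strip \<rho> \<mu>" and wt: "weight \<rho> = weight \<mu> + a"
    show "\<rho> i \<le> b i"
    proof (cases i)
      case 0
      have "finite (cells \<rho>)" by (rule finite_cells[OF strip_shape_upper[OF st assms]])
      then have "card ({0 :: nat} \<times> {..<\<rho> 0}) \<le> weight \<rho>"
        unfolding weight_def by (rule card_mono) (auto simp: cells_def)
      then show ?thesis using wt 0 by (simp add: b_def)
    next
      case (Suc j)
      then show ?thesis using st by (simp add: b_def strip_def)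
    qed
  qed
  ultimately show ?thesis
    by (rule rev_finite_subset)
qed

lemma mono_degree_single [simp]: "mono_degree (Poly_Mapping.single k b) = b"
  by (simp add: mono_degree_def)

text \<open>Coefficientwise form of the Pieri rule. Both sides expand, by removing the largest
  entry, into sums over pairs of shapes with a common upper or a common lower neighbour; row by row
  these two neighbours are exchanged by the reflection \<open>x \<mapsto> min + max - x\<close>.\<close>

lemma kostka_pieri:
  assumes "shape \<mu>" "Poly_Mapping.keys m \<subseteq> {..<k}"
  shows "(\<Sum>\<rho> | strip \<rho> \<mu> \<and> weight \<rho> = weight \<mu> + a. kostka \<rho> m) =
    (\<Sum>(d, e) | d + e = m. (if mono_degree d = a then 1 else 0) * kostka \<mu> e)"
  using assms
proof (induction k arbitrary: \<mu> m a)
  case 0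
  then have m: "m = 0" by simp
  let ?U = "{\<rho>. strip \<rho> \<mu> \<and> weight \<rho> = weight \<mu> + a}"
  have "(\<Sum>\<rho>\<in>?U. kostka \<rho> m) = (\<Sum>\<rho>\<in>?U. if \<rho> = (\<lambda>_. 0) then 1 else 0)"
    unfolding m using 0 by (intro sum.cong refl kostka_zero) (auto dest: strip_shape_upper[OF _ 0(1)])
  also have "\<dots> = (if (\<lambda>_. 0) \<in> ?U then 1 else 0)"
    using finite_strips_upper[OF 0(1)] by (rule sum.delta)
  also have "(\<lambda>_. 0) \<in> ?U \<longleftrightarrow> \<mu> = (\<lambda>_. 0) \<and> a = 0"
    by (auto simp: strip_def)
  also have "(if \<mu> = (\<lambda>_. 0) \<and> a = 0 then 1 else 0) =
      (if mono_degree 0 = a then 1 else 0) * kostka \<mu> 0"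
    using 0 by (auto simp: kostka_zero mono_degree_def)
  also have "\<dots> = (\<Sum>(d, e) \<in> {(0, 0)}. (if mono_degree d = a then 1 else 0) * kostka \<mu> e)"
    by simp
  also have "{(0 :: monomial, 0)} = {(d, e). d + e = m}"
    unfolding m by (auto simp: poly_mapping_eq_iff lookup_add fun_eq_iff plus_poly_mapping.rep_eq)
  finally show ?case .
next
  case (Suc k)
  obtain m' b where m: "m = m' + Poly_Mapping.single k b" and m': "Poly_Mapping.keys m' \<subseteq> {..<k}"
    by (rule keys_lessThan_Suc_split[OF Suc.prems(2)])
  note \<mu> = \<open>shape \<mu>\<close>
  let ?U = "\<lambda>\<kappa> a. {\<rho>. strip \<rho> \<kappa> \<and> weight \<rho> = weight \<kappa> + a}"
  let ?D = "\<lambda>\<rho> b. {\<nu>. strip \<rho> \<nu> \<and> weight \<rho> = weight \<nu> + b}"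
  have finD: "finite (?D f c)" if "shape f" for f c
    by (rule finite_subset[OF _ finite_strips_lower[OF that]]) auto
  \<comment> \<open>On the left \<open>\<rho>\<close> is a common upper neighbour of
    \<open>\<mu>\<close> and \<open>\<nu>\<close>. On the right \<open>\<kappa>\<close> is a common
    lower neighbour, and \<open>j\<close> is the share of the exponent \<open>b\<close> taken by the
    complete function.\<close>
  let ?L = "SIGMA \<rho>:?U \<mu> a. ?D \<rho> b"
  let ?R = "SIGMA p:(SIGMA j:{..min a b}. ?D \<mu> (b - j)). ?U (snd p) (a - fst p)"
  have "(\<Sum>\<rho>\<in>?U \<mu> a. kostka \<rho> m) = (\<Sum>\<rho>\<in>?U \<mu> a. \<Sum>\<nu>\<in>?D \<rho> b. kostka \<nu> m')"
    unfolding m using \<mu> m' by (intro sum.cong refl kostka_add_single) (auto dest: strip_shape_upper[OF _ \<mu>])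
  also have "\<dots> = (\<Sum>(\<rho>, \<nu>)\<in>?L. kostka \<nu> m')"
    using finite_strips_upper[OF \<mu>] by (intro sum.Sigma ballI finD) (auto dest: strip_shape_upper[OF _ \<mu>])
  also have "\<dots> = (\<Sum>(p, \<nu>)\<in>?R. kostka \<nu> m')"
  \<comment> \<open>Row \<open>Suc i\<close> of \<open>\<rho>\<close> and row \<open>i\<close> of
    \<open>\<kappa>\<close> range over the same interval, from
    \<open>max (\<mu> (Suc i)) (\<nu> (Suc i))\<close> to \<open>min (\<mu> i) (\<nu> i)\<close>,
    and its reflection exchanges them. Row 0 of \<open>\<rho>\<close> has no partner; its excess
    over \<open>max (\<mu> 0) (\<nu> 0)\<close> is stored as \<open>j\<close>.\<close>
  proof (rule sum.reindex_bij_witness[of _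
        "\<lambda>((j, \<kappa>), \<nu>). (\<lambda>i. case i of 0 \<Rightarrow> max (\<mu> 0) (\<nu> 0) + j
           | Suc i \<Rightarrow> min (\<mu> i) (\<nu> i) + max (\<mu> (Suc i)) (\<nu> (Suc i)) - \<kappa> i, \<nu>)"
        "\<lambda>(\<rho>, \<nu>). ((\<rho> 0 - max (\<mu> 0) (\<nu> 0),
           \<lambda>i. min (\<mu> i) (\<nu> i) + max (\<mu> (Suc i)) (\<nu> (Suc i)) - \<rho> (Suc i)), \<nu>)"], goal_cases)
    case (1 x)
    then obtain \<rho> \<nu> where x: "x = (\<rho>, \<nu>)" "strip \<rho> \<mu>" "strip \<rho> \<nu>" by auto
    have le: "\<rho> (Suc i) \<le> min (\<mu> i) (\<nu> i) + max (\<mu> (Suc i)) (\<nu> (Suc i))"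
      "\<rho> 0 \<ge> max (\<mu> 0) (\<nu> 0)" for i
      using x by (auto simp: strip_def intro!: trans_le_add1)
    have "(case i of 0 \<Rightarrow> max (\<mu> 0) (\<nu> 0) + (\<rho> 0 - max (\<mu> 0) (\<nu> 0))
        | Suc i \<Rightarrow> min (\<mu> i) (\<nu> i) + max (\<mu> (Suc i)) (\<nu> (Suc i)) -
           (min (\<mu> i) (\<nu> i) + max (\<mu> (Suc i)) (\<nu> (Suc i)) - \<rho> (Suc i))) = \<rho> i" for i
      by (cases i) (simp_all only: nat.case diff_diff_cancel[OF le(1)] le_add_diff_inverse[OF le(2)])
    then show ?case
      unfolding x by (simp only: prod.case prod.inject fun_eq_iff simp_thms)
  next
    case (2 x)
    then obtain \<rho> \<nu> where x: "x = (\<rho>, \<nu>)" "strip \<rho> \<mu>" "strip \<rho> \<nu>"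
      and wt: "weight \<rho> = weight \<mu> + a" "weight \<rho> = weight \<nu> + b" by auto
    define \<kappa> where "\<kappa> i = min (\<mu> i) (\<nu> i) + max (\<mu> (Suc i)) (\<nu> (Suc i)) - \<rho> (Suc i)" for i
    have ub: "\<rho> (Suc i) \<le> \<mu> i" "\<rho> (Suc i) \<le> \<nu> i" "\<mu> i \<le> \<rho> i" "\<nu> i \<le> \<rho> i" for i
      using x by (auto simp: strip_def)
    have \<nu>: "shape \<nu>" by (rule strip_shape_lower[OF x(3) strip_shape_upper[OF x(2) \<mu>]])
    have "\<kappa> i \<le> \<mu> i \<and> \<kappa> i \<le> \<nu> i \<and> \<mu> (Suc i) \<le> \<kappa> i \<and> \<nu> (Suc i) \<le> \<kappa> i" for i
      using ub(1,2)[of i] ub(3,4)[of "Suc i"] unfolding \<kappa>_def by linarith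
    then have st: "strip \<mu> \<kappa>" "strip \<nu> \<kappa>"
      by (simp_all add: strip_def)
    \<comment> \<open>Combined with the weight identity below, these inequalities say that
      \<open>j\<close> exceeds neither \<open>b\<close> nor \<open>a\<close>, so that the truncated
      differences \<open>b - j\<close> and \<open>a - j\<close> are exact.\<close>
    moreover have "weight \<kappa> \<le> weight \<mu>" "weight \<kappa> \<le> weight \<nu>"
      by (rule weight_strip[OF st(1) \<mu>], rule weight_strip[OF st(2) \<nu>])
    moreover have "weight \<kappa> + weight \<rho> + max (\<mu> 0) (\<nu> 0) = weight \<mu> + weight \<nu> + \<rho> 0"
    proof (rule strip_toggle_weight[OF \<mu> \<nu>])
      show "\<rho> (Suc i) + \<kappa> i = min (\<mu> i) (\<nu> i) + max (\<mu> (Suc i)) (\<nu> (Suc i))" for i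
        using ub(1,2)[of i] unfolding \<kappa>_def by linarith
    qed
    moreover have "max (\<mu> 0) (\<nu> 0) \<le> \<rho> 0" using ub by simp
    ultimately show ?case
      using wt unfolding x prod.case \<kappa>_def[symmetric] by auto
  next
    case (3 x)
    then obtain j \<kappa> \<nu> where x: "x = ((j, \<kappa>), \<nu>)" "strip \<mu> \<kappa>" "strip \<nu> \<kappa>" by auto
    have le: "\<kappa> i \<le> min (\<mu> i) (\<nu> i) + max (\<mu> (Suc i)) (\<nu> (Suc i))" for i
      using x by (auto simp: strip_def intro!: trans_le_add1)
    show ?case
      unfolding x by (simp only: prod.case nat.case diff_diff_cancel[OF le] add_diff_cancel_left')
  next
    case (4 x)
    then obtain j \<kappa> \<nu> where x: "x = ((j, \<kappa>), \<nu>)" "strip \<mu> \<kappa>" "strip \<nu> \<kappa>"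
      and j: "j \<le> a" "j \<le> b" and wt: "weight \<mu> = weight \<kappa> + (b - j)" "weight \<nu> = weight \<kappa> + (a - j)"
      by auto
    define \<rho> where "\<rho> i = (case i of 0 \<Rightarrow> max (\<mu> 0) (\<nu> 0) + j
      | Suc i \<Rightarrow> min (\<mu> i) (\<nu> i) + max (\<mu> (Suc i)) (\<nu> (Suc i)) - \<kappa> i)" for i
    have ub: "\<kappa> i \<le> \<mu> i" "\<kappa> i \<le> \<nu> i" "\<mu> (Suc i) \<le> \<kappa> i" "\<nu> (Suc i) \<le> \<kappa> i" for i
      using x by (auto simp: strip_def)
    have \<nu>: "shape \<nu>" by (rule strip_shape_upper[OF x(3) strip_shape_lower[OF x(2) \<mu>]])
    have "\<mu> i \<le> \<rho> i \<and> \<nu> i \<le> \<rho> i \<and> \<rho> (Suc i) \<le> \<mu> i \<and> \<rho> (Suc i) \<le> \<nu> i" for i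
    proof -
      have "\<rho> (Suc i) \<le> \<mu> i \<and> \<rho> (Suc i) \<le> \<nu> i"
        using ub[of i] unfolding \<rho>_def nat.case by linarith
      moreover have "\<mu> i \<le> \<rho> i \<and> \<nu> i \<le> \<rho> i"
      proof (cases i)
        case (Suc l)
        then show ?thesis using ub[of l] unfolding \<rho>_def Suc nat.case by linarith
      qed (auto simp: \<rho>_def max_def)
      ultimately show ?thesis by blast
    qed
    then have "strip \<rho> \<mu>" "strip \<rho> \<nu>" by (auto simp: strip_def)
    moreover have "weight \<kappa> + weight \<rho> + max (\<mu> 0) (\<nu> 0) = weight \<mu> + weight \<nu> + \<rho> 0"
    proof (rule strip_toggle_weight[OF \<mu> \<nu>])
      show "\<rho> (Suc i) + \<kappa> i = min (\<mu> i) (\<nu> i) + max (\<mu> (Suc i)) (\<nu> (Suc i))" for i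
        using ub[of i] unfolding \<rho>_def nat.case by linarith
    qed
    moreover have "\<rho> 0 = max (\<mu> 0) (\<nu> 0) + j" by (simp add: \<rho>_def)
    ultimately show ?case
      using wt j unfolding x prod.case \<rho>_def[symmetric] by auto
  next
    case (5 x)
    then show ?case by auto
  qed
  also have "\<dots> = (\<Sum>p\<in>(SIGMA j:{..min a b}. ?D \<mu> (b - j)). \<Sum>\<nu>\<in>?U (snd p) (a - fst p). kostka \<nu> m')"
    using \<mu> by (intro sum.Sigma[symmetric] ballI finite_SigmaI finD finite_strips_upper)
      (auto dest: strip_shape_lower[OF _ \<mu>])
  also have "\<dots> = (\<Sum>(j, \<kappa>)\<in>(SIGMA j:{..min a b}. ?D \<mu> (b - j)). \<Sum>\<nu>\<in>?U \<kappa> (a - j). kostka \<nu> m')"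
    by (simp add: case_prod_unfold)
  also have "\<dots> = (\<Sum>j\<le>min a b. \<Sum>\<kappa>\<in>?D \<mu> (b - j). \<Sum>\<nu>\<in>?U \<kappa> (a - j). kostka \<nu> m')"
    using \<mu> by (intro sum.Sigma[symmetric] ballI finD) auto
  also have "\<dots> = (\<Sum>j\<le>min a b. \<Sum>\<kappa>\<in>?D \<mu> (b - j).
      \<Sum>(d, e) | d + e = m'. (if mono_degree d = a - j then 1 else 0) * kostka \<kappa> e)"
    using m' by (intro sum.cong refl Suc.IH) (auto dest: strip_shape_lower[OF _ \<mu>])
  \<comment> \<open>For \<open>j > a\<close> the truncated condition
    \<open>mono_degree d = a - j\<close> would hold at \<open>d = 0\<close>; written additively it
    fails.\<close>
  also have "\<dots> = (\<Sum>j\<le>min a b. \<Sum>\<kappa>\<in>?D \<mu> (b - j).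
      \<Sum>(d, e) | d + e = m'. (if mono_degree d + j = a then 1 else 0) * kostka \<kappa> e)"
    by (intro sum.cong refl) (auto intro!: sum.cong)
  \<comment> \<open>Terms with \<open>j > a\<close> therefore vanish, and \<open>j\<close> can run
    over all shares of \<open>b\<close>, as the recursion for the product requires.\<close>
  also have "\<dots> = (\<Sum>j\<le>b. \<Sum>\<kappa>\<in>?D \<mu> (b - j).
      \<Sum>(d, e) | d + e = m'. (if mono_degree d + j = a then 1 else 0) * kostka \<kappa> e)"
    by (rule sum.mono_neutral_left) (auto intro!: sum.neutral)
  also have "\<dots> = (\<Sum>j\<le>b. \<Sum>(d, e) | d + e = m'. (if mono_degree d + j = a then 1 else 0) *
      (\<Sum>\<kappa>\<in>?D \<mu> (b - j). kostka \<kappa> e))"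
    unfolding case_prod_unfold sum_distrib_left by (intro sum.cong refl sum.swap)
  also have "\<dots> = (\<Sum>j\<le>b. \<Sum>(d, e) | d + e = m'.
      (if mono_degree (d + Poly_Mapping.single k j) = a then 1 else 0) *
      kostka \<mu> (e + Poly_Mapping.single k (b - j)))"
  proof (rule sum.cong[OF refl], rule sum.cong[OF refl], clarify)
    fix j and d e :: monomial assume "m' = d + e"
    then have "Poly_Mapping.keys e \<subseteq> Poly_Mapping.keys m'"
      by (auto simp: in_keys_iff lookup_add)
    with m' have "Poly_Mapping.keys e \<subseteq> {..<k}" by blast
    with \<mu> show "(if mono_degree d + j = a then 1 else 0) * (\<Sum>\<kappa>\<in>?D \<mu> (b - j). kostka \<kappa> e) =
      (if mono_degree (d + Poly_Mapping.single k j) = a then 1 else 0) *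
      kostka \<mu> (e + Poly_Mapping.single k (b - j))"
      by (simp add: kostka_add_single mono_degree_add)
  qed
  also have "\<dots> = (\<Sum>(d, e) | d + e = m. (if mono_degree d = a then 1 else 0) * kostka \<mu> e)"
    unfolding m using m' by (intro sum_antidiagonal_add_single[symmetric]) (auto simp: in_keys_iff)
  finally show ?case .
qed

section \<open>Schur functions as a basis\<close>

lemma pcoeff_Powser [simp]: "pcoeff (Powser f) = f"
  by (simp add: Powser_inverse)

lemma powser_eqI: "(\<And>m. pcoeff f m = pcoeff g m) \<Longrightarrow> f = g"
  by (simp add: pcoeff_inject[symmetric] fun_eq_iff)

lemma pcoeff_sum: "pcoeff (\<Sum>x\<in>A. f x) m = (\<Sum>x\<in>A. pcoeff (f x) m)"
  by (induction A rule: infinite_finite_induct) (simp_all add: zero_powser.rep_eq plus_powser.rep_eq)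

definition shape_schur :: "(nat \<Rightarrow> nat) \<Rightarrow> 'a :: comm_ring_1 powser" where
  "shape_schur f = Powser (\<lambda>m. of_nat (kostka f m))"

lemma pcoeff_shape_schur [simp]: "pcoeff (shape_schur f) m = of_nat (kostka f m)"
  by (simp add: shape_schur_def)

lemma keys_bound: "\<exists>k. Poly_Mapping.keys (m :: monomial) \<subseteq> {..<k}"
  by (rule finite_nat_bounded) simp

text \<open>The right-hand side of \<open>kostka_pieri\<close> is a coefficient of this product,
  because a coefficient of \<open>sym_h a\<close> is the indicator of degree
  \<open>a\<close>.\<close>

lemma sym_h_mult_shape_schur:
  assumes "shape \<mu>"
  shows "sym_h a * shape_schur \<mu> =
    (\<Sum>\<rho> | strip \<rho> \<mu> \<and> weight \<rho> = weight \<mu> + a. shape_schur \<rho> :: 'a :: comm_ring_1 powser)"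
proof (rule powser_eqI)
  fix m :: monomial
  obtain k where k: "Poly_Mapping.keys m \<subseteq> {..<k}" using keys_bound[of m] ..
  have "pcoeff (sym_h a * shape_schur \<mu> :: 'a powser) m =
      (\<Sum>(d, e) | d + e = m. (if mono_degree d = a then 1 else 0) * of_nat (kostka \<mu> e))"
    by (simp add: times_powser.rep_eq sym_h_def)
  also have "\<dots> = of_nat (\<Sum>(d, e) | d + e = m. (if mono_degree d = a then 1 else 0) * kostka \<mu> e)"
    by (auto simp: case_prod_unfold intro!: sum.cong)
  also have "\<dots> = of_nat (\<Sum>\<rho> | strip \<rho> \<mu> \<and> weight \<rho> = weight \<mu> + a. kostka \<rho> m)"
    by (simp only: kostka_pieri[OF assms k])
  finally show "pcoeff (sym_h a * shape_schur \<mu> :: 'a powser) m =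
      pcoeff (\<Sum>\<rho> | strip \<rho> \<mu> \<and> weight \<rho> = weight \<mu> + a. shape_schur \<rho>) m"
    by (simp add: pcoeff_sum)
qed

definition shapes :: "nat \<Rightarrow> (nat \<Rightarrow> nat) set" where
  "shapes n = {f. shape f \<and> weight f = n}"

lemma finite_shapes: "finite (shapes n)"
proof -
  \<comment> \<open>With \<open>n\<close> cells no row is longer than \<open>n\<close>, and a
    nonempty row \<open>i\<close> forces \<open>i + 1\<close> cells in the first column.\<close>
  define b where "b i = (if i < n then n else 0)" for i
  have "finite {g. \<forall>i. g i \<le> b i}"
    by (rule finite_bounded_functions[of n]) (simp add: b_def)
  moreover have "shapes n \<subseteq> {g. \<forall>i. g i \<le> b i}"
  proof clarify
    fix f i assume "f \<in> shapes n"
    then have f: "shape f" "card (cells f) = n" by (auto simp: shapes_def weight_def)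
    have "card ({i} \<times> {..<f i}) \<le> card (cells f)"
      by (rule card_mono[OF finite_cells[OF f(1)]]) (auto simp: cells_def)
    moreover have "i < n" if "f i \<noteq> 0"
    proof -
      have "card ({..i} \<times> {0::nat}) \<le> card (cells f)"
      proof (rule card_mono[OF finite_cells[OF f(1)]], clarsimp simp: cells_def)
        fix j assume "j \<le> i"
        then have "f i \<le> f j" by (rule shape_antimono[OF f(1)])
        with that show "0 < f j" by simp
      qed
      then show ?thesis using f by simp
    qed
    ultimately show "f i \<le> b i" using f by (auto simp: b_def)
  qed
  ultimately show ?thesis by (rule rev_finite_subset)
qed

lemma weight_eq_0_iff: "shape f \<Longrightarrow> weight f = 0 \<longleftrightarrow> f = (\<lambda>_. 0)"
  using finite_cells[of f] by (auto simp: weight_def cells_def fun_eq_iff)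

lemma shapes_0: "shapes 0 = {\<lambda>_. 0}"
  by (auto simp: shapes_def weight_eq_0_iff)

text \<open>Variables are numbered from the end of the list, so that the head has the largest index.\<close>

fun content_monomial :: "nat list \<Rightarrow> monomial" where
  "content_monomial [] = 0"
| "content_monomial (x # xs) = content_monomial xs + Poly_Mapping.single (length xs) x"

lemma keys_content: "Poly_Mapping.keys (content_monomial xs) \<subseteq> {..<length xs}"
proof (induction xs)
  case (Cons x xs)
  have "Poly_Mapping.keys (content_monomial (x # xs)) \<subseteq>
      Poly_Mapping.keys (content_monomial xs) \<union> Poly_Mapping.keys (Poly_Mapping.single (length xs) x)"
    unfolding content_monomial.simps by (rule Poly_Mapping.keys_add)
  also have "\<dots> \<subseteq> {..<length (x # xs)}"
    using Cons by (auto split: if_splits)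
  finally show ?case .
qed simp

interpretation powser: vector_space "pscale :: 'a :: field \<Rightarrow> _"
  by (rule vector_space_pscale)

lemma mult_pscale: "f * pscale c g = pscale c (f * g)"
  using pscale_mult[of 1 f c g] by (simp add: pscale_one)

text \<open>Multiplication by \<open>sym_h x\<close> adds a horizontal strip of size
  \<open>x\<close>, while the recursion for Kostka numbers removes one; exchanging the two sums
  matches them. The last factor multiplied on is the head of the list, which therefore has to carry
  the largest entry.\<close>

lemma prod_sym_h_expansion:
  "prod_list (map sym_h xs) = (\<Sum>f\<in>shapes (sum_list xs).
     pscale (of_nat (kostka f (content_monomial xs))) (shape_schur f) :: 'a :: field powser)"
proof (induction xs)
  case Nil
  have "shape_schur (\<lambda>_. 0) = (1 :: 'a powser)"
  proof (rule powser_eqI)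
    fix m :: monomial
    have "tableaux (\<lambda>_. 0) c = (if c = (\<lambda>_. 0) then {\<lambda>_. undefined} else {})" for c
      by (auto simp: tableaux_def cells_def)
    then have "kostka (\<lambda>_. 0) m = (if m = 0 then 1 else 0)"
      by (simp add: kostka_def poly_mapping_eq_iff fun_eq_iff)
    then show "pcoeff (shape_schur (\<lambda>_. 0) :: 'a powser) m = pcoeff 1 m"
      by (simp add: one_powser.rep_eq)
  qed
  then show ?case
    by (simp add: shapes_0 kostka_zero)
next
  case (Cons x xs)
  let ?S = "shapes (sum_list xs)" and ?S' = "shapes (sum_list (x # xs))"
  have up: "{\<rho>. strip \<rho> \<mu> \<and> weight \<rho> = weight \<mu> + x} = {\<rho>\<in>?S'. strip \<rho> \<mu>}" if "\<mu> \<in> ?S" for \<mu>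
    using that by (auto simp: shapes_def dest: strip_shape_upper)
  have down: "{\<mu>. strip \<rho> \<mu> \<and> weight \<rho> = weight \<mu> + x} = {\<mu>\<in>?S. strip \<rho> \<mu>}" if "\<rho> \<in> ?S'" for \<rho>
    using that by (auto simp: shapes_def dest: strip_shape_lower)
  have "prod_list (map sym_h (x # xs)) =
      (\<Sum>\<mu>\<in>?S. pscale (of_nat (kostka \<mu> (content_monomial xs))) (sym_h x * shape_schur \<mu> :: 'a powser))"
    by (simp add: Cons sum_distrib_left mult_pscale)
  also have "\<dots> = (\<Sum>\<mu>\<in>?S. \<Sum>\<rho> | \<rho> \<in> ?S' \<and> strip \<rho> \<mu>.
      pscale (of_nat (kostka \<mu> (content_monomial xs))) (shape_schur \<rho>))"
  proof (rule sum.cong[OF refl])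
    fix \<mu> assume \<mu>: "\<mu> \<in> ?S"
    then have "shape \<mu>" by (simp add: shapes_def)
    then show "pscale (of_nat (kostka \<mu> (content_monomial xs))) (sym_h x * shape_schur \<mu> :: 'a powser) =
      (\<Sum>\<rho> | \<rho> \<in> ?S' \<and> strip \<rho> \<mu>. pscale (of_nat (kostka \<mu> (content_monomial xs))) (shape_schur \<rho>))"
      by (simp only: sym_h_mult_shape_schur up[OF \<mu>] powser.scale_sum_right)
  qed
  also have "\<dots> = (\<Sum>\<rho>\<in>?S'. \<Sum>\<mu> | \<mu> \<in> ?S \<and> strip \<rho> \<mu>.
      pscale (of_nat (kostka \<mu> (content_monomial xs))) (shape_schur \<rho>))"
    by (rule sum.swap_restrict[OF finite_shapes finite_shapes])
  also have "\<dots> = (\<Sum>\<rho>\<in>?S'. pscale (of_nat (kostka \<rho> (content_monomial (x # xs)))) (shape_schur \<rho>))"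
  proof (rule sum.cong[OF refl])
    fix \<rho> assume \<rho>: "\<rho> \<in> ?S'"
    then have "shape \<rho>" by (simp add: shapes_def)
    then have "kostka \<rho> (content_monomial (x # xs)) = (\<Sum>\<mu> | \<mu> \<in> ?S \<and> strip \<rho> \<mu>. kostka \<mu> (content_monomial xs))"
      using keys_content[of xs] by (simp only: content_monomial.simps kostka_add_single down[OF \<rho>])
    then show "(\<Sum>\<mu> | \<mu> \<in> ?S \<and> strip \<rho> \<mu>. pscale (of_nat (kostka \<mu> (content_monomial xs))) (shape_schur \<rho>)) =
      pscale (of_nat (kostka \<rho> (content_monomial (x # xs)))) (shape_schur \<rho> :: 'a powser)"
      by (simp only: of_nat_sum powser.scale_sum_left)
  qed
  finally show ?case .
qed

section \<open>Columns and elementary symmetric functions\<close>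

definition column :: "nat \<Rightarrow> nat \<Rightarrow> nat" where
  "column n i = (if i < n then 1 else 0)"

lemma shape_column [simp]: "shape (column n)"
  by (auto simp: shape_def column_def antimono_def)

lemma weight_column [simp]: "weight (column n) = n"
  by (subst weight_eq_sum[of n]) (simp_all add: column_def)

lemma column_inject [simp]: "column m = column n \<longleftrightarrow> m = n"
  using weight_column by metis

text \<open>A horizontal strip has at most one cell in the only column, and that cell must be the
  lowest one. At \<open>n = 0\<close> the two alternatives coincide.\<close>

lemma strip_column:
  "strip (column n) g \<longleftrightarrow> g = column n \<or> g = column (n - 1)"
proof
  assume g: "strip (column n) g"
  have le: "g i \<le> (if i < n then 1 else 0)" "(if Suc i < n then 1 else 0) \<le> g i" for i
    using g by (auto simp: strip_def column_def)
  show "g = column n \<or> g = column (n - 1)"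
  proof (cases "n = 0")
    case True
    then show ?thesis using le(1) by (auto simp: column_def fun_eq_iff)
  next
    case False
    have eq: "g i = (if i < n - 1 then 1 else if i = n - 1 then g (n - 1) else 0)" for i
      using le(1)[of i] le(2)[of i] by (auto split: if_splits)
    have "g (n - 1) \<le> 1" using le(1)[of "n - 1"] by (simp split: if_splits)
    then consider "g (n - 1) = 0" | "g (n - 1) = 1" by linarith
    then show ?thesis
    proof cases
      case 1
      have "g i = column (n - 1) i" for i
        by (subst eq) (use 1 in \<open>auto simp: column_def\<close>)
      then show ?thesis by blast
    next
      case 2
      have "g i = column n i" for i
        using False by (subst eq) (use 2 in \<open>auto simp: column_def\<close>)
      then show ?thesis by blast
    qed
  qed
qed (auto simp: strip_def column_def)

text \<open>A column tableau lists a set of distinct entries in increasing order, so its content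
  determines it. The induction decides whether the largest possible entry occurs at the
  bottom.\<close>

lemma kostka_column:
  assumes "Poly_Mapping.keys m \<subseteq> {..<k}"
  shows "kostka (column n) m = (if mono_degree m = n \<and> (\<forall>i. Poly_Mapping.lookup m i \<le> 1) then 1 else 0)"
  using assms
proof (induction k arbitrary: n m)
  case 0
  have "column n = (\<lambda>_. 0) \<longleftrightarrow> n = 0"
    by (auto simp: column_def fun_eq_iff)
  with 0 show ?case by (auto simp: kostka_zero mono_degree_def)
next
  case (Suc k)
  obtain m' b where m: "m = m' + Poly_Mapping.single k b" and m': "Poly_Mapping.keys m' \<subseteq> {..<k}"
    by (rule keys_lessThan_Suc_split[OF Suc.prems])
  have m'k: "Poly_Mapping.lookup m' k = 0" using m' by (auto simp: in_keys_iff)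
  have le: "(\<forall>i. Poly_Mapping.lookup m i \<le> 1) \<longleftrightarrow> b \<le> 1 \<and> (\<forall>i. Poly_Mapping.lookup m' i \<le> 1)"
  proof -
    have "Poly_Mapping.lookup m i = (if i = k then b else Poly_Mapping.lookup m' i)" for i
      by (auto simp: m lookup_add lookup_single m'k)
    then show ?thesis using m'k by (metis zero_le_one)
  qed
  have deg: "mono_degree m = mono_degree m' + b"
    by (simp add: m mono_degree_add)
  have rec: "kostka (column n) m =
      (\<Sum>g | strip (column n) g \<and> weight (column n) = weight g + b. kostka g m')"
    unfolding m by (rule kostka_add_single[OF shape_column m'])
  \<comment> \<open>The guard \<open>n \<ge> 1\<close> matters: at \<open>n = 0\<close> truncated
    subtraction makes \<open>column (n - 1)\<close> the empty shape, which has the wrong weight for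
    \<open>b = 1\<close>.\<close>
  have set: "{g. strip (column n) g \<and> weight (column n) = weight g + b} =
      (if b = 0 then {column n} else if b = 1 \<and> n \<ge> 1 then {column (n - 1)} else {})"
  proof (rule set_eqI)
    fix g
    consider "g = column n" | "g = column (n - 1)" | "g \<noteq> column n" "g \<noteq> column (n - 1)" by blast
    then show "g \<in> {g. strip (column n) g \<and> weight (column n) = weight g + b} \<longleftrightarrow>
      g \<in> (if b = 0 then {column n} else if b = 1 \<and> n \<ge> 1 then {column (n - 1)} else {})"
      by cases (auto simp: strip_column)
  qed
  show ?case
    unfolding rec set deg le using Suc.IH[OF m'] by auto
qed

lemma sym_e_eq_shape_schur: "sym_e n = shape_schur (column n)"
proof (rule powser_eqI)
  fix m :: monomial
  obtain k where "Poly_Mapping.keys m \<subseteq> {..<k}" using keys_bound[of m] ..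
  from kostka_column[OF this, of n] show "pcoeff (sym_e n) m = pcoeff (shape_schur (column n)) m"
    by (simp add: sym_e_def)
qed

section \<open>Triangularity and linear independence of the Schur functions\<close>

lemma kostka_dominance:
  assumes f: "shape f" and nz: "kostka f m \<noteq> 0"
  shows "(\<Sum>i<k. Poly_Mapping.lookup m i) \<le> (\<Sum>i<k. f i)"
proof -
  obtain T where T: "T \<in> tableaux f (Poly_Mapping.lookup m)"
    using nz by (auto simp: kostka_def card_eq_0_iff)
  have fin: "finite (cells f)" by (rule finite_cells[OF f])
  \<comment> \<open>Strict columns with entries starting at 0 force an entry to be at least its row
    index. So all entries below \<open>k\<close> lie in the first \<open>k\<close> rows, which is
    the dominance inequality.\<close>
  have ge: "T (i, j) \<ge> i" if "(i, j) \<in> cells f" for i j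
    using that
  proof (induction i)
    case (Suc i)
    then have "(i, j) \<in> cells f"
      using shape_antimono[OF f, of i "Suc i"] by (simp add: cells_def)
    with Suc.IH tableauxD(3)[OF T Suc.prems] show ?case by simp
  qed simp
  have "(\<Sum>i<k. Poly_Mapping.lookup m i) = (\<Sum>i<k. card {x \<in> cells f. T x = i})"
    using tableauxD(4)[OF T] by simp
  also have "\<dots> = card (\<Union>i<k. {x \<in> cells f. T x = i})"
    by (rule card_UN_disjoint[symmetric]) (use fin in auto)
  also have "\<dots> \<le> card (Sigma {..<k} (\<lambda>i. {..<f i}))"
  proof (rule card_mono)
    show "(\<Union>i<k. {x \<in> cells f. T x = i}) \<subseteq> Sigma {..<k} (\<lambda>i. {..<f i})"
      using ge by (fastforce simp: cells_def)
  qed simp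
  also have "\<dots> = (\<Sum>i<k. f i)" by simp
  finally show ?thesis .
qed

text \<open>Writing the row index into every cell gives a tableau with content \<open>f\<close>, so
  the diagonal of the triangular matrix is nonzero. Finite support makes \<open>f\<close> an
  exponent vector.\<close>

lemma kostka_self:
  assumes f: "shape f"
  shows "kostka f (Abs_poly_mapping f) \<noteq> 0" "Poly_Mapping.lookup (Abs_poly_mapping f) = f"
proof -
  obtain N where N: "\<And>i. i \<ge> N \<Longrightarrow> f i = 0" using shape_eventually_zero[OF f] by blast
  have "i < N" if "f i \<noteq> 0" for i using N[of i] that by (cases "i < N") auto
  then have "{i. f i \<noteq> 0} \<subseteq> {..<N}" by blast
  then have "finite {i. f i \<noteq> 0}" by (rule finite_subset) simp
  then show look: "Poly_Mapping.lookup (Abs_poly_mapping f) = f" by simp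
  have "(\<lambda>x\<in>cells f. fst x) \<in> tableaux f f"
  proof (rule tableauxI)
    fix k
    have "{x \<in> cells f. (\<lambda>x\<in>cells f. fst x) x = k} = {k} \<times> {..<f k}"
      by (auto simp: cells_def)
    then show "card {x \<in> cells f. (\<lambda>x\<in>cells f. fst x) x = k} = f k" by simp
  next
    fix i j assume "(Suc i, j) \<in> cells f"
    moreover have "(i, j) \<in> cells f"
      using calculation shape_antimono[OF f, of i "Suc i"] by (simp add: cells_def)
    ultimately show "(\<lambda>x\<in>cells f. fst x) (i, j) < (\<lambda>x\<in>cells f. fst x) (Suc i, j)" by simp
  qed (auto simp: cells_def)
  moreover have "finite (tableaux f f)"
    by (rule finite_tableaux[OF f, of N]) (use N in auto)
  ultimately show "kostka f (Abs_poly_mapping f) \<noteq> 0"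
    by (auto simp: kostka_def look)
qed

text \<open>Among the shapes with nonzero coefficient take \<open>g\<close> maximal and read off the
  coefficient of the monomial with exponents \<open>g\<close>: only shapes dominating
  \<open>g\<close> contribute, and by maximality this leaves \<open>g\<close> alone.\<close>

lemma shape_schur_independent:
  fixes c :: "(nat \<Rightarrow> nat) \<Rightarrow> 'a :: field_char_0"
  assumes fin: "finite S" and S: "S \<subseteq> Collect shape"
    and zero: "(\<Sum>f\<in>S. pscale (c f) (shape_schur f)) = 0"
  shows "\<forall>f\<in>S. c f = 0"
proof (rule ccontr)
  assume "\<not> (\<forall>f\<in>S. c f = 0)"
  define S' where "S' = {f\<in>S. c f \<noteq> 0}"
  have S': "finite S'" "S' \<noteq> {}"
    using fin \<open>\<not> (\<forall>f\<in>S. c f = 0)\<close> by (auto simp: S'_def)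
  have "\<exists>N. \<forall>f\<in>S. \<forall>i\<ge>N. f i = 0"
    using fin S
  proof (induction rule: finite_induct)
    case (insert f F)
    then obtain N where N: "\<forall>g\<in>F. \<forall>i\<ge>N. g i = 0" by auto
    obtain M where M: "\<And>i. i \<ge> M \<Longrightarrow> f i = 0"
      using insert.prems shape_eventually_zero[of f] by blast
    have "\<forall>g\<in>insert f F. \<forall>i\<ge>max M N. g i = 0" using N M by simp
    then show ?case by blast
  qed simp
  then obtain N where N: "\<And>f i. f \<in> S \<Longrightarrow> i \<ge> N \<Longrightarrow> f i = 0" by blast
  \<comment> \<open>The sum of all partial sums is strictly monotone for dominance, so maximizing
    this number replaces an argument about maximal elements of a partial order. All shapes involved
    vanish from row \<open>N\<close> on.\<close>
  define M where "M f = (\<Sum>k\<le>N. \<Sum>i<k. f i)" for f :: "nat \<Rightarrow> nat"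
  obtain g where g: "g \<in> S'" and max: "\<And>f. f \<in> S' \<Longrightarrow> M f \<le> M g"
  proof -
    have "Max (M ` S') \<in> M ` S'" using S' by (intro Max_in) auto
    then obtain g where "g \<in> S'" "M g = Max (M ` S')" by auto
    then show thesis using S' by (intro that[of g]) auto
  qed
  have gS: "g \<in> S" "shape g" using g S by (auto simp: S'_def)
  let ?m = "Abs_poly_mapping g"
  have vanish: "c f * of_nat (kostka f ?m) = 0" if "f \<in> S - {g}" for f
  proof (rule ccontr)
    assume nz: "c f * of_nat (kostka f ?m) \<noteq> 0"
    then have f: "f \<in> S" "f \<noteq> g" "f \<in> S'" "kostka f ?m \<noteq> 0" using that by (auto simp: S'_def)
    then have "shape f" using S by auto
    then have dom: "(\<Sum>i<k. g i) \<le> (\<Sum>i<k. f i)" for k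
      using kostka_dominance[of f ?m k] f(4) by (simp add: kostka_self(2)[OF gS(2)])
    have "M g \<le> M f"
      unfolding M_def by (rule sum_mono) (rule dom)
    with max[OF f(3)] have "M g = M f" by (rule antisym[rotated])
    have eq: "(\<Sum>i<k. g i) = (\<Sum>i<k. f i)" if "k \<le> N" for k
    proof (rule ccontr)
      assume "(\<Sum>i<k. g i) \<noteq> (\<Sum>i<k. f i)"
      then have "(\<Sum>i<k. g i) < (\<Sum>i<k. f i)" using dom[of k] by simp
      then have "M g < M f"
        unfolding M_def using that dom by (intro sum_strict_mono_ex1) auto
      with \<open>M g = M f\<close> show False by simp
    qed
    have "f i = g i" for i
    proof (cases "i < N")
      case True
      then show ?thesis using eq[of "Suc i"] eq[of i] by simp
    next
      case False
      then show ?thesis using N[OF f(1), of i] N[OF gS(1), of i] by simp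
    qed
    with f(2) show False by (simp add: fun_eq_iff)
  qed
  have rest: "(\<Sum>f\<in>S - {g}. c f * of_nat (kostka f ?m)) = 0"
    using vanish by (intro sum.neutral ballI)
  have "0 = pcoeff (\<Sum>f\<in>S. pscale (c f) (shape_schur f)) ?m"
    by (simp add: zero zero_powser.rep_eq)
  also have "\<dots> = (\<Sum>f\<in>S. c f * of_nat (kostka f ?m))"
    by (simp add: pcoeff_sum pscale.rep_eq)
  also have "\<dots> = c g * of_nat (kostka g ?m) + (\<Sum>f\<in>S - {g}. c f * of_nat (kostka f ?m))"
    by (rule sum.remove[OF fin gS(1)])
  also have "\<dots> = c g * of_nat (kostka g ?m)"
    using rest by simp
  finally show False
    using kostka_self(1)[OF gS(2)] g by (simp add: S'_def)
qed

section \<open>Partitions as lists, and coordinates in the Schur basis\<close>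

definition row_lengths :: "nat list \<Rightarrow> nat \<Rightarrow> nat" where
  "row_lengths \<mu> i = (if i < length \<mu> then \<mu> ! i else 0)"

lemma schur_eq_shape_schur: "schur \<mu> = shape_schur (row_lengths \<mu>)"
proof -
  have "diagram \<mu> = cells (row_lengths \<mu>)"
    by (auto simp: diagram_def cells_def row_lengths_def split: if_splits)
  then have "ssyt \<mu> m = tableaux (row_lengths \<mu>) (Poly_Mapping.lookup m)" for m
    by (simp add: ssyt_def tableaux_def)
  then show ?thesis
    by (simp add: schur_def shape_schur_def kostka_def)
qed

lemma row_lengths_partitions: "row_lengths ` Collect is_partition = Collect shape"
proof (intro equalityI subsetI)
  fix f assume "f \<in> row_lengths ` Collect is_partition"
  then obtain \<mu> where \<mu>: "is_partition \<mu>" and f: "f = row_lengths \<mu>" by auto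
  have "antimono f"
    unfolding antimono_iff_le_Suc using \<mu>
    by (auto simp: f row_lengths_def is_partition_def sorted_wrt_iff_nth_less)
  moreover have "f (length \<mu>) = 0" by (simp add: f row_lengths_def)
  ultimately show "f \<in> Collect shape" by (auto simp: shape_def)
next
  fix f assume "f \<in> Collect shape"
  then have f: "shape f" by simp
  then have ex: "\<exists>N. f N = 0" by (simp add: shape_def)
  \<comment> \<open>The list must stop at the first zero row, since a partition may not contain
    0.\<close>
  define N where "N = (LEAST N. f N = 0)"
  have N: "f N = 0" unfolding N_def using ex by (rule LeastI_ex)
  have pos: "f i \<noteq> 0" if "i < N" for i using that not_less_Least by (auto simp: N_def)
  have zero: "f i = 0" if "i \<ge> N" for i using shape_antimono[OF f that] N by simp
  have "is_partition (map f [0..<N])"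
    using shape_antimono[OF f] by (auto simp: is_partition_def sorted_wrt_iff_nth_less dest: pos)
  moreover have "row_lengths (map f [0..<N]) = f"
    using zero by (auto simp: row_lengths_def fun_eq_iff)
  ultimately show "f \<in> row_lengths ` Collect is_partition" by (metis image_eqI mem_Collect_eq)
qed

lemma schur_basis_eq: "schur ` Collect is_partition = shape_schur ` Collect shape"
  unfolding row_lengths_partitions[symmetric] by (auto simp: image_image schur_eq_shape_schur)

text \<open>Coordinates refer to a set of vectors, so distinctness of the indexed family is needed
  to pass between vectors and shapes. Two equal members would satisfy the nontrivial relation with
  coefficients 1 and -1.\<close>

lemma inj_on_shape_schur: "inj_on (shape_schur :: _ \<Rightarrow> 'a :: field_char_0 powser) (Collect shape)"
proof (rule inj_onI)
  fix f g assume fg: "f \<in> Collect shape" "g \<in> Collect shape"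
    and eq: "shape_schur f = (shape_schur g :: 'a powser)"
  show "f = g"
  proof (rule ccontr)
    assume ne: "f \<noteq> g"
    define c :: "(nat \<Rightarrow> nat) \<Rightarrow> 'a" where "c h = (if h = f then 1 else - 1)" for h
    have "(\<Sum>h\<in>{f, g}. pscale (c h) (shape_schur h)) = 0"
      using ne by (simp add: c_def eq pscale_one powser.scale_minus_left)
    with fg have "\<forall>h\<in>{f, g}. c h = 0"
      by (intro shape_schur_independent) auto
    then show False by (simp add: c_def)
  qed
qed

lemma independent_schur: "powser.independent (schur ` Collect is_partition :: 'a :: field_char_0 powser set)"
  unfolding schur_basis_eq powser.independent_explicit_module
proof clarify
  fix t :: "'a powser set" and u v
  assume t: "finite t" "t \<subseteq> shape_schur ` Collect shape" and z: "(\<Sum>v\<in>t. pscale (u v) v) = 0" and v: "v \<in> t"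
  obtain S where S: "S \<subseteq> Collect shape" "finite S" "t = shape_schur ` S"
    using finite_subset_image[OF t] by blast
  have inj: "inj_on (shape_schur :: _ \<Rightarrow> 'a powser) S"
    using inj_on_shape_schur S(1) by (rule inj_on_subset)
  have "(\<Sum>f\<in>S. pscale (u (shape_schur f)) (shape_schur f)) = 0"
    using z unfolding S(3) sum.reindex[OF inj] by simp
  from shape_schur_independent[OF S(2,1) this] v show "u v = 0"
    by (auto simp: S(3))
qed

lemma schur_coord_shape_schur:
  fixes a :: "(nat \<Rightarrow> nat) \<Rightarrow> 'a :: field_char_0"
  assumes fin: "finite S" and S: "S \<subseteq> Collect shape" and g: "g \<in> Collect shape"
  shows "schur_coord (\<Sum>f\<in>S. pscale (a f) (shape_schur f)) (shape_schur g) = (if g \<in> S then a g else 0)"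
proof -
  let ?B = "schur ` Collect is_partition :: 'a powser set"
  have in_B: "shape_schur f \<in> ?B" if "f \<in> S" for f
    using that S by (auto simp: schur_basis_eq)
  have "schur_coord (\<Sum>f\<in>S. pscale (a f) (shape_schur f)) (shape_schur g) =
      (\<Sum>f\<in>S. a f * (if shape_schur g = (shape_schur f :: 'a powser) then 1 else 0))"
    unfolding schur_coord_def
    using in_B by (simp add: powser.representation_sum powser.representation_scale
        powser.representation_basis independent_schur powser.span_base powser.span_scale)
  also have "\<dots> = (\<Sum>f\<in>S. if f = g then a f else 0)"
    using S g inj_onD[OF inj_on_shape_schur] by (intro sum.cong) auto
  also have "\<dots> = (if g \<in> S then a g else 0)"
    using fin by (simp add: sum.delta)
  finally show ?thesis .
qed

lemma hall_expansion:
  fixes a b :: "(nat \<Rightarrow> nat) \<Rightarrow> 'a :: field_char_0"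
  assumes fin: "finite S" and S: "S \<subseteq> Collect shape"
  shows "hall (\<Sum>f\<in>S. pscale (a f) (shape_schur f)) (\<Sum>f\<in>S. pscale (b f) (shape_schur f)) = (\<Sum>f\<in>S. a f * b f)"
proof -
  let ?x = "\<Sum>f\<in>S. pscale (a f) (shape_schur f)" and ?y = "\<Sum>f\<in>S. pscale (b f) (shape_schur f)"
  have coord: "schur_coord ?x (shape_schur f) = a f" "schur_coord ?y (shape_schur f) = b f" if "f \<in> S" for f
    using that S by (auto simp: schur_coord_shape_schur[OF fin S])
  \<comment> \<open>\<open>hall\<close> sums over the support of its first argument; inside the
    image of \<open>S\<close> the additional terms are 0.\<close>
  have supp: "{s. schur_coord ?x s \<noteq> 0} \<subseteq> shape_schur ` S"
  proof clarify
    fix s assume nz: "schur_coord ?x s \<noteq> 0"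
    then have "s \<in> schur ` Collect is_partition"
      unfolding schur_coord_def by (rule powser.representation_ne_zero)
    then obtain g where g: "g \<in> Collect shape" "s = shape_schur g"
      by (auto simp: schur_basis_eq)
    with nz show "s \<in> shape_schur ` S"
      by (auto simp: schur_coord_shape_schur[OF fin S] split: if_splits)
  qed
  have "hall ?x ?y = (\<Sum>s\<in>shape_schur ` S. schur_coord ?x s * schur_coord ?y s)"
    unfolding hall_def using fin supp by (intro sum.mono_neutral_left) auto
  also have "\<dots> = (\<Sum>f\<in>S. a f * b f)"
    by (subst sum.reindex[OF inj_on_subset[OF inj_on_shape_schur S]]) (simp add: coord)
  finally show ?thesis .
qed

section \<open>Pairing products of complete homogeneous functions\<close>

text \<open>The same Kostka numbers expand products of complete functions in Schur functions and
  Schur functions in monomials. This is the duality of complete and monomial functions, stated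
  without the latter.\<close>

lemma hall_sum_prod_sym_h:
  fixes c :: "'b \<Rightarrow> 'a :: field_char_0"
  assumes X: "\<And>x. x \<in> I \<Longrightarrow> sum_list (X x) = n"
    and g: "g = (\<Sum>f\<in>shapes n. pscale (b f) (shape_schur f))"
  shows "hall (\<Sum>x\<in>I. pscale (c x) (prod_list (map sym_h (X x)))) g =
    (\<Sum>x\<in>I. c x * pcoeff g (content_monomial (X x)))"
proof -
  have S: "finite (shapes n)" "shapes n \<subseteq> Collect shape"
    by (auto simp: finite_shapes) (simp add: shapes_def)
  have "(\<Sum>x\<in>I. pscale (c x) (prod_list (map sym_h (X x)))) =
      (\<Sum>x\<in>I. \<Sum>f\<in>shapes n. pscale (c x * of_nat (kostka f (content_monomial (X x)))) (shape_schur f))"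
    using X by (intro sum.cong) (simp_all add: prod_sym_h_expansion powser.scale_sum_right)
  also have "\<dots> = (\<Sum>f\<in>shapes n. pscale (\<Sum>x\<in>I. c x * of_nat (kostka f (content_monomial (X x)))) (shape_schur f))"
    by (subst sum.swap) (simp add: powser.scale_sum_left)
  finally have "hall (\<Sum>x\<in>I. pscale (c x) (prod_list (map sym_h (X x)))) g =
      (\<Sum>f\<in>shapes n. (\<Sum>x\<in>I. c x * of_nat (kostka f (content_monomial (X x)))) * b f)"
    by (simp only: g hall_expansion[OF S])
  also have "\<dots> = (\<Sum>x\<in>I. \<Sum>f\<in>shapes n. c x * of_nat (kostka f (content_monomial (X x))) * b f)"
    by (subst sum.swap) (simp add: sum_distrib_right)
  also have "\<dots> = (\<Sum>x\<in>I. c x * pcoeff g (content_monomial (X x)))"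
    by (simp add: g pcoeff_sum pscale.rep_eq sum_distrib_left mult_ac)
  finally show ?thesis .
qed

text \<open>Both sides are sums over shapes of a product of two Kostka numbers, symmetric in the two
  lists. The symmetry trades a coefficient of the power of \<open>sym_h 1\<close> for a coefficient
  at a squarefree monomial, where factorizations are subsets.\<close>

lemma pcoeff_prod_sym_h_commute:
  assumes "sum_list xs = sum_list ys"
  shows "pcoeff (prod_list (map sym_h xs) :: 'a :: field powser) (content_monomial ys) =
    pcoeff (prod_list (map sym_h ys)) (content_monomial xs)"
  by (simp add: prod_sym_h_expansion assms pcoeff_sum pscale.rep_eq mult.commute)

text \<open>Divisors of a squarefree monomial are subsets of its variables. Adding one variable
  reproduces Pascal's rule.\<close>

lemma card_submonomials_squarefree:
  assumes "Poly_Mapping.keys m \<subseteq> {..<k}" "\<And>i. Poly_Mapping.lookup m i \<le> 1"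
  shows "(\<Sum>(d, e) | d + e = m. if mono_degree d = x then 1 else 0) = mono_degree m choose x"
  using assms
proof (induction k arbitrary: m x)
  case 0
  have "{(d :: monomial, e). d + e = 0} = {(0, 0)}"
    by (auto simp: poly_mapping_eq_iff lookup_add fun_eq_iff plus_poly_mapping.rep_eq)
  moreover have "m = 0" using 0 by simp
  ultimately show ?case by (auto simp: mono_degree_def)
next
  case (Suc k)
  obtain m' b where m: "m = m' + Poly_Mapping.single k b" and m': "Poly_Mapping.keys m' \<subseteq> {..<k}"
    by (rule keys_lessThan_Suc_split[OF Suc.prems(1)])
  have m'k: "Poly_Mapping.lookup m' k = 0" using m' by (auto simp: in_keys_iff)
  have le: "Poly_Mapping.lookup m' i \<le> 1" for i
    using Suc.prems(2)[of i] by (simp add: m lookup_add)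
  have b: "b = 0 \<or> b = 1"
    using Suc.prems(2)[of k] by (auto simp: m lookup_add m'k)
  have IH: "(\<Sum>(d, e) | d + e = m'. if mono_degree d = y then 1 else 0) = mono_degree m' choose y" for y
    by (rule Suc.IH[OF m' le])
  have rec: "(\<Sum>(d, e) | d + e = m. if mono_degree d = x then 1 else 0) =
      (\<Sum>j\<le>b. \<Sum>(d, e) | d + e = m'. if mono_degree d + j = x then 1 else (0 :: nat))"
    unfolding m by (subst sum_antidiagonal_add_single[OF m'k]) (simp add: mono_degree_add)
  show ?case
  proof (cases "b = 0")
    case True
    then show ?thesis unfolding rec by (simp add: IH m)
  next
    case False
    then have "b = 1" using b by simp
    then show ?thesis
      unfolding rec by (cases x) (simp_all add: IH[unfolded case_prod_unfold] m mono_degree_add case_prod_unfold)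
  qed
qed

text \<open>The multinomial coefficient as a telescoping product of binomials, in the form that
  follows the factors of a product of \<open>sym_h\<close>.\<close>

fun multinom :: "nat list \<Rightarrow> nat" where
  "multinom [] = 1"
| "multinom (x # xs) = (sum_list (x # xs) choose x) * multinom xs"

text \<open>Each factor selects its variables among those left over by the earlier factors.\<close>

lemma pcoeff_prod_sym_h_squarefree:
  assumes "\<And>i. Poly_Mapping.lookup m i \<le> 1" "mono_degree m = sum_list xs"
  shows "pcoeff (prod_list (map sym_h xs) :: 'a :: comm_ring_1 powser) m = of_nat (multinom xs)"
  using assms
proof (induction xs arbitrary: m)
  case Nil
  then have "m = 0"
    by (auto simp: mono_degree_def in_keys_iff intro!: poly_mapping_eqI)
  then show ?case by (simp add: one_powser.rep_eq)
next
  case (Cons x xs)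
  let ?H = "prod_list (map sym_h xs) :: 'a powser"
  obtain k where k: "Poly_Mapping.keys m \<subseteq> {..<k}" using keys_bound[of m] ..
  have "pcoeff (sym_h x * ?H) m =
      (\<Sum>(d, e) | d + e = m. (if mono_degree d = x then 1 else 0) * pcoeff ?H e)"
    by (simp add: times_powser.rep_eq sym_h_def)
  also have "\<dots> = (\<Sum>(d, e) | d + e = m. of_nat (if mono_degree d = x then 1 else 0) * of_nat (multinom xs))"
  proof (rule sum.cong[OF refl], clarify)
    fix d e assume m: "m = d + e"
    have "pcoeff ?H e = of_nat (multinom xs)" if "mono_degree d = x"
    proof (rule Cons.IH)
      show "Poly_Mapping.lookup e i \<le> 1" for i
        using Cons.prems(1)[of i] by (simp add: m lookup_add)
      show "mono_degree e = sum_list xs"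
        using Cons.prems(2) that by (simp add: m mono_degree_add)
    qed
    then show "(if mono_degree d = x then 1 else 0) * pcoeff ?H e =
        of_nat (if mono_degree d = x then 1 else 0) * of_nat (multinom xs)" by simp
  qed
  also have "\<dots> = of_nat ((\<Sum>(d, e) | d + e = m. if mono_degree d = x then 1 else 0) * multinom xs)"
    by (simp only: case_prod_unfold of_nat_sum of_nat_mult sum_distrib_right)
  also have "\<dots> = of_nat (multinom (x # xs))"
    using card_submonomials_squarefree[OF k Cons.prems(1)] Cons.prems(2) by simp
  finally show ?case by simp
qed

lemma mono_degree_content: "mono_degree (content_monomial xs) = sum_list xs"
  by (induction xs) (simp_all add: mono_degree_add mono_degree_def[of 0])

lemma content_le_1_iff: "(\<forall>i. Poly_Mapping.lookup (content_monomial xs) i \<le> 1) \<longleftrightarrow> (\<forall>x\<in>set xs. x \<le> 1)"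
proof (induction xs)
  case (Cons x xs)
  have "Poly_Mapping.lookup (content_monomial xs) (length xs) = 0"
    using keys_content[of xs] by (auto simp: in_keys_iff)
  then have "Poly_Mapping.lookup (content_monomial (x # xs)) i =
      (if i = length xs then x else Poly_Mapping.lookup (content_monomial xs) i)" for i
    by (auto simp: lookup_add lookup_single)
  then have "(\<forall>i. Poly_Mapping.lookup (content_monomial (x # xs)) i \<le> 1) \<longleftrightarrow>
      x \<le> 1 \<and> (\<forall>i. Poly_Mapping.lookup (content_monomial xs) i \<le> 1)"
    using \<open>Poly_Mapping.lookup (content_monomial xs) (length xs) = 0\<close> by (metis zero_le_one)
  with Cons show ?case by simp
qed simp

lemma hall_sum_prod_sym_h_h1_power:
  fixes c :: "'b \<Rightarrow> 'a :: field_char_0"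
  assumes "\<And>x. x \<in> I \<Longrightarrow> sum_list (X x) = n"
  shows "hall (\<Sum>x\<in>I. pscale (c x) (prod_list (map sym_h (X x)))) (sym_h 1 ^ n) =
    (\<Sum>x\<in>I. c x * of_nat (multinom (X x)))"
proof -
  have h1: "sym_h 1 ^ n = (prod_list (map sym_h (replicate n 1)) :: 'a powser)"
    by (induction n) simp_all
  have sum: "sum_list (replicate n (1 :: nat)) = n"
    by (simp add: sum_list_replicate)
  have "pcoeff (sym_h 1 ^ n :: 'a powser) (content_monomial (X x)) = of_nat (multinom (X x))" if "x \<in> I" for x
  proof -
    have eq: "sum_list (replicate n 1) = sum_list (X x)" using assms[OF that] sum by simp
    have "\<forall>i. Poly_Mapping.lookup (content_monomial (replicate n 1)) i \<le> 1"
      unfolding content_le_1_iff by simp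
    then show ?thesis
      unfolding h1 pcoeff_prod_sym_h_commute[OF eq]
      using eq by (intro pcoeff_prod_sym_h_squarefree) (auto simp: mono_degree_content)
  qed
  note coeff = this
  have rep: "sym_h 1 ^ n = (\<Sum>f\<in>shapes n. pscale (of_nat (kostka f (content_monomial (replicate n 1))))
      (shape_schur f :: 'a powser))"
    unfolding h1 prod_sym_h_expansion sum ..
  have "hall (\<Sum>x\<in>I. pscale (c x) (prod_list (map sym_h (X x)))) (sym_h 1 ^ n) =
    (\<Sum>x\<in>I. c x * pcoeff (sym_h 1 ^ n) (content_monomial (X x)))"
    using assms rep by (rule hall_sum_prod_sym_h)
  also have "\<dots> = (\<Sum>x\<in>I. c x * of_nat (multinom (X x)))"
    by (rule sum.cong[OF refl]) (simp only: coeff)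
  finally show ?thesis .
qed

lemma hall_sum_prod_sym_h_e:
  fixes c :: "'b \<Rightarrow> 'a :: field_char_0"
  assumes "\<And>x. x \<in> I \<Longrightarrow> sum_list (X x) = n"
  shows "hall (\<Sum>x\<in>I. pscale (c x) (prod_list (map sym_h (X x)))) (sym_e n) =
    (\<Sum>x\<in>I. if \<forall>k\<in>set (X x). k \<le> 1 then c x else 0)"
proof -
  have "column n \<in> shapes n" by (simp add: shapes_def)
  then have rep: "sym_e n = (\<Sum>f\<in>shapes n. pscale (if f = column n then 1 else 0) (shape_schur f :: 'a powser))"
    by (subst sum.remove[of _ "column n"]) (auto simp: sym_e_eq_shape_schur finite_shapes pscale_one intro!: sum.neutral)
  have "hall (\<Sum>x\<in>I. pscale (c x) (prod_list (map sym_h (X x)))) (sym_e n) =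
    (\<Sum>x\<in>I. c x * pcoeff (sym_e n) (content_monomial (X x)))"
    using assms rep by (rule hall_sum_prod_sym_h)
  also have "\<dots> = (\<Sum>x\<in>I. if \<forall>k\<in>set (X x). k \<le> 1 then c x else 0)"
    using assms by (intro sum.cong) (auto simp: sym_e_def mono_degree_content content_le_1_iff[unfolded One_nat_def])
  finally show ?thesis .
qed

section \<open>Compositions as descent sets\<close>

text \<open>A recursive descent set, made for list induction. The test for \<open>[]\<close>
  excludes the full sum, which is not a descent.\<close>

fun partial_sums :: "nat list \<Rightarrow> nat set" where
  "partial_sums [] = {}"
| "partial_sums (x # xs) = (if xs = [] then {} else insert x ((+) x ` partial_sums xs))"

lemma partial_sums_eq: "partial_sums xs = {sum_list (take i xs) | i. 1 \<le> i \<and> i < length xs}"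
proof (induction xs)
  case (Cons x xs)
  show ?case
  proof (cases "xs = []")
    case False
    have "{sum_list (take i (x # xs)) | i. 1 \<le> i \<and> i < length (x # xs)} =
        (\<lambda>i. sum_list (take (Suc i) (x # xs))) ` {i. i < length xs}"
    proof (intro equalityI subsetI)
      fix s assume "s \<in> {sum_list (take i (x # xs)) | i. 1 \<le> i \<and> i < length (x # xs)}"
      then obtain i where "s = sum_list (take i (x # xs))" "1 \<le> i" "i < length (x # xs)" by blast
      then show "s \<in> (\<lambda>i. sum_list (take (Suc i) (x # xs))) ` {i. i < length xs}"
        by (intro image_eqI[of _ _ "i - 1"]) auto
    next
      fix s assume "s \<in> (\<lambda>i. sum_list (take (Suc i) (x # xs))) ` {i. i < length xs}"
      then obtain i where "s = sum_list (take (Suc i) (x # xs))" "i < length xs" by blast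
      then show "s \<in> {sum_list (take i (x # xs)) | i. 1 \<le> i \<and> i < length (x # xs)}"
        by (intro CollectI exI[of _ "Suc i"]) auto
    qed
    also have "{i. i < length xs} = insert 0 {i. 1 \<le> i \<and> i < length xs}"
      using False by auto
    also have "(\<lambda>i. sum_list (take (Suc i) (x # xs))) ` \<dots> =
        insert x ((+) x ` {sum_list (take i xs) | i. 1 \<le> i \<and> i < length xs})"
      by (auto simp: image_def)
    finally show ?thesis using False Cons by simp
  qed auto
qed simp

lemma descents_eq_partial_sums: "descents \<alpha> = partial_sums (parts \<alpha>)"
  by (simp add: descents_def partial_sums_eq len_def)

lemma partial_sums_subset: "0 \<notin> set xs \<Longrightarrow> partial_sums xs \<subseteq> {1..<sum_list xs}"
proof (induction xs)
  case (Cons x xs)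
  then have "sum_list xs > 0" if "xs \<noteq> []" using that by (cases xs) auto
  with Cons show ?case by (auto simp: subset_iff)
qed simp

lemma finite_partial_sums: "finite (partial_sums xs)"
  by (induction xs) auto

lemma partial_sums_insert_disjoint:
  "0 \<notin> set xs \<Longrightarrow> x \<notin> (+) x ` partial_sums xs"
  using partial_sums_subset[of xs] by auto

lemma card_partial_sums: "0 \<notin> set xs \<Longrightarrow> card (partial_sums xs) = length xs - 1"
proof (induction xs)
  case (Cons x xs)
  then show ?case
    using partial_sums_insert_disjoint[of xs x] finite_partial_sums[of xs]
    by (auto simp: card_image)
qed simp

text \<open>The first part is the least partial sum, so the list can be read off part by part. When
  no partial sum is left, the common total determines the last part.\<close>

lemma partial_sums_inject:
  assumes "0 \<notin> set xs" "0 \<notin> set ys" "sum_list xs = sum_list ys" "partial_sums xs = partial_sums ys"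
  shows "xs = ys"
  using assms
proof (induction xs arbitrary: ys)
  case Nil
  then show ?case by (cases ys) auto
next
  case (Cons x xs)
  then obtain y zs where ys: "ys = y # zs" by (cases ys) auto
  show ?case
  proof (cases "xs = []")
    case True
    then have "zs = []" using Cons.prems(4) by (auto simp: ys split: if_splits)
    with True Cons.prems(3) show ?thesis by (simp add: ys)
  next
    case False
    then have zs: "zs \<noteq> []" using Cons.prems(4) by (auto simp: ys split: if_splits)
    have Min: "Min (insert u ((+) u ` partial_sums us)) = u" for u us
      using finite_partial_sums[of us] by (intro Min_eqI) auto
    have eq: "insert x ((+) x ` partial_sums xs) = insert y ((+) y ` partial_sums zs)"
      using Cons.prems(4) False zs by (simp add: ys)
    then have xy: "x = y" using Min by metis
    have "(+) x ` partial_sums xs = (+) x ` partial_sums zs"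
      using eq partial_sums_insert_disjoint[of xs x] partial_sums_insert_disjoint[of zs x] Cons.prems(1,2)
      unfolding xy[symmetric] ys by (simp add: insert_ident)
    then have "partial_sums xs = partial_sums zs"
      by (simp add: inj_image_eq_iff)
    with Cons.IH[of zs] Cons.prems show ?thesis by (simp add: ys xy)
  qed
qed

text \<open>The least element \<open>a\<close> of \<open>S\<close> becomes the first part; the other
  elements, lowered by \<open>a\<close>, describe a composition of \<open>n - a\<close>.\<close>

lemma partial_sums_surj:
  "S \<subseteq> {1..<n} \<Longrightarrow> \<exists>xs. 0 \<notin> set xs \<and> sum_list xs = n \<and> partial_sums xs = S"
proof (induction n arbitrary: S rule: less_induct)
  case (less n)
  show ?case
  proof (cases "S = {}")
    case True
    then show ?thesis
      by (intro exI[of _ "if n = 0 then [] else [n]"]) auto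
  next
    case False
    have fin: "finite S" using less.prems by (rule finite_subset) simp
    define a where "a = Min S"
    have a: "a \<in> S" "\<And>s. s \<in> S \<Longrightarrow> a \<le> s"
      using fin False by (auto simp: a_def)
    then have an: "1 \<le> a" "a < n" using less.prems by auto
    let ?S = "(\<lambda>s. s - a) ` (S - {a})"
    have "?S \<subseteq> {1..<n - a}"
    proof
      fix y assume "y \<in> ?S"
      then obtain s where s: "s \<in> S" "s \<noteq> a" "y = s - a" by auto
      then have "a < s" "s < n" using a(2)[of s] less.prems by auto
      then show "y \<in> {1..<n - a}" using s by auto
    qed
    then obtain xs where xs: "0 \<notin> set xs" "sum_list xs = n - a" "partial_sums xs = ?S"
      using less.IH[of "n - a" ?S] an by auto
    have "(+) a ` ?S = S - {a}"
      using a(2) by (force simp: image_image intro!: image_eqI)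
    then have "partial_sums (a # xs) = S"
      using xs an a(1) by (auto simp: insert_absorb)
    then show ?thesis
      using xs an by (intro exI[of _ "a # xs"]) auto
  qed
qed

lemma zero_notin_parts: "0 \<notin> set (parts \<alpha>)"
  using parts[of \<alpha>] by simp

lemma bij_betw_descents: "bij_betw descents (compositions n) (Pow {1..<n})"
proof (rule bij_betwI')
  fix \<alpha> \<beta> assume "\<alpha> \<in> compositions n" "\<beta> \<in> compositions n"
  then show "descents \<alpha> = descents \<beta> \<longleftrightarrow> \<alpha> = \<beta>"
    using partial_sums_inject[OF zero_notin_parts zero_notin_parts, of \<alpha> \<beta>]
    by (auto simp: compositions_def size_composition_def descents_eq_partial_sums parts_inject)
next
  fix \<alpha> assume "\<alpha> \<in> compositions n"
  then show "descents \<alpha> \<in> Pow {1..<n}"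
    using partial_sums_subset[OF zero_notin_parts, of \<alpha>]
    by (auto simp: compositions_def size_composition_def descents_eq_partial_sums)
next
  fix S assume "S \<in> Pow {1..<n}"
  then obtain xs where "0 \<notin> set xs" "sum_list xs = n" "partial_sums xs = S"
    using partial_sums_surj[of S n] by auto
  then show "\<exists>\<alpha>\<in>compositions n. S = descents \<alpha>"
    by (intro bexI[of _ "Abs_composition xs"])
      (auto simp: compositions_def size_composition_def descents_eq_partial_sums Abs_composition_inverse)
qed

lemma descents_subset: "descents \<alpha> \<subseteq> {1..<size \<alpha>}"
  using partial_sums_subset[OF zero_notin_parts, of \<alpha>]
  by (simp add: size_composition_def descents_eq_partial_sums)

lemma finite_descents: "finite (descents \<alpha>)"
  by (simp add: descents_eq_partial_sums finite_partial_sums)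

section \<open>Complement, reversal and the statistics\<close>

lemma descents_complement:
  "size (complement \<alpha>) = size \<alpha>" "descents (complement \<alpha>) = {1..<size \<alpha>} - descents \<alpha>"
proof -
  have "{1..<size \<alpha>} - descents \<alpha> \<in> Pow {1..<size \<alpha>}" by auto
  then obtain \<gamma> where "\<gamma> \<in> compositions (size \<alpha>)" "descents \<gamma> = {1..<size \<alpha>} - descents \<alpha>"
    using bij_betw_descents[of "size \<alpha>"] by (metis bij_betw_iff_bijections)
  moreover have "\<gamma>' = \<gamma>''" if "size \<gamma>' = n" "size \<gamma>'' = n" "descents \<gamma>' = descents \<gamma>''" for \<gamma>' \<gamma>'' n
    using that bij_betw_descents[of n] unfolding bij_betw_def
    by (auto simp: compositions_def dest: inj_onD)
  ultimately have "\<exists>!\<gamma>. size \<gamma> = size \<alpha> \<and> descents \<gamma> = {1..<size \<alpha>} - descents \<alpha>"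
    by (intro ex1I[of _ \<gamma>]) (auto simp: compositions_def)
  from theI'[OF this] show "size (complement \<alpha>) = size \<alpha>"
    "descents (complement \<alpha>) = {1..<size \<alpha>} - descents \<alpha>"
    unfolding complement_def by auto
qed

text \<open>A prefix of the reversed list sums to the total minus a prefix sum of the
  original.\<close>

lemma descents_reverse: "descents (reverse \<alpha>) = (\<lambda>i. size \<alpha> - i) ` descents \<alpha>"
proof -
  let ?xs = "parts \<alpha>"
  have ps: "sum_list (take i (rev ?xs)) = sum_list ?xs - sum_list (take (length ?xs - i) ?xs)" for i
  proof -
    have "sum_list ?xs = sum_list (take (length ?xs - i) ?xs) + sum_list (drop (length ?xs - i) ?xs)"
      by (metis append_take_drop_id sum_list.append)
    then show ?thesis by (simp add: take_rev)
  qed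
  have "descents (reverse \<alpha>) = (\<lambda>i. sum_list (take i (rev ?xs))) ` {i. 1 \<le> i \<and> i < length ?xs}"
    by (auto simp: descents_def len_def reverse.rep_eq)
  also have "\<dots> = (\<lambda>i. sum_list ?xs - sum_list (take i ?xs)) ` (\<lambda>i. length ?xs - i) ` {i. 1 \<le> i \<and> i < length ?xs}"
    by (simp add: ps image_image)
  also have "(\<lambda>i. length ?xs - i) ` {i. 1 \<le> i \<and> i < length ?xs} = {i. 1 \<le> i \<and> i < length ?xs}"
  proof (intro equalityI subsetI)
    fix j assume j: "j \<in> {i. 1 \<le> i \<and> i < length ?xs}"
    then show "j \<in> (\<lambda>i. length ?xs - i) ` {i. 1 \<le> i \<and> i < length ?xs}"
      by (intro image_eqI[of _ _ "length ?xs - j"]) auto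
  qed auto
  also have "(\<lambda>i. sum_list ?xs - sum_list (take i ?xs)) ` {i. 1 \<le> i \<and> i < length ?xs} =
      (\<lambda>i. size \<alpha> - i) ` descents \<alpha>"
    by (auto simp: descents_def len_def size_composition_def)
  finally show ?thesis .
qed

lemma inj_on_diff_size: "inj_on (\<lambda>i. n - i) {1..<n :: nat}"
  by (auto simp: inj_on_def)

text \<open>Complement exchanges descents and non-descents and reversal reflects positions; this is
  the origin of the exponents n - i of \<open>q\<close>.\<close>

lemma n_stat_conjugate: "n_stat (conjugate \<alpha>) = (\<Sum>i\<in>{1..<size \<alpha>} - descents \<alpha>. size \<alpha> - i)"
  unfolding n_stat_def conjugate_def descents_reverse descents_complement
proof -
  have "inj_on (\<lambda>i. size \<alpha> - i) ({1..<size \<alpha>} - descents \<alpha>)"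
    by (rule inj_on_subset[OF inj_on_diff_size[of "size \<alpha>"]]) auto
  then show "\<Sum>((\<lambda>i. size \<alpha> - i) ` ({1..<size \<alpha>} - descents \<alpha>)) = (\<Sum>i\<in>{1..<size \<alpha>} - descents \<alpha>. size \<alpha> - i)"
    by (simp add: sum.reindex)
qed

lemma c_stat_conjugate:
  assumes "size \<beta> = size \<alpha>"
  shows "c_stat (conjugate \<alpha>) (reverse \<beta>) = (\<Sum>i\<in>descents \<beta> - descents \<alpha>. size \<alpha> - i)"
proof -
  let ?I = "{1..<size \<alpha>}"
  have sub: "descents \<beta> \<subseteq> ?I" using descents_subset[of \<beta>] assms by simp
  have "(\<lambda>i. size \<alpha> - i) ` (?I - descents \<alpha>) \<inter> (\<lambda>i. size \<alpha> - i) ` descents \<beta> =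
      (\<lambda>i. size \<alpha> - i) ` ((?I - descents \<alpha>) \<inter> descents \<beta>)"
    using sub by (intro inj_on_image_Int[OF inj_on_diff_size, symmetric]) auto
  also have "(?I - descents \<alpha>) \<inter> descents \<beta> = descents \<beta> - descents \<alpha>"
    using sub by auto
  finally have "c_stat (conjugate \<alpha>) (reverse \<beta>) = \<Sum>((\<lambda>i. size \<alpha> - i) ` (descents \<beta> - descents \<alpha>))"
    unfolding c_stat_def conjugate_def descents_reverse descents_complement by (simp add: assms)
  also have "\<dots> = (\<Sum>i\<in>descents \<beta> - descents \<alpha>. size \<alpha> - i)"
  proof -
    have "inj_on (\<lambda>i. size \<alpha> - i) (descents \<beta> - descents \<alpha>)"
      by (rule inj_on_subset[OF inj_on_diff_size[of "size \<alpha>"]]) (use sub in auto)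
    then show ?thesis by (simp add: sum.reindex)
  qed
  finally show ?thesis .
qed

text \<open>In the expanded product, \<open>B\<close> records the factors from which the
  \<open>True\<close> summand is taken.\<close>

lemma sum_Pow_prod:
  fixes f :: "'b \<Rightarrow> bool \<Rightarrow> 'a :: comm_semiring_1"
  assumes "finite I"
  shows "(\<Sum>B\<in>Pow I. \<Prod>i\<in>I. f i (i \<in> B)) = (\<Prod>i\<in>I. f i True + f i False)"
  using assms
proof (induction I rule: finite_induct)
  case (insert a I)
  have P: "(\<Prod>i\<in>I. f i (i = a \<or> i \<in> B)) = (\<Prod>i\<in>I. f i (i \<in> B))" for B
  proof (rule prod.cong[OF refl])
    fix i assume "i \<in> I"
    then have "i \<noteq> a" using insert(2) by auto
    then show "f i (i = a \<or> i \<in> B) = f i (i \<in> B)" by simp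
  qed
  have "inj_on (insert a) (Pow I)"
    using insert(2) by (auto simp: inj_on_def)
  moreover have "Pow I \<inter> insert a ` Pow I = {}" using insert(2) by auto
  ultimately have "(\<Sum>B\<in>Pow (insert a I). \<Prod>i\<in>insert a I. f i (i \<in> B)) =
      (\<Sum>B\<in>Pow I. \<Prod>i\<in>insert a I. f i (i \<in> B)) +
      (\<Sum>B\<in>Pow I. \<Prod>i\<in>insert a I. f i (i \<in> insert a B))"
    using insert(1) by (simp add: Pow_insert sum.union_disjoint sum.reindex)
  also have "(\<Sum>B\<in>Pow I. \<Prod>i\<in>insert a I. f i (i \<in> B)) = (\<Sum>B\<in>Pow I. f a False * (\<Prod>i\<in>I. f i (i \<in> B)))"
  proof (rule sum.cong[OF refl])
    fix B assume "B \<in> Pow I"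
    then have "a \<notin> B" using insert(2) by auto
    then show "(\<Prod>i\<in>insert a I. f i (i \<in> B)) = f a False * (\<Prod>i\<in>I. f i (i \<in> B))"
      using insert(1,2) by simp
  qed
  also have "(\<Sum>B\<in>Pow I. \<Prod>i\<in>insert a I. f i (i \<in> insert a B)) = (\<Sum>B\<in>Pow I. f a True * (\<Prod>i\<in>I. f i (i \<in> B)))"
    using insert(1,2) by (simp add: P)
  finally show ?case
    using insert by (simp add: sum_distrib_left[symmetric] distrib_right add.commute)
qed simp

text \<open>Compositions of \<open>n\<close> are identified with subsets of \<open>{1..<n}\<close>, so that all changes of basis
  below become tensor products of \<open>2 \<times> 2\<close> matrices \<open>u i\<close>, one for every \<open>i \<in> {1..<n}\<close>.\<close>

definition tensor :: "nat \<Rightarrow> (nat \<Rightarrow> bool \<Rightarrow> bool \<Rightarrow> 'a) \<Rightarrow> composition \<Rightarrow> composition \<Rightarrow> 'a :: comm_semiring_1" where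
  "tensor n u \<alpha> \<beta> = (\<Prod>i\<in>{1..<n}. u i (i \<in> descents \<alpha>) (i \<in> descents \<beta>))"

lemma sum_compositions_prod:
  fixes f :: "nat \<Rightarrow> bool \<Rightarrow> 'a :: comm_semiring_1"
  shows "(\<Sum>\<beta>\<in>compositions n. \<Prod>i\<in>{1..<n}. f i (i \<in> descents \<beta>)) = (\<Prod>i\<in>{1..<n}. f i True + f i False)"
  using sum.reindex_bij_betw[OF bij_betw_descents[of n], of "\<lambda>B. \<Prod>i\<in>{1..<n}. f i (i \<in> B)"]
  by (simp add: sum_Pow_prod)

text \<open>Tensor products are multiplied factorwise: by distributivity the sum over all middle
  compositions is a product of sums with two terms, each an entry of a product of 2 x 2
  matrices.\<close>

lemma sum_tensor_mult:
  "(\<Sum>\<beta>\<in>compositions n. tensor n u \<alpha> \<beta> * tensor n v \<beta> \<gamma>) =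
    tensor n (\<lambda>i a c. u i a True * v i True c + u i a False * v i False c) \<alpha> \<gamma>"
  unfolding tensor_def prod.distrib[symmetric]
  by (rule sum_compositions_prod[where n = n and f = "\<lambda>i b. u i (i \<in> descents \<alpha>) b * v i b (i \<in> descents \<gamma>)"])

lemma tensor_delta:
  assumes "\<alpha> \<in> compositions n" "\<beta> \<in> compositions n"
    and u: "\<And>i a b. i \<in> {1..<n} \<Longrightarrow> u i a b = (if a = b then 1 else 0)"
  shows "tensor n u \<alpha> \<beta> = (if \<alpha> = \<beta> then 1 else 0)"
proof (cases "\<alpha> = \<beta>")
  case True
  then show ?thesis unfolding tensor_def by (simp add: u)
next
  case False
  then have "descents \<alpha> \<noteq> descents \<beta>"
    using assms(1,2) bij_betw_descents[of n] by (auto simp: bij_betw_def dest: inj_onD)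
  moreover have "descents \<alpha> \<subseteq> {1..<n}" "descents \<beta> \<subseteq> {1..<n}"
    using assms(1,2) descents_subset[of \<alpha>] descents_subset[of \<beta>] by (auto simp: compositions_def)
  ultimately obtain i where "i \<in> {1..<n}" "(i \<in> descents \<alpha>) \<noteq> (i \<in> descents \<beta>)" by blast
  then have "tensor n u \<alpha> \<beta> = 0"
    unfolding tensor_def by (intro prod_zero) (auto intro!: bexI[of _ i] simp: u)
  with False show ?thesis by simp
qed

section \<open>The operator nabla\<close>

text \<open>Padding with 1 brings products over different subsets to one index set, where they can
  be merged factor by factor.\<close>

lemma prod_subset_mask:
  assumes "S \<subseteq> {1..<n :: nat}"
  shows "(\<Prod>i\<in>S. g i) = (\<Prod>i\<in>{1..<n}. if i \<in> S then g i else (1 :: 'a :: comm_monoid_mult))"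
  using prod.inter_restrict[of "{1..<n}" g S] assms by (simp add: Int_absorb1)

lemma len_eq: "len \<alpha> = (if size \<alpha> = 0 then 0 else card (descents \<alpha>) + 1)"
proof (cases "parts \<alpha>")
  case (Cons x xs)
  then have "size \<alpha> \<noteq> 0" using zero_notin_parts[of \<alpha>] by (auto simp: size_composition_def)
  then show ?thesis
    using card_partial_sums[OF zero_notin_parts, of \<alpha>] Cons by (simp add: len_def descents_eq_partial_sums)
qed (simp add: len_def size_composition_def)

lemma len_diff:
  assumes "refines \<alpha> \<beta>"
  shows "len \<alpha> - len \<beta> = card (descents \<alpha> - descents \<beta>)"
  using assms finite_descents[of \<beta>] descents_subset[of \<alpha>]
  by (auto simp: refines_def len_eq card_Diff_subset)

text \<open>Coarsening deletes descents, each at the cost of a sign, and never creates one.\<close>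

definition ribbon_mat :: "nat \<Rightarrow> bool \<Rightarrow> bool \<Rightarrow> qt_field" where
  "ribbon_mat i a c = (if a then (if c then 1 else - 1) else (if c then 0 else 1))"

lemma lookup_nc_ribbon:
  "Poly_Mapping.lookup (nc_ribbon \<alpha>) \<gamma> =
    (if size \<gamma> = size \<alpha> then tensor (size \<alpha>) ribbon_mat \<alpha> \<gamma> else 0)"
proof -
  have fin: "finite {\<beta>. refines \<alpha> \<beta>}"
    by (rule finite_subset[OF _ finite_compositions[of "size \<alpha>"]]) (auto simp: refines_def compositions_def)
  have "Poly_Mapping.lookup (nc_ribbon \<alpha>) \<gamma> =
      (\<Sum>\<beta> | refines \<alpha> \<beta>. if \<beta> = \<gamma> then (- 1) ^ (len \<alpha> - len \<gamma>) else 0)"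
    by (auto simp: nc_ribbon_def lookup_sum nc_h_comp_eq_single lookup_single when_def intro!: sum.cong)
  also have "\<dots> = (if refines \<alpha> \<gamma> then (- 1) ^ (len \<alpha> - len \<gamma>) else 0)"
    using fin by (simp add: sum.delta)
  also have "\<dots> = (if size \<gamma> = size \<alpha> then tensor (size \<alpha>) ribbon_mat \<alpha> \<gamma> else 0)"
  proof (cases "refines \<alpha> \<gamma>")
    case True
    then have sub: "descents \<gamma> \<subseteq> descents \<alpha>" "size \<gamma> = size \<alpha>" by (auto simp: refines_def)
    have "(- 1) ^ (len \<alpha> - len \<gamma>) = (\<Prod>i\<in>descents \<alpha> - descents \<gamma>. - 1 :: qt_field)"
      by (simp add: len_diff[OF True])
    also have "\<dots> = tensor (size \<alpha>) ribbon_mat \<alpha> \<gamma>"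
      using descents_subset[of \<alpha>] sub unfolding tensor_def
      by (subst prod_subset_mask[of _ "size \<alpha>"]) (auto simp: ribbon_mat_def intro!: prod.cong)
    finally show ?thesis using True sub by simp
  next
    case False
    have "tensor (size \<alpha>) ribbon_mat \<alpha> \<gamma> = 0" if sz: "size \<gamma> = size \<alpha>"
    proof -
      obtain i where i: "i \<in> descents \<gamma>" "i \<notin> descents \<alpha>"
        using False sz by (auto simp: refines_def)
      then have "i \<in> {1..<size \<alpha>}" using descents_subset[of \<gamma>] sz by auto
      with i show ?thesis
        unfolding tensor_def by (intro prod_zero) (auto intro!: bexI[of _ i] simp: ribbon_mat_def)
    qed
    with False show ?thesis by simp
  qed
  finally show ?thesis .
qed

definition eigenfactor :: "nat \<Rightarrow> nat \<Rightarrow> bool \<Rightarrow> qt_field" where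
  "eigenfactor n i a = (if a then t ^ i else q ^ (n - i))"

text \<open>With x the eigenfactor, the ribbon coefficients are x for \<open>True\<close> and 1 for
  \<open>False\<close>; multiplying this row by \<open>ribbon_mat\<close> gives x and 1 - x.\<close>

definition Hqt_mat :: "nat \<Rightarrow> nat \<Rightarrow> bool \<Rightarrow> bool \<Rightarrow> qt_field" where
  "Hqt_mat n i a c = (if c then eigenfactor n i a else 1 - eigenfactor n i a)"

lemma Hqt_coeff:
  assumes "size \<beta> = size \<alpha>"
  shows "t ^ c_stat \<alpha> \<beta> * q ^ c_stat (conjugate \<alpha>) (reverse \<beta>) =
    tensor (size \<alpha>) (\<lambda>i a b. if b then eigenfactor (size \<alpha>) i a else 1) \<alpha> \<beta>"
proof -
  have sub: "descents \<alpha> \<inter> descents \<beta> \<subseteq> {1..<size \<alpha>}" "descents \<beta> - descents \<alpha> \<subseteq> {1..<size \<alpha>}"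
    using descents_subset[of \<alpha>] descents_subset[of \<beta>] assms by auto
  show ?thesis
    unfolding c_stat_conjugate[OF assms] c_stat_def[of \<alpha>] power_sum prod_subset_mask[OF sub(1)]
      prod_subset_mask[OF sub(2)] tensor_def prod.distrib[symmetric]
    by (rule prod.cong[OF refl]) (auto simp: eigenfactor_def)
qed

lemma lookup_nc_Hqt:
  "Poly_Mapping.lookup (nc_Hqt \<alpha>) \<gamma> =
    (if size \<gamma> = size \<alpha> then tensor (size \<alpha>) (Hqt_mat (size \<alpha>)) \<alpha> \<gamma> else 0)"
proof -
  let ?n = "size \<alpha>"
  have "Poly_Mapping.lookup (nc_Hqt \<alpha>) \<gamma> = (\<Sum>\<beta>\<in>compositions ?n.
      tensor ?n (\<lambda>i a b. if b then eigenfactor ?n i a else 1) \<alpha> \<beta> *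
      (if size \<gamma> = ?n then tensor ?n ribbon_mat \<beta> \<gamma> else 0))"
    unfolding nc_Hqt_def lookup_sum lookup_nc_scale lookup_nc_ribbon
    by (rule sum.cong[OF refl]) (simp add: Hqt_coeff compositions_def)
  also have "\<dots> = (if size \<gamma> = ?n then tensor ?n (Hqt_mat ?n) \<alpha> \<gamma> else 0)"
  proof (cases "size \<gamma> = ?n")
    case True
    then show ?thesis
      by (simp add: sum_tensor_mult) (auto simp: tensor_def Hqt_mat_def ribbon_mat_def intro!: prod.cong)
  qed simp
  finally show ?thesis .
qed

lemma nabla_eigenvalue:
  "t ^ n_stat \<alpha> * q ^ n_stat (conjugate \<alpha>) = (\<Prod>i\<in>{1..<size \<alpha>}. eigenfactor (size \<alpha>) i (i \<in> descents \<alpha>))"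
proof -
  have sub: "{1..<size \<alpha>} - descents \<alpha> \<subseteq> {1..<size \<alpha>}" by auto
  show ?thesis
    unfolding n_stat_conjugate n_stat_def[of \<alpha>] power_sum prod_subset_mask[OF descents_subset]
      prod_subset_mask[OF sub] prod.distrib[symmetric]
    by (rule prod.cong[OF refl]) (auto simp: eigenfactor_def)
qed

section \<open>Invertibility of the local matrices\<close>

lemma of_qt_poly_hom:
  "of_qt_poly 0 = 0" "of_qt_poly 1 = 1" "of_qt_poly (P + Q) = of_qt_poly P + of_qt_poly Q"
  "of_qt_poly (P * Q) = of_qt_poly P * of_qt_poly Q" "of_qt_poly (- P) = - of_qt_poly P"
  by (simp_all add: of_qt_poly_def Zero_fract_def One_fract_def)

lemma of_qt_poly_power: "of_qt_poly (P ^ k) = of_qt_poly P ^ k"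
  by (induction k) (simp_all add: of_qt_poly_hom)

text \<open>The difference of the two powers is the determinant of a local matrix. Since
  \<open>t\<close> is the outer polynomial variable, one side has degree \<open>i > 0\<close> and
  the other degree 0.\<close>

lemma t_power_neq_q_power:
  assumes "i > 0"
  shows "t ^ i \<noteq> q ^ j"
proof
  assume "t ^ i = q ^ j"
  then have eq: "[:0, 1:] ^ i = ([:[:0, 1:]:] ^ j :: qt_poly)" (is "?a = ?b")
    unfolding t_def q_def of_qt_poly_power[symmetric] by (simp add: of_qt_poly_def eq_fract)
  have "degree ?a = i" by (simp add: degree_power_eq)
  moreover have "degree ?b = 0" by (simp add: degree_power_eq)
  ultimately show False using eq assms by simp
qed

text \<open>The adjugate of \<open>Hqt_mat\<close> divided by its determinant.\<close>

definition Hqt_inv :: "nat \<Rightarrow> nat \<Rightarrow> bool \<Rightarrow> bool \<Rightarrow> qt_field" where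
  "Hqt_inv n i c a =
    (if c then (if a then 1 - q ^ (n - i) else t ^ i - 1) else (if a then - (q ^ (n - i)) else t ^ i)) /
    (t ^ i - q ^ (n - i))"

lemma Hqt_inv_right:
  assumes "i \<in> {1..<n}"
  shows "Hqt_mat n i a True * Hqt_inv n i True b + Hqt_mat n i a False * Hqt_inv n i False b =
    (if a = b then 1 else 0)"
  using t_power_neq_q_power[of i "n - i"] assms
  by (cases a; cases b) (simp_all add: Hqt_mat_def Hqt_inv_def eigenfactor_def divide_simps, (simp add: algebra_simps)+)

lemma Hqt_inv_left:
  assumes "i \<in> {1..<n}"
  shows "Hqt_inv n i c True * Hqt_mat n i True b + Hqt_inv n i c False * Hqt_mat n i False b =
    (if c = b then 1 else 0)"
  using t_power_neq_q_power[of i "n - i"] assms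
  by (cases c; cases b) (simp_all add: Hqt_mat_def Hqt_inv_def eigenfactor_def divide_simps, (simp add: algebra_simps)+)

interpretation ncsym: vector_space nc_scale
  by (rule vector_space_nc_scale)

interpretation ncsym_pair: vector_space_pair nc_scale nc_scale ..

text \<open>The elements \<open>nc_Hqt \<alpha>\<close> span, which gives uniqueness of
  \<open>nabla\<close>.\<close>

lemma single_eq_sum_nc_Hqt:
  "Poly_Mapping.single \<gamma> 1 =
    (\<Sum>\<alpha>\<in>compositions (size \<gamma>). nc_scale (tensor (size \<gamma>) (Hqt_inv (size \<gamma>)) \<gamma> \<alpha>) (nc_Hqt \<alpha>))"
proof (rule poly_mapping_eqI)
  fix \<delta>
  let ?n = "size \<gamma>"
  have "Poly_Mapping.lookup (\<Sum>\<alpha>\<in>compositions ?n. nc_scale (tensor ?n (Hqt_inv ?n) \<gamma> \<alpha>) (nc_Hqt \<alpha>)) \<delta> =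
      (\<Sum>\<alpha>\<in>compositions ?n. tensor ?n (Hqt_inv ?n) \<gamma> \<alpha> * (if size \<delta> = ?n then tensor ?n (Hqt_mat ?n) \<alpha> \<delta> else 0))"
    unfolding lookup_sum lookup_nc_scale lookup_nc_Hqt
    by (rule sum.cong[OF refl]) (simp add: compositions_def)
  also have "\<dots> = (if \<gamma> = \<delta> then 1 else 0)"
  proof (cases "size \<delta> = ?n")
    case True
    then show ?thesis
      unfolding if_P[OF True] sum_tensor_mult
      by (intro tensor_delta) (auto simp: compositions_def Hqt_inv_left)
  qed auto
  finally show "Poly_Mapping.lookup (Poly_Mapping.single \<gamma> 1) \<delta> =
      Poly_Mapping.lookup (\<Sum>\<alpha>\<in>compositions ?n. nc_scale (tensor ?n (Hqt_inv ?n) \<gamma> \<alpha>) (nc_Hqt \<alpha>)) \<delta>"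
    by (simp add: lookup_single when_def)
qed

section \<open>Existence and uniqueness of nabla\<close>

definition nc_extend :: "(composition \<Rightarrow> ncsym) \<Rightarrow> ncsym \<Rightarrow> ncsym" where
  "nc_extend V F = (\<Sum>\<gamma>\<in>Poly_Mapping.keys F. nc_scale (Poly_Mapping.lookup F \<gamma>) (V \<gamma>))"

lemma nc_extend_superset:
  assumes "finite A" "Poly_Mapping.keys F \<subseteq> A"
  shows "nc_extend V F = (\<Sum>\<gamma>\<in>A. nc_scale (Poly_Mapping.lookup F \<gamma>) (V \<gamma>))"
  unfolding nc_extend_def using assms by (intro sum.mono_neutral_left) (auto simp: in_keys_iff)

lemma linear_nc_extend: "Vector_Spaces.linear nc_scale nc_scale (nc_extend V)"
proof (unfold Vector_Spaces.linear_iff, intro conjI allI vector_space_nc_scale)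
  fix F G :: ncsym
  let ?A = "Poly_Mapping.keys F \<union> Poly_Mapping.keys G"
  have "Poly_Mapping.keys (F + G) \<subseteq> ?A" by (rule Poly_Mapping.keys_add)
  then show "nc_extend V (F + G) = nc_extend V F + nc_extend V G"
    by (simp add: nc_extend_superset[of ?A] lookup_add ncsym.scale_left_distrib sum.distrib)
next
  fix c and F :: ncsym
  have "Poly_Mapping.keys (nc_scale c F) \<subseteq> Poly_Mapping.keys F"
    by (auto simp: in_keys_iff)
  then show "nc_extend V (nc_scale c F) = nc_scale c (nc_extend V F)"
    by (simp add: nc_extend_superset[of "Poly_Mapping.keys F"] ncsym.scale_sum_right)
qed

text \<open>Nothing can be said about the definite description \<open>nabla\<close> before this. The
  eigenvector equations of the constructed map use \<open>Hqt_inv_right\<close>, while uniqueness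
  uses the spanning property, hence \<open>Hqt_inv_left\<close>.\<close>

lemma nabla_ex1:
  "\<exists>!F. Vector_Spaces.linear nc_scale nc_scale F \<and>
     (\<forall>\<alpha>. F (nc_Hqt \<alpha>) = nc_scale (t ^ n_stat \<alpha> * q ^ n_stat (conjugate \<alpha>)) (nc_Hqt \<alpha>))"
proof -
  define ev where "ev \<alpha> = t ^ n_stat \<alpha> * q ^ n_stat (conjugate \<alpha>)" for \<alpha>
  \<comment> \<open>The forced image of a basis monomial: its expansion in the
    \<open>nc_Hqt \<beta>\<close> with every term scaled by the eigenvalue.\<close>
  define V where "V \<gamma> = (\<Sum>\<beta>\<in>compositions (size \<gamma>).
      nc_scale (tensor (size \<gamma>) (Hqt_inv (size \<gamma>)) \<gamma> \<beta> * ev \<beta>) (nc_Hqt \<beta>))" for \<gamma>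
  have "nc_extend V (nc_Hqt \<alpha>) = nc_scale (ev \<alpha>) (nc_Hqt \<alpha>)" for \<alpha>
  proof -
    let ?n = "size \<alpha>"
    let ?C = "compositions ?n"
    have keys: "Poly_Mapping.keys (nc_Hqt \<alpha>) \<subseteq> ?C"
      by (auto simp: in_keys_iff lookup_nc_Hqt compositions_def split: if_splits)
    have "nc_extend V (nc_Hqt \<alpha>) = (\<Sum>\<gamma>\<in>?C. nc_scale (tensor ?n (Hqt_mat ?n) \<alpha> \<gamma>) (V \<gamma>))"
      unfolding nc_extend_superset[OF finite_compositions keys]
      by (rule sum.cong[OF refl]) (simp add: lookup_nc_Hqt compositions_def)
    also have "\<dots> = (\<Sum>\<gamma>\<in>?C. \<Sum>\<beta>\<in>?C. nc_scale
        (tensor ?n (Hqt_mat ?n) \<alpha> \<gamma> * tensor ?n (Hqt_inv ?n) \<gamma> \<beta> * ev \<beta>) (nc_Hqt \<beta>))"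
      by (rule sum.cong[OF refl]) (simp add: V_def ncsym.scale_sum_right compositions_def mult.assoc)
    also have "\<dots> = (\<Sum>\<beta>\<in>?C. nc_scale
        ((\<Sum>\<gamma>\<in>?C. tensor ?n (Hqt_mat ?n) \<alpha> \<gamma> * tensor ?n (Hqt_inv ?n) \<gamma> \<beta>) * ev \<beta>) (nc_Hqt \<beta>))"
      by (subst sum.swap) (simp add: ncsym.scale_sum_left sum_distrib_right)
    also have "\<dots> = (\<Sum>\<beta>\<in>?C. if \<beta> = \<alpha> then nc_scale (ev \<alpha>) (nc_Hqt \<alpha>) else 0)"
    proof (rule sum.cong[OF refl])
      fix \<beta> assume "\<beta> \<in> ?C"
      then have "(\<Sum>\<gamma>\<in>?C. tensor ?n (Hqt_mat ?n) \<alpha> \<gamma> * tensor ?n (Hqt_inv ?n) \<gamma> \<beta>) = (if \<alpha> = \<beta> then 1 else 0)"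
        unfolding sum_tensor_mult by (intro tensor_delta) (auto simp: compositions_def Hqt_inv_right)
      then show "nc_scale ((\<Sum>\<gamma>\<in>?C. tensor ?n (Hqt_mat ?n) \<alpha> \<gamma> * tensor ?n (Hqt_inv ?n) \<gamma> \<beta>) * ev \<beta>) (nc_Hqt \<beta>) =
        (if \<beta> = \<alpha> then nc_scale (ev \<alpha>) (nc_Hqt \<alpha>) else 0)" by simp
    qed
    also have "\<dots> = nc_scale (ev \<alpha>) (nc_Hqt \<alpha>)"
      using finite_compositions[of ?n] by (simp add: sum.delta compositions_def)
    finally show ?thesis .
  qed
  moreover have "F = G" if F: "Vector_Spaces.linear nc_scale nc_scale F" and G: "Vector_Spaces.linear nc_scale nc_scale G"
    and eq: "\<And>\<alpha>. F (nc_Hqt \<alpha>) = G (nc_Hqt \<alpha>)" for F G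
  proof
    fix x
    show "F x = G x"
    proof (induction x rule: ncsym_induct)
      case (single \<alpha> c)
      have "Poly_Mapping.single \<alpha> c = nc_scale c (Poly_Mapping.single \<alpha> 1)"
        by (intro poly_mapping_eqI) (simp add: lookup_single when_def)
      moreover have "F (Poly_Mapping.single \<alpha> 1) = G (Poly_Mapping.single \<alpha> 1)"
        unfolding single_eq_sum_nc_Hqt ncsym_pair.linear_sum[OF F] ncsym_pair.linear_sum[OF G]
          ncsym_pair.linear_scale[OF F] ncsym_pair.linear_scale[OF G] eq ..
      ultimately show ?case
        by (simp add: ncsym_pair.linear_scale[OF F] ncsym_pair.linear_scale[OF G])
    next
      case (add x y)
      then show ?case by (simp add: ncsym_pair.linear_add[OF F] ncsym_pair.linear_add[OF G])
    qed
  qed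
  ultimately show ?thesis
    using linear_nc_extend[of V] unfolding ev_def by (intro ex1I[of _ "nc_extend V"]) auto
qed

lemma linear_nabla: "Vector_Spaces.linear nc_scale nc_scale nabla"
  and nabla_nc_Hqt: "nabla (nc_Hqt \<alpha>) = nc_scale (t ^ n_stat \<alpha> * q ^ n_stat (conjugate \<alpha>)) (nc_Hqt \<alpha>)"
  using theI'[OF nabla_ex1] unfolding nabla_def by blast+

section \<open>The image of e_n under nabla\<close>

lemma nc_e_eq_sum_nc_Hqt:
  assumes "n \<ge> 1"
  shows "nc_e n = (\<Sum>\<alpha>\<in>compositions n.
    nc_scale (\<Prod>i\<in>{1..<n}. (if i \<in> descents \<alpha> then 1 else - 1) / (t ^ i - q ^ (n - i))) (nc_Hqt \<alpha>))"
proof (rule poly_mapping_eqI)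
  fix \<gamma>
  \<comment> \<open>A row vector disguised as a matrix: \<open>?x\<close> ignores \<open>a\<close>,
    so \<open>\<gamma>\<close> as first index of \<open>tensor\<close> is a dummy that makes
    \<open>sum_tensor_mult\<close> applicable.\<close>
  let ?x = "\<lambda>i a b. (if b then 1 else - 1) / (t ^ i - q ^ (n - i))"
  have "Poly_Mapping.lookup (nc_e n) \<gamma> = (\<Sum>\<alpha>\<in>compositions n. if \<alpha> = \<gamma> then (- 1) ^ (n - len \<gamma>) else 0)"
    by (auto simp: nc_e_def lookup_sum nc_h_comp_eq_single lookup_single when_def intro!: sum.cong)
  also have "\<dots> = (if size \<gamma> = n then (- 1) ^ (n - len \<gamma>) else 0)"
    using finite_compositions[of n] by (simp add: sum.delta compositions_def)
  also have "\<dots> = (if size \<gamma> = n then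
      tensor n (\<lambda>i a c. ?x i a True * Hqt_mat n i True c + ?x i a False * Hqt_mat n i False c) \<gamma> \<gamma> else 0)"
  proof (cases "size \<gamma> = n")
    case True
    have sub: "descents \<gamma> \<subseteq> {1..<n}" using descents_subset[of \<gamma>] True by simp
    \<comment> \<open>Of the \<open>n - 1\<close> positions, \<open>len \<gamma> - 1\<close> are
      descents, so the sign of e_n counts the non-descents.\<close>
    have "n - len \<gamma> = card ({1..<n} - descents \<gamma>)"
      using assms True by (subst card_Diff_subset[OF finite_descents sub]) (simp add: len_eq)
    then have "(- 1) ^ (n - len \<gamma>) = (\<Prod>i\<in>{1..<n} - descents \<gamma>. - 1 :: qt_field)" by simp
    also have "\<dots> = (\<Prod>i\<in>{1..<n}. if i \<in> {1..<n} - descents \<gamma> then - 1 else 1)"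
      by (rule prod_subset_mask) auto
    also have "\<dots> = tensor n (\<lambda>i a c. ?x i a True * Hqt_mat n i True c + ?x i a False * Hqt_mat n i False c) \<gamma> \<gamma>"
      unfolding tensor_def
    proof (rule prod.cong[OF refl])
      fix i assume i: "i \<in> {1..<n}"
      then have "t ^ i - q ^ (n - i) \<noteq> 0" using t_power_neq_q_power[of i "n - i"] by simp
      with i show "(if i \<in> {1..<n} - descents \<gamma> then - 1 else 1) =
          ?x i (i \<in> descents \<gamma>) True * Hqt_mat n i True (i \<in> descents \<gamma>) +
          ?x i (i \<in> descents \<gamma>) False * Hqt_mat n i False (i \<in> descents \<gamma>)"
        by (simp add: Hqt_mat_def eigenfactor_def divide_simps)
    qed
    finally show ?thesis using True by simp
  qed simp
  also have "\<dots> = (\<Sum>\<alpha>\<in>compositions n. tensor n ?x \<gamma> \<alpha> * (if size \<gamma> = n then tensor n (Hqt_mat n) \<alpha> \<gamma> else 0))"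
    by (simp add: sum_tensor_mult)
  also have "\<dots> = Poly_Mapping.lookup (\<Sum>\<alpha>\<in>compositions n. nc_scale (tensor n ?x \<gamma> \<alpha>) (nc_Hqt \<alpha>)) \<gamma>"
    unfolding lookup_sum lookup_nc_scale lookup_nc_Hqt
    by (rule sum.cong[OF refl]) (simp add: compositions_def)
  finally show "Poly_Mapping.lookup (nc_e n) \<gamma> = Poly_Mapping.lookup (\<Sum>\<alpha>\<in>compositions n.
    nc_scale (\<Prod>i\<in>{1..<n}. (if i \<in> descents \<alpha> then 1 else - 1) / (t ^ i - q ^ (n - i))) (nc_Hqt \<alpha>)) \<gamma>"
    by (simp add: tensor_def)
qed

lemma lookup_nabla_nc_e:
  assumes "n \<ge> 1"
  shows "Poly_Mapping.lookup (nabla (nc_e n)) \<gamma> = (if size \<gamma> = n then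
    \<Prod>i\<in>{1..<n}. if i \<in> descents \<gamma> then t ^ i + q ^ (n - i) else 1 - (t ^ i + q ^ (n - i)) else 0)"
proof -
  let ?x = "\<lambda>i a b. (if b then 1 else - 1) / (t ^ i - q ^ (n - i)) * eigenfactor n i b"
  have "nabla (nc_e n) = (\<Sum>\<alpha>\<in>compositions n. nc_scale (tensor n ?x \<gamma> \<alpha>) (nc_Hqt \<alpha>))"
    unfolding nc_e_eq_sum_nc_Hqt[OF assms] ncsym_pair.linear_sum[OF linear_nabla]
      ncsym_pair.linear_scale[OF linear_nabla] nabla_nc_Hqt
  proof (rule sum.cong[OF refl])
    fix \<alpha> assume "\<alpha> \<in> compositions n"
    then have sz: "size \<alpha> = n" by (simp add: compositions_def)
    show "nc_scale (\<Prod>i\<in>{1..<n}. (if i \<in> descents \<alpha> then 1 else - 1) / (t ^ i - q ^ (n - i)))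
        (nc_scale (t ^ n_stat \<alpha> * q ^ n_stat (conjugate \<alpha>)) (nc_Hqt \<alpha>)) =
      nc_scale (tensor n ?x \<gamma> \<alpha>) (nc_Hqt \<alpha>)"
      by (simp only: ncsym.scale_scale tensor_def prod.distrib nabla_eigenvalue sz)
  qed
  then have "Poly_Mapping.lookup (nabla (nc_e n)) \<gamma> =
      (\<Sum>\<alpha>\<in>compositions n. tensor n ?x \<gamma> \<alpha> * (if size \<gamma> = n then tensor n (Hqt_mat n) \<alpha> \<gamma> else 0))"
    unfolding lookup_sum lookup_nc_scale lookup_nc_Hqt
    by (auto simp: lookup_sum lookup_nc_Hqt compositions_def intro!: sum.cong)
  also have "\<dots> = (if size \<gamma> = n then
      tensor n (\<lambda>i a c. ?x i a True * Hqt_mat n i True c + ?x i a False * Hqt_mat n i False c) \<gamma> \<gamma> else 0)"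
    by (simp add: sum_tensor_mult)
  also have "tensor n (\<lambda>i a c. ?x i a True * Hqt_mat n i True c + ?x i a False * Hqt_mat n i False c) \<gamma> \<gamma> =
      (\<Prod>i\<in>{1..<n}. if i \<in> descents \<gamma> then t ^ i + q ^ (n - i) else 1 - (t ^ i + q ^ (n - i)))"
    unfolding tensor_def
  proof (rule prod.cong[OF refl])
    fix i assume i: "i \<in> {1..<n}"
    then have "t ^ i - q ^ (n - i) \<noteq> 0" using t_power_neq_q_power[of i "n - i"] by simp
    then show "?x i (i \<in> descents \<gamma>) True * Hqt_mat n i True (i \<in> descents \<gamma>) +
        ?x i (i \<in> descents \<gamma>) False * Hqt_mat n i False (i \<in> descents \<gamma>) =
        (if i \<in> descents \<gamma> then t ^ i + q ^ (n - i) else 1 - (t ^ i + q ^ (n - i)))"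
      by (simp add: Hqt_mat_def eigenfactor_def divide_simps) (simp add: algebra_simps)
  qed
  finally show ?thesis .
qed

lemma chi_nabla_nc_e:
  assumes "n \<ge> 1"
  shows "chi (nabla (nc_e n)) = (\<Sum>\<gamma>\<in>compositions n.
    pscale (\<Prod>i\<in>{1..<n}. if i \<in> descents \<gamma> then t ^ i + q ^ (n - i) else 1 - (t ^ i + q ^ (n - i)))
      (prod_list (map sym_h (parts \<gamma>))))"
proof -
  have keys: "Poly_Mapping.keys (nabla (nc_e n)) \<subseteq> compositions n"
    by (auto simp: in_keys_iff lookup_nabla_nc_e[OF assms] compositions_def split: if_splits)
  show ?thesis
    unfolding chi_superset[OF finite_compositions keys]
    by (intro sum.cong refl) (simp add: lookup_nabla_nc_e[OF assms] compositions_def)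
qed

section \<open>Counting preferential arrangements\<close>

text \<open>An arbitrary domain lets the recursion remove a fibre without relabelling.\<close>

definition surjections :: "'a set \<Rightarrow> nat \<Rightarrow> ('a \<Rightarrow> nat) set" where
  "surjections A k = {f \<in> A \<rightarrow>\<^sub>E {1..k}. f ` A = {1..k}}"

lemma finite_surjections: "finite A \<Longrightarrow> finite (surjections A k)"
  unfolding surjections_def by (rule finite_subset[of _ "A \<rightarrow>\<^sub>E {1..k}"]) (auto intro: finite_PiE)

text \<open>\<open>B\<close> is the fibre over the largest value, nonempty by surjectivity; the rest
  of the map is a surjection onto the smaller values.\<close>

lemma card_surjections_Suc:
  assumes "finite A"
  shows "card (surjections A (Suc k)) = (\<Sum>B\<in>Pow A - {{}}. card (surjections (A - B) k))"
proof -
  define S where "S B = {f \<in> surjections A (Suc k). {x \<in> A. f x = Suc k} = B}" for B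
  have "surjections A (Suc k) = (\<Union>B\<in>Pow A - {{}}. S B)"
  proof (intro equalityI subsetI)
    fix f assume f: "f \<in> surjections A (Suc k)"
    then have "Suc k \<in> f ` A" by (simp add: surjections_def)
    then have "{x \<in> A. f x = Suc k} \<in> Pow A - {{}}" by auto
    with f show "f \<in> (\<Union>B\<in>Pow A - {{}}. S B)" by (auto simp: S_def)
  qed (auto simp: S_def)
  also have "card \<dots> = (\<Sum>B\<in>Pow A - {{}}. card (S B))"
    using assms finite_surjections[OF assms] by (intro card_UN_disjoint) (auto simp: S_def)
  also have "\<dots> = (\<Sum>B\<in>Pow A - {{}}. card (surjections (A - B) k))"
  proof (rule sum.cong[OF refl])
    fix B assume "B \<in> Pow A - {{}}"
    then have B: "B \<subseteq> A" "B \<noteq> {}" by auto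
    define E where "E g = (\<lambda>x\<in>A. if x \<in> B then Suc k else g x)" for g :: "'a \<Rightarrow> nat"
    have "bij_betw (\<lambda>f. restrict f (A - B)) (S B) (surjections (A - B) k)"
    proof (rule bij_betw_byWitness[where f' = E])
      show "\<forall>f\<in>S B. E (restrict f (A - B)) = f"
      proof
        fix f assume "f \<in> S B"
        then have "f \<in> extensional A" "{x \<in> A. f x = Suc k} = B"
          by (auto simp: S_def surjections_def PiE_def)
        then show "E (restrict f (A - B)) = f"
          by (intro extensionalityI[of _ A]) (auto simp: E_def)
      qed
      show "\<forall>g\<in>surjections (A - B) k. restrict (E g) (A - B) = g"
        by (intro ballI extensionalityI[of _ "A - B"]) (auto simp: E_def surjections_def PiE_def)
      show "(\<lambda>f. restrict f (A - B)) ` S B \<subseteq> surjections (A - B) k"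
      proof (rule image_subsetI)
        fix f assume f: "f \<in> S B"
        then have fB: "{x \<in> A. f x = Suc k} = B" and fA: "f ` A = {1..Suc k}"
          by (auto simp: S_def surjections_def)
        have "f ` (A - B) = f ` A - {Suc k}" unfolding fB[symmetric] by auto
        also have "\<dots> = {1..k}" unfolding fA by auto
        finally have "restrict f (A - B) ` (A - B) = {1..k}" by simp
        then show "restrict f (A - B) \<in> surjections (A - B) k"
          unfolding surjections_def by auto
      qed
      show "E ` surjections (A - B) k \<subseteq> S B"
      proof (rule image_subsetI)
        fix g assume g: "g \<in> surjections (A - B) k"
        have "E g ` A = E g ` B \<union> E g ` (A - B)" using B by auto
        also have "E g ` (A - B) = g ` (A - B)" by (auto simp: E_def)
        also have "\<dots> = {1..k}" using g by (simp add: surjections_def)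
        also have "E g ` B = {Suc k}" using B by (auto simp: E_def image_def subset_iff)
        finally have im: "E g ` A = {1..Suc k}" by auto
        moreover have "E g \<in> extensional A" by (simp add: E_def)
        ultimately have "E g \<in> surjections A (Suc k)"
          unfolding surjections_def by (auto simp: PiE_def)
        moreover have "g x \<le> k" if "x \<in> A - B" for x
          using g that by (auto simp: surjections_def)
        then have "{x \<in> A. E g x = Suc k} = B" using B by (force simp: E_def)
        ultimately show "E g \<in> S B" by (simp add: S_def)
      qed
    qed
    then show "card (S B) = card (surjections (A - B) k)" by (rule bij_betw_same_card)
  qed
  finally show ?thesis .
qed

text \<open>These are the numbers k! S(n, k) with Stirling numbers of the second kind;
  \<open>j\<close> is the size of the fibre over the largest value.\<close>

fun surj_count :: "nat \<Rightarrow> nat \<Rightarrow> nat" where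
  "surj_count n 0 = (if n = 0 then 1 else 0)"
| "surj_count n (Suc k) = (\<Sum>j = 1..n. (n choose j) * surj_count (n - j) k)"

lemma sum_nonempty_subsets_by_card:
  assumes "finite A"
  shows "(\<Sum>B\<in>Pow A - {{}}. g (card B)) = (\<Sum>j = 1..card A. (card A choose j) * g j :: nat)"
proof -
  have "card ` (Pow A - {{}}) \<subseteq> {1..card A}"
  proof (rule image_subsetI)
    fix B assume "B \<in> Pow A - {{}}"
    then have "B \<subseteq> A" "B \<noteq> {}" by auto
    moreover have "finite B" using \<open>B \<subseteq> A\<close> assms by (rule finite_subset)
    ultimately show "card B \<in> {1..card A}"
      using assms by (simp add: card_mono Suc_le_eq card_gt_0_iff)
  qed
  then have "(\<Sum>B\<in>Pow A - {{}}. g (card B)) =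
      (\<Sum>j = 1..card A. \<Sum>B | B \<in> Pow A - {{}} \<and> card B = j. g (card B))"
    using assms by (intro sum.group[symmetric]) auto
  also have "\<dots> = (\<Sum>j = 1..card A. \<Sum>B | B \<subseteq> A \<and> card B = j. g j)"
    by (intro sum.cong) auto
  also have "\<dots> = (\<Sum>j = 1..card A. (card A choose j) * g j)"
    using n_subsets[OF assms] by simp
  finally show ?thesis .
qed

lemma card_surjections: "finite A \<Longrightarrow> card (surjections A k) = surj_count (card A) k"
proof (induction k arbitrary: A)
  case 0
  have "surjections A 0 = (if A = {} then {\<lambda>_. undefined} else {})"
    by (auto simp: surjections_def)
  with 0 show ?case by simp
next
  case (Suc k)
  have "card (surjections A (Suc k)) = (\<Sum>B\<in>Pow A - {{}}. surj_count (card A - card B) k)"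
    unfolding card_surjections_Suc[OF Suc.prems]
    using Suc by (intro sum.cong) (auto simp: card_Diff_subset finite_subset)
  also have "\<dots> = (\<Sum>j = 1..card A. (card A choose j) * surj_count (card A - j) k)"
    by (rule sum_nonempty_subsets_by_card[OF Suc.prems])
  finally show ?case by simp
qed

lemma surj_count_eq_0: "n < k \<Longrightarrow> surj_count n k = 0"
  by (induction n k rule: surj_count.induct) auto

text \<open>The term for \<open>k = 0\<close> is 0 when \<open>n \<ge> 1\<close> and supplies the
  value 1 at \<open>n = 0\<close>, with which the recursion has to start.\<close>

definition preferential_arrangements :: "nat \<Rightarrow> nat" where
  "preferential_arrangements n = (\<Sum>k\<le>n. surj_count n k)"

lemma preferential_arrangements_rec:
  assumes "n \<ge> 1"
  shows "preferential_arrangements n = (\<Sum>j = 1..n. (n choose j) * preferential_arrangements (n - j))"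
proof -
  obtain m where n: "n = Suc m" using assms by (cases n) auto
  have "preferential_arrangements n = (\<Sum>k\<le>m. surj_count n (Suc k))"
    unfolding preferential_arrangements_def n sum.atMost_Suc_shift by simp
  also have "\<dots> = (\<Sum>j = 1..n. (n choose j) * (\<Sum>k\<le>m. surj_count (n - j) k))"
    by (simp add: sum_distrib_left sum.swap[of _ "{..m}"])
  also have "\<dots> = (\<Sum>j = 1..n. (n choose j) * preferential_arrangements (n - j))"
  proof (intro sum.cong refl arg_cong2[where f = "(*)"])
    fix j assume j: "j \<in> {1..n}"
    \<comment> \<open>As \<open>n - j \<le> m\<close>, the surplus terms ask for more values than
      arguments and vanish.\<close>
    show "(\<Sum>k\<le>m. surj_count (n - j) k) = preferential_arrangements (n - j)"
      unfolding preferential_arrangements_def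
      using j n by (intro sum.mono_neutral_right) (auto intro!: surj_count_eq_0)
  qed
  finally show ?thesis .
qed

text \<open>Binomial convolution is multiplication of exponential generating functions. Both
  sequences to be compared fit, with \<open>c j = 1\<close> for the arrangements and
  \<open>c j = - 2 * (- 1) ^ j\<close> for the signed sums.\<close>

lemma egf_binomial_rec:
  fixes a c :: "nat \<Rightarrow> 'a :: field_char_0"
  assumes "a 0 = 1" "\<And>n. n \<ge> 1 \<Longrightarrow> a n = (\<Sum>j = 1..n. of_nat (n choose j) * c j * a (n - j))"
  shows "Abs_fps (\<lambda>n. a n / fact n) =
    1 + Abs_fps (\<lambda>n. if n = 0 then 0 else c n / fact n) * Abs_fps (\<lambda>n. a n / fact n)" (is "?A = 1 + ?C * ?A")
proof (rule fps_ext)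
  fix n
  show "fps_nth ?A n = fps_nth (1 + ?C * ?A) n"
  proof (cases "n = 0")
    case False
    have "fps_nth (?C * ?A) n = (\<Sum>j = 0..n. (if j = 0 then 0 else c j / fact j) * (a (n - j) / fact (n - j)))"
      by (simp add: fps_mult_nth)
    also have "\<dots> = (\<Sum>j = 1..n. c j / fact j * (a (n - j) / fact (n - j)))"
      by (intro sum.mono_neutral_cong_right) auto
    also have "\<dots> = (\<Sum>j = 1..n. of_nat (n choose j) * c j * a (n - j)) / fact n"
      unfolding sum_divide_distrib
      by (intro sum.cong refl) (simp add: binomial_fact field_simps)
    also have "\<dots> = a n / fact n" using assms(2)[of n] False by simp
    finally show ?thesis using False by simp
  qed (simp add: assms(1))
qed

section \<open>Signed sums of multinomial coefficients over compositions\<close>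

lemma sum_compositions_rec:
  fixes P :: "nat list \<Rightarrow> 'b :: comm_monoid_add"
  assumes "n \<ge> 1"
  shows "(\<Sum>\<gamma>\<in>compositions n. P (parts \<gamma>)) =
    (\<Sum>j = 1..n. \<Sum>\<gamma>\<in>compositions (n - j). P (j # parts \<gamma>))"
proof -
  have parts_cons: "parts (Abs_composition (j # parts \<gamma>)) = j # parts \<gamma>" if "j \<ge> 1" for j \<gamma>
    using that zero_notin_parts[of \<gamma>] by (simp add: Abs_composition_inverse)
  have tl: "parts (Abs_composition (tl (parts \<gamma>))) = tl (parts \<gamma>)" for \<gamma>
    using zero_notin_parts[of \<gamma>] by (cases "parts \<gamma>") (simp_all add: Abs_composition_inverse)
  have ne: "parts \<gamma> \<noteq> []" "hd (parts \<gamma>) \<ge> 1" "size \<gamma> = hd (parts \<gamma>) + sum_list (tl (parts \<gamma>))"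
    if "\<gamma> \<in> compositions n" for \<gamma>
    using that assms zero_notin_parts[of \<gamma>]
    by (cases "parts \<gamma>"; auto simp: compositions_def size_composition_def)+
  have "(\<Sum>j = 1..n. \<Sum>\<gamma>\<in>compositions (n - j). P (j # parts \<gamma>)) =
      (\<Sum>(j, \<gamma>)\<in>(SIGMA j:{1..n}. compositions (n - j)). P (j # parts \<gamma>))"
    by (rule sum.Sigma) (auto simp: finite_compositions)
  also have "\<dots> = (\<Sum>\<gamma>\<in>compositions n. P (parts \<gamma>))"
  proof (rule sum.reindex_bij_witness[of _
        "\<lambda>\<gamma>. (hd (parts \<gamma>), Abs_composition (tl (parts \<gamma>)))" "\<lambda>(j, \<gamma>). Abs_composition (j # parts \<gamma>)"], goal_cases)
    case (1 a)
    then show ?case by (auto simp: parts_cons parts_inverse)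
  next
    case (2 a)
    then show ?case by (auto simp: parts_cons compositions_def size_composition_def)
  next
    case (3 \<gamma>)
    then show ?case using ne[of \<gamma>] by (simp add: tl parts_inverse)
  next
    case (4 \<gamma>)
    then show ?case using ne[of \<gamma>] by (auto simp: tl compositions_def size_composition_def)
  next
    case (5 a)
    then show ?case by (auto simp: parts_cons)
  qed
  finally show ?thesis ..
qed

text \<open>At q = t = 1 a descent has factor 2 and a non-descent -1. A part \<open>x\<close> covers
  \<open>x - 1\<close> non-descents, hence 2 (-1)^(x-1); one factor 2 is in excess, because there is
  one more part than descents.\<close>

definition signed_weight :: "nat list \<Rightarrow> rat" where
  "signed_weight xs = (\<Prod>x\<leftarrow>xs. - 2 * (- 1) ^ x)"

definition signed_sum :: "nat \<Rightarrow> rat" where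
  "signed_sum n = (\<Sum>\<gamma>\<in>compositions n. signed_weight (parts \<gamma>) * of_nat (multinom (parts \<gamma>)))"

lemma compositions_0: "compositions 0 = {0}"
proof -
  have "\<gamma> = 0" if "size \<gamma> = 0" for \<gamma> :: composition
  proof -
    have "parts \<gamma> = []"
      using that zero_notin_parts[of \<gamma>] by (cases "parts \<gamma>") (auto simp: size_composition_def)
    then show ?thesis by (simp add: zero_composition.rep_eq flip: parts_inject)
  qed
  then show ?thesis by (auto simp: compositions_def size_composition_def zero_composition.rep_eq)
qed

lemma signed_sum_rec:
  assumes "n \<ge> 1"
  shows "signed_sum n = (\<Sum>j = 1..n. of_nat (n choose j) * (- 2 * (- 1) ^ j) * signed_sum (n - j))"
proof -
  have "signed_weight (j # parts \<gamma>) * of_nat (multinom (j # parts \<gamma>)) =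
      of_nat (n choose j) * (- 2 * (- 1) ^ j) * (signed_weight (parts \<gamma>) * of_nat (multinom (parts \<gamma>)))"
    if "j \<in> {1..n}" "\<gamma> \<in> compositions (n - j)" for j \<gamma>
    using that by (simp add: signed_weight_def compositions_def size_composition_def)
  then show ?thesis
    unfolding signed_sum_def sum_distrib_left
      sum_compositions_rec[OF assms, of "\<lambda>xs. signed_weight xs * of_nat (multinom xs)"]
    by (intro sum.cong refl)
qed

text \<open>The exponential generating functions of the two sequences are \<open>F = 1 / (2 - e\<^sup>x)\<close> and
  \<open>G = 1 / (2 e\<^sup>-\<^sup>x - 1)\<close>, and \<open>G = 2 F - 1\<close>.\<close>

lemma signed_sum_eq:
  assumes "n \<ge> 1"
  shows "signed_sum n = 2 * of_nat (preferential_arrangements n)"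
proof -
  let ?F = "Abs_fps (\<lambda>n. of_nat (preferential_arrangements n) / fact n) :: rat fps"
  let ?G = "Abs_fps (\<lambda>n. signed_sum n / fact n)"
  let ?E = "fps_exp (1 :: rat)" and ?E' = "fps_exp (- 1 :: rat)"
  have "?F = 1 + Abs_fps (\<lambda>n. if n = 0 then 0 else 1 / fact n) * ?F"
  proof (rule egf_binomial_rec)
    show "of_nat (preferential_arrangements 0) = (1 :: rat)" by (simp add: preferential_arrangements_def)
  qed (subst preferential_arrangements_rec; simp)
  also have "Abs_fps (\<lambda>n. if n = 0 then 0 else 1 / fact n) = ?E - 1"
    by (rule fps_ext) simp
  finally have F: "?F = 1 + (?E - 1) * ?F" .
  have "?G = 1 + Abs_fps (\<lambda>n. if n = 0 then 0 else - 2 * (- 1) ^ n / fact n) * ?G"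
  proof (rule egf_binomial_rec)
    show "signed_sum 0 = 1"
      by (simp add: signed_sum_def compositions_0 zero_composition.rep_eq signed_weight_def)
  qed (rule signed_sum_rec)
  also have "Abs_fps (\<lambda>n. if n = 0 then 0 else - 2 * (- 1) ^ n / fact n) = 2 - 2 * ?E'"
    by (rule fps_ext) (simp add: fps_numeral_nth numeral_fps_const)
  finally have G: "?G = 1 + (2 - 2 * ?E') * ?G" .
  have EE: "?E' * ?E = 1" using fps_exp_add_mult[of "- 1" "1 :: rat"] by simp
  have "(2 - ?E) * ?F = 1" using F by (simp add: algebra_simps)
  \<comment> \<open>Here (2 - e^x) (2F - 1) = 2 - (2 - e^x) = e^x; multiplying by e^(-x) exhibits 2F
    - 1 as the inverse of 2 e^(-x) - 1.\<close>
  then have "?E' * ((2 - ?E) * (2 * ?F - 1)) = ?E' * (2 - (2 - ?E))"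
    by (simp add: algebra_simps)
  then have inv: "(2 * ?E' - 1) * (2 * ?F - 1) = 1"
    using EE by (simp add: algebra_simps)
  have G': "?G * (2 * ?E' - 1) = 1" using G by (simp add: algebra_simps)
  have "?G = ?G * ((2 * ?E' - 1) * (2 * ?F - 1))"
    by (simp only: inv mult_1_right)
  also have "\<dots> = 2 * ?F - 1"
    by (simp only: mult.assoc[symmetric] G' mult_1_left)
  finally have "fps_nth ?G n = fps_nth (2 * ?F - 1) n" by simp
  \<comment> \<open>The summand -1 affects only the constant coefficient, and
    \<open>n \<ge> 1\<close>.\<close>
  also have "\<dots> = 2 * (of_nat (preferential_arrangements n) / fact n)"
    using assms by (simp add: numeral_fps_const)
  finally show ?thesis by simp
qed

section \<open>Compositions into ones, and evaluation at q = t = 1\<close>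

lemma parts_le_1_iff:
  assumes "size \<gamma> = n"
  shows "(\<forall>k\<in>set (parts \<gamma>). k \<le> 1) \<longleftrightarrow> descents \<gamma> = {1..<n}"
proof -
  \<comment> \<open>Positive parts make the sum at least the length, with equality only for ones;
    this turns the condition into a count of descents.\<close>
  have "(\<forall>k\<in>set xs. k \<le> 1) \<longleftrightarrow> length xs = sum_list xs" if "0 \<notin> set xs" for xs :: "nat list"
  proof -
    have "length xs \<le> sum_list xs" if "0 \<notin> set xs" for xs :: "nat list"
      using that by (induction xs) auto
    with that show ?thesis
      by (induction xs) (auto simp: Suc_le_eq, fastforce+)
  qed
  from this[OF zero_notin_parts] have "(\<forall>k\<in>set (parts \<gamma>). k \<le> 1) \<longleftrightarrow> len \<gamma> = n"
    using assms by (simp add: len_def size_composition_def)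
  also have "\<dots> \<longleftrightarrow> card (descents \<gamma>) = card {1..<n}"
    using descents_subset[of \<gamma>] assms by (auto simp: len_eq)
  also have "\<dots> \<longleftrightarrow> descents \<gamma> = {1..<n}"
    using descents_subset[of \<gamma>] assms card_subset_eq[of "{1..<n}" "descents \<gamma>"] by fastforce
  finally show ?thesis .
qed

text \<open>Rational values are needed because the factors 1 - W_i take the value -1, although the
  final value is a natural number.\<close>

definition qt_value :: "qt_field \<Rightarrow> rat \<Rightarrow> bool" where
  "qt_value x r \<longleftrightarrow> (\<exists>P. x = of_qt_poly P \<and> eval_qt P 1 1 = r)"

lemma qt_value_intros:
  "qt_value 0 0" "qt_value 1 1" "qt_value t 1" "qt_value q 1"
  "qt_value x r \<Longrightarrow> qt_value y s \<Longrightarrow> qt_value (x + y) (r + s)"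
  "qt_value x r \<Longrightarrow> qt_value y s \<Longrightarrow> qt_value (x * y) (r * s)"
  "qt_value x r \<Longrightarrow> qt_value (- x) (- r)"
proof -
  have "0 = of_qt_poly 0 \<and> eval_qt 0 1 1 = 0" "1 = of_qt_poly 1 \<and> eval_qt 1 1 1 = 1"
    "t = of_qt_poly [:0, 1:] \<and> eval_qt [:0, 1:] 1 1 = 1"
    "q = of_qt_poly [:[:0, 1:]:] \<and> eval_qt [:[:0, 1:]:] 1 1 = 1"
    by (simp_all add: of_qt_poly_hom t_def q_def eval_qt_def)
  then show "qt_value 0 0" "qt_value 1 1" "qt_value t 1" "qt_value q 1"
    unfolding qt_value_def by blast+
next
  assume "qt_value x r" "qt_value y s"
  then obtain P R where "x = of_qt_poly P" "eval_qt P 1 1 = r" "y = of_qt_poly R" "eval_qt R 1 1 = s"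
    by (auto simp: qt_value_def)
  then have "x + y = of_qt_poly (P + R) \<and> eval_qt (P + R) 1 1 = r + s"
    "x * y = of_qt_poly (P * R) \<and> eval_qt (P * R) 1 1 = r * s"
    by (simp_all add: of_qt_poly_hom eval_qt_def)
  then show "qt_value (x + y) (r + s)" "qt_value (x * y) (r * s)"
    unfolding qt_value_def by blast+
next
  assume "qt_value x r"
  then obtain P where "x = of_qt_poly P" "eval_qt P 1 1 = r"
    by (auto simp: qt_value_def)
  then show "qt_value (- x) (- r)"
    unfolding qt_value_def by (intro exI[of _ "- P"]) (simp add: of_qt_poly_hom eval_qt_def)
qed

lemma qt_value_diff: "qt_value x r \<Longrightarrow> qt_value y s \<Longrightarrow> qt_value (x - y) (r - s)"
  using qt_value_intros(5)[OF _ qt_value_intros(7), of x r y s] by simp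

lemma qt_value_power: "qt_value x r \<Longrightarrow> qt_value (x ^ k) (r ^ k)"
  by (induction k) (auto intro: qt_value_intros)

lemma qt_value_of_nat: "qt_value (of_nat k) (of_nat k)"
  by (induction k) (auto intro: qt_value_intros)

lemma qt_value_sum: "(\<And>i. i \<in> I \<Longrightarrow> qt_value (f i) (g i)) \<Longrightarrow> qt_value (\<Sum>i\<in>I. f i) (\<Sum>i\<in>I. g i)"
  by (induction I rule: infinite_finite_induct) (auto intro: qt_value_intros)

lemma qt_value_prod: "(\<And>i. i \<in> I \<Longrightarrow> qt_value (f i) (g i)) \<Longrightarrow> qt_value (\<Prod>i\<in>I. f i) (\<Prod>i\<in>I. g i)"
  by (induction I rule: infinite_finite_induct) (auto intro: qt_value_intros)

lemma qt_value_factor: "qt_value (t ^ i + q ^ j) 2"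
  using qt_value_intros(5)[OF qt_value_power[OF qt_value_intros(3)] qt_value_power[OF qt_value_intros(4)]]
  by simp

lemma signed_weight_eq:
  assumes "n \<ge> 1" "\<gamma> \<in> compositions n"
  shows "2 * (\<Prod>i\<in>{1..<n}. if i \<in> descents \<gamma> then 2 else - 1) = signed_weight (parts \<gamma>)"
proof -
  let ?D = "descents \<gamma>"
  have sz: "size \<gamma> = n" using assms by (simp add: compositions_def)
  have sub: "?D \<subseteq> {1..<n}" using descents_subset[of \<gamma>] sz by simp
  have "signed_weight xs = (- 2) ^ length xs * (- 1) ^ sum_list xs" for xs
    by (induction xs) (simp_all add: signed_weight_def power_add)
  then have "signed_weight (parts \<gamma>) = (- 2) ^ len \<gamma> * (- 1) ^ n"
    using sz by (simp add: len_def size_composition_def)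
  \<comment> \<open>\<open>n\<close> is 1 plus the numbers of descents and non-descents. The signs
    of \<open>(- 2) ^ (card ?D + 1)\<close> and \<open>(- 1) ^ (1 + card ?D)\<close> then
    cancel.\<close>
  also have "\<dots> = (- 2) ^ (card ?D + 1) * (- 1) ^ (1 + card ?D + card ({1..<n} - ?D))"
    using assms sz card_mono[OF _ sub] card_Diff_subset[OF finite_descents sub] by (simp add: len_eq)
  also have "\<dots> = 2 * (2 ^ card ?D * (- 1) ^ card ({1..<n} - ?D))"
    by (simp add: power_add power_mult_distrib[symmetric] mult.assoc[symmetric])
  also have "2 ^ card ?D * (- 1) ^ card ({1..<n} - ?D) =
      (\<Prod>i\<in>?D. 2) * (\<Prod>i\<in>{1..<n} - ?D. - 1 :: rat)" by simp
  also have "\<dots> = (\<Prod>i\<in>{1..<n}. if i \<in> ?D then 2 else - 1)"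
    using sub by (subst prod.If_cases) (auto simp: Int_absorb1 Diff_eq Collect_neg_eq[symmetric])
  finally show ?thesis ..
qed

theorem proposition25:
  fixes n :: nat
  assumes "n \<ge> 1"
  shows "qt_analog (hall (chi (nabla (nc_e n))) (sym_h 1 ^ n))
           (\<Sum>k = 1..n. card {f \<in> {1..n} \<rightarrow>\<^sub>E {1..k}. f ` {1..n} = {1..k}}) \<and>
         hall (chi (nabla (nc_e n))) (sym_e n) = (\<Prod>i = 1..n - 1. q ^ (n - i) + t ^ i) \<and>
         qt_analog (hall (chi (nabla (nc_e n))) (sym_e n)) (2 ^ (n - 1))"
proof -
  define W where "W i = t ^ i + q ^ (n - i)" for i
  define c where "c \<gamma> = (\<Prod>i\<in>{1..<n}. if i \<in> descents \<gamma> then W i else 1 - W i)" for \<gamma>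
  define d where "d \<gamma> = (\<Prod>i\<in>{1..<n}. if i \<in> descents \<gamma> then 2 else - 1 :: rat)" for \<gamma>
  have W: "qt_value (W i) 2" for i
    unfolding W_def by (rule qt_value_factor)
  have W': "qt_value (1 - W i) (- 1)" for i
    using qt_value_diff[OF qt_value_intros(2) W[of i]] by simp
  have chi: "chi (nabla (nc_e n)) = (\<Sum>\<gamma>\<in>compositions n. pscale (c \<gamma>) (prod_list (map sym_h (parts \<gamma>))))"
    using chi_nabla_nc_e[OF assms] by (simp only: c_def W_def)
  have sum_parts: "\<And>\<gamma>. \<gamma> \<in> compositions n \<Longrightarrow> sum_list (parts \<gamma>) = n"
    by (simp add: compositions_def size_composition_def)
  have c: "qt_value (c \<gamma>) (d \<gamma>)" for \<gamma>
    unfolding c_def d_def by (rule qt_value_prod) (use W W' in auto)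
  have h: "hall (chi (nabla (nc_e n))) (sym_h 1 ^ n) = (\<Sum>\<gamma>\<in>compositions n. c \<gamma> * of_nat (multinom (parts \<gamma>)))"
    unfolding chi by (rule hall_sum_prod_sym_h_h1_power) (rule sum_parts)
  have "qt_value (hall (chi (nabla (nc_e n))) (sym_h 1 ^ n))
      (\<Sum>\<gamma>\<in>compositions n. d \<gamma> * of_nat (multinom (parts \<gamma>)))"
    unfolding h by (intro qt_value_sum qt_value_intros(6) c qt_value_of_nat)
  also have "(\<Sum>\<gamma>\<in>compositions n. d \<gamma> * of_nat (multinom (parts \<gamma>))) = signed_sum n / 2"
    unfolding signed_sum_def sum_divide_distrib
    by (rule sum.cong[OF refl]) (simp add: signed_weight_eq[OF assms, symmetric] d_def)
  also have "\<dots> = of_nat (preferential_arrangements n)"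
    by (simp add: signed_sum_eq[OF assms])
  also have "preferential_arrangements n = (\<Sum>k = 1..n. surj_count n k)"
    unfolding preferential_arrangements_def using assms by (intro sum.mono_neutral_right) (auto simp: not_le)
  also have "\<dots> = (\<Sum>k = 1..n. card {f \<in> {1..n} \<rightarrow>\<^sub>E {1..k}. f ` {1..n} = {1..k}})"
    using card_surjections[of "{1..n}"] by (simp add: surjections_def)
  finally have 1: "qt_analog (hall (chi (nabla (nc_e n))) (sym_h 1 ^ n))
      (\<Sum>k = 1..n. card {f \<in> {1..n} \<rightarrow>\<^sub>E {1..k}. f ` {1..n} = {1..k}})"
    by (simp only: qt_analog_def qt_value_def)
  have "hall (chi (nabla (nc_e n))) (sym_e n) =
      (\<Sum>\<gamma>\<in>compositions n. if \<forall>k\<in>set (parts \<gamma>). k \<le> 1 then c \<gamma> else 0)"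
    unfolding chi by (rule hall_sum_prod_sym_h_e) (rule sum_parts)
  \<comment> \<open>Replacing \<open>1 - W i\<close> by 0 expresses that only the composition into
    ones survives, in the product form summed by \<open>sum_compositions_prod\<close>.\<close>
  also have "\<dots> = (\<Sum>\<gamma>\<in>compositions n. \<Prod>i\<in>{1..<n}. if i \<in> descents \<gamma> then W i else 0)"
  proof (rule sum.cong[OF refl])
    fix \<gamma> assume "\<gamma> \<in> compositions n"
    then have sz: "size \<gamma> = n" by (simp add: compositions_def)
    show "(if \<forall>k\<in>set (parts \<gamma>). k \<le> 1 then c \<gamma> else 0) = (\<Prod>i\<in>{1..<n}. if i \<in> descents \<gamma> then W i else 0)"
    proof (cases "descents \<gamma> = {1..<n}")
      case True
      then show ?thesis
        unfolding parts_le_1_iff[OF sz] c_def by simp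
    next
      case False
      moreover have "descents \<gamma> \<subseteq> {1..<n}" using descents_subset[of \<gamma>] sz by simp
      ultimately obtain i where "i \<in> {1..<n}" "i \<notin> descents \<gamma>" by blast
      then have "(\<Prod>i\<in>{1..<n}. if i \<in> descents \<gamma> then W i else 0) = 0"
        by (intro prod_zero) (auto intro!: bexI[of _ i])
      with False show ?thesis unfolding parts_le_1_iff[OF sz] by simp
    qed
  qed
  also have "\<dots> = (\<Prod>i\<in>{1..<n}. W i)"
    using sum_compositions_prod[of "\<lambda>i b. if b then W i else 0" n] by simp
  finally have e: "hall (chi (nabla (nc_e n))) (sym_e n) = (\<Prod>i\<in>{1..<n}. W i)" .
  have "{1..<n} = {1..n - 1}" by auto
  with e have 2: "hall (chi (nabla (nc_e n))) (sym_e n) = (\<Prod>i = 1..n - 1. q ^ (n - i) + t ^ i)"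
    by (simp add: W_def add.commute)
  have "qt_value (\<Prod>i\<in>{1..<n}. W i) (\<Prod>i\<in>{1..<n}. 2)"
    by (rule qt_value_prod) (rule W)
  then have 3: "qt_analog (hall (chi (nabla (nc_e n))) (sym_e n)) (2 ^ (n - 1))"
    unfolding e by (simp add: qt_analog_def qt_value_def)
  from 1 2 3 show ?thesis by blast
qed

end
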